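(* Let $\lambda\in(0,1)$. Then $$\dim_{hyp}(f_\lambda)=\dim_H(\mathrm{Bas}_{1-\lambda})=t_1,$$ where $$t_1=\begin{cases}1&\text{if }\lambda\in(0,1/2],\\ t_2&\text{if }\lambda\in[1/2,1),\end{cases}\qquad t_2=-\frac{\log4}{\log[\lambda(1-\lambda)]}.$$
   Context: The map $f_\lambda$. Fix $\lambda\in(0,1)$. Let $I=[0,1]$, $c=\frac12$ and $\hat x=1-x$. Put $z_{-1}=0$, $z_j=\frac12(1-\lambda^{j+1})$ for $j\ge 0$, $W_j=(z_{j-1},z_j)$ and $\hat W_j=(\hat z_j,\hat z_{j-1})$. Let $\kappa_0=\kappa_1=\frac1{1-\lambda}$, $\kappa_2=\frac1\lambda$, $\kappa_3=\frac{1-\lambda}{\lambda}$, $\kappa_4=\frac{(1-\lambda)^3}{\lambda}$, and $\kappa_j=\frac{\lambda^{2j}(1-\lambda)^{2j}}{\lambda^{10}(1-\lambda)^5}$ for $j\ge5$. Then $f_\lambda:I\to I$ is the unique continuous map with $f_\lambda(0)=f_\lambda(1)=0$ that is affine with slope $\kappa_j$ on $W_j$ and with slope $-\kappa_j$ on $\hat W_j$ for every $j\ge0$; it is unimodal with critical point $c$. $\mathrm{Bas}_\lambda=\{x\in I: f_\lambda^n(x)\to\omega(c)\text{ as }n\to\infty\}$ is the basin of $\omega(c)$, where $\omega(c)$ is the omega-limit set of $c$ under $f_\lambda$ (so $\mathrm{Bas}_{1-\lambda}$ is the basin for the map $f_{1-\lambda}$). The hyperbolic dimension $\dim_{hyp}(f_\lambda)$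 is the supremum of the Hausdorff dimensions of hyperbolic sets $\Lambda$, i.e. sets $\Lambda$ that are $f_\lambda$-invariant, compact and bounded away from $c$. $\dim_H$ is Hausdorff dimension. *)

theory Defs
  imports "HOL-Analysis.Analysis"
begin

section \<open>The maps $f_\lambda$\<close>

text \<open>
  The index is shifted by one: \<open>zpt lam n\<close> is $z_{n-1}$, so that \<open>zpt lam 0 = 0\<close> is $z_{-1}$
  and \<open>W lam j\<close> is $(z_{j-1}, z_j)$.
\<close>

definition zpt :: "real \<Rightarrow> nat \<Rightarrow> real" where
  "zpt lam n = (1 - lam ^ n) / 2"

definition W :: "real \<Rightarrow> nat \<Rightarrow> real set" where
  "W lam j = {zpt lam j <..< zpt lam (Suc j)}"

definition W_hat :: "real \<Rightarrow> nat \<Rightarrow> real set" where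
  "W_hat lam j = {1 - zpt lam (Suc j) <..< 1 - zpt lam j}"

definition kappa :: "real \<Rightarrow> nat \<Rightarrow> real" where
  "kappa lam j =
    (if j \<le> 1 then 1 / (1 - lam)
     else if j = 2 then 1 / lam
     else if j = 3 then (1 - lam) / lam
     else if j = 4 then (1 - lam) ^ 3 / lam
     else (lam ^ (2 * j) * (1 - lam) ^ (2 * j)) / (lam ^ 10 * (1 - lam) ^ 5))"

definition affine_with_slope_on :: "real \<Rightarrow> real set \<Rightarrow> (real \<Rightarrow> real) \<Rightarrow> bool" where
  "affine_with_slope_on a S f \<longleftrightarrow> (\<exists>b. \<forall>x\<in>S. f x = a * x + b)"

definition is_fmap :: "real \<Rightarrow> (real \<Rightarrow> real) \<Rightarrow> bool" where
  "is_fmap lam f \<longleftrightarrow>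
     f \<in> {0..1} \<rightarrow> {0..1} \<and> continuous_on {0..1} f \<and> f 0 = 0 \<and> f 1 = 0 \<and>
     (\<forall>j. affine_with_slope_on (kappa lam j) (W lam j) f \<and>
          affine_with_slope_on (- kappa lam j) (W_hat lam j) f)"

text \<open>
  As a total function on the reals the map is set to 0 off the unit interval. This choice is
  immaterial, since only orbits starting in the unit interval are considered. Existence and
  uniqueness are shown in \<open>fmap_ex1\<close> below.
\<close>

definition fmap :: "real \<Rightarrow> real \<Rightarrow> real" where
  "fmap lam = (THE f. is_fmap lam f \<and> (\<forall>x. x \<notin> {0..1} \<longrightarrow> f x = 0))"

subsection \<open>Existence and uniqueness\<close>

lemma zpt_mono:
  assumes "0 < lam" "lam < 1" "i \<le> j"
  shows "zpt lam i \<le> zpt lam j"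
  using assms power_decreasing[of i j lam] by (simp add: zpt_def)

lemma zpt_strict:
  assumes "0 < lam" "lam < 1"
  shows "zpt lam j < zpt lam (Suc j)"
  using assms power_strict_decreasing[of j "Suc j" lam] by (simp add: zpt_def)

lemma zpt_bounds:
  assumes "0 < lam" "lam < 1"
  shows "0 \<le> zpt lam j" "zpt lam j < 1/2"
  using assms power_le_one[of lam j] by (simp_all add: zpt_def)

lemma zpt_tendsto:
  assumes "0 < lam" "lam < 1"
  shows "zpt lam \<longlonglongrightarrow> 1/2"
proof -
  have "(\<lambda>n. (1 - lam ^ n) / 2) \<longlonglongrightarrow> (1 - 0) / 2"
    using assms by (intro tendsto_intros LIMSEQ_realpow_zero) auto
  then show ?thesis by (simp add: zpt_def[abs_def])
qed

lemma half_unique: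
  fixes d :: "real \<Rightarrow> real"
  assumes lam: "0 < lam" "lam < 1"
    and cont: "continuous_on {0..1/2} d" and d0: "d 0 = 0"
    and const: "\<And>j. \<exists>k. \<forall>x\<in>W lam j. d x = k"
    and x: "x \<in> {0..1/2}"
  shows "d x = 0"
proof -
  have main: "\<forall>x\<in>{0..zpt lam j}. d x = 0" for j
  proof (induction j)
    case 0
    then show ?case using d0 by (simp add: zpt_def)
  next
    case (Suc j)
    let ?a = "zpt lam j" and ?b = "zpt lam (Suc j)"
    have ab: "?a < ?b" "0 \<le> ?a" "?b < 1/2" using lam zpt_strict zpt_bounds by auto
    obtain k where k: "\<And>x. x \<in> {?a<..<?b} \<Longrightarrow> d x = k"
      using const[of j] unfolding W_def by blast
    have cl: "closure {?a<..<?b} = {?a..?b}" using ab by simp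
    have "continuous_on (closure {?a<..<?b}) d"
      using cont ab unfolding cl by (rule_tac continuous_on_subset) auto
    then have all: "d y = k" if "y \<in> {?a..?b}" for y
      using continuous_constant_on_closure[of "{?a<..<?b}" d k y] k that cl by auto
    have "d ?a = 0" using Suc ab by auto
    then have "k = 0" using all[of ?a] ab by auto
    then show ?case using Suc all by (metis atLeastAtMost_iff linear)
  qed
  have lt: "d y = 0" if y: "y \<in> {0<..<1/2}" for y
  proof -
    have "eventually (\<lambda>n. y < zpt lam n) sequentially"
      using order_tendstoD(1)[OF zpt_tendsto[OF lam], of y] y by auto
    then obtain n where "y < zpt lam n" by (auto simp: eventually_sequentially)
    then show ?thesis using main[of n] y by auto
  qed
  have cl: "closure {0<..<1/2::real} = {0..1/2}" by simp
  show ?thesis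
    using continuous_constant_on_closure[of "{0<..<1/2}" d 0 x] lt x cont unfolding cl by auto
qed

lemma is_fmap_unique:
  assumes lam: "0 < lam" "lam < 1" and f: "is_fmap lam f" and g: "is_fmap lam g"
    and x: "x \<in> {0..1}"
  shows "f x = g x"
proof -
  define d where "d x = f x - g x" for x
  have cont: "continuous_on {0..1} d"
    using f g unfolding d_def is_fmap_def by (auto intro!: continuous_intros)
  have W: "\<exists>k. \<forall>x\<in>W lam j. d x = k" for j
  proof -
    obtain b b' where "\<forall>x\<in>W lam j. f x = kappa lam j * x + b" "\<forall>x\<in>W lam j. g x = kappa lam j * x + b'"
      using f g unfolding is_fmap_def affine_with_slope_on_def by blast
    then have "\<forall>x\<in>W lam j. d x = b - b'" by (simp add: d_def)
    then show ?thesis by blast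
  qed
  have Wh: "\<exists>k. \<forall>x\<in>W lam j. d (1 - x) = k" for j
  proof -
    obtain b b' where b: "\<forall>x\<in>W_hat lam j. f x = - kappa lam j * x + b"
        "\<forall>x\<in>W_hat lam j. g x = - kappa lam j * x + b'"
      using f g unfolding is_fmap_def affine_with_slope_on_def by blast
    have "1 - x \<in> W_hat lam j" if "x \<in> W lam j" for x
      using that by (auto simp: W_def W_hat_def)
    then have "\<forall>x\<in>W lam j. d (1 - x) = b - b'" using b by (simp add: d_def)
    then show ?thesis by blast
  qed
  have "d x = 0"
  proof (cases "x \<le> 1/2")
    case True
    have "continuous_on {0..1/2} d" by (rule continuous_on_subset[OF cont]) auto
    moreover have "d 0 = 0" using f g by (simp add: d_def is_fmap_def)
    ultimately show ?thesis using half_unique[OF lam, of d x] W x True by auto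
  next
    case False
    have "continuous_on {0..1/2} (\<lambda>x. d (1 - x))"
      by (rule continuous_on_compose2[OF cont]) (auto intro!: continuous_intros)
    moreover have "d (1 - 0) = 0" using f g by (simp add: d_def is_fmap_def)
    ultimately have "d (1 - (1 - x)) = 0"
      using half_unique[OF lam, of "\<lambda>x. d (1 - x)" "1 - x"] Wh x False by auto
    then show ?thesis by simp
  qed
  then show ?thesis by (simp add: d_def)
qed

lemma kappa_mass:
  assumes lam: "0 < lam" "lam < 1"
  defines "m \<equiv> \<lambda>j. kappa lam j * (zpt lam (Suc j) - zpt lam j)"
  shows "summable m" "suminf m \<le> 1" "m j \<ge> 0"
proof -
  define mu where "mu = 1 - lam"
  define q where "q = lam ^ 3 * mu ^ 2"
  define C where "C = lam ^ 5 * mu ^ 6 / 2"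
  have mu: "0 < mu" "mu < 1" and lm: "lam = 1 - mu" using lam by (auto simp: mu_def)
  have len: "zpt lam (Suc j) - zpt lam j = lam ^ j * mu / 2" for j
    by (simp add: zpt_def mu_def field_simps)
  have m_eq: "m j = kappa lam j * (lam ^ j * mu / 2)" for j by (simp add: m_def len)
  have kn: "kappa lam j \<ge> 0" for j using lam by (simp add: kappa_def)
  show "m j \<ge> 0" using kn[of j] lam mu by (simp add: m_eq)
  have tail: "m (j + 5) = C * q ^ j" for j
  proof -
    have "m (j + 5) = (lam ^ (2 * (j+5)) * mu ^ (2 * (j+5))) / (lam ^ 10 * mu ^ 5) * (lam ^ (j+5) * mu / 2)"
      by (simp add: m_eq kappa_def mu_def)
    also have "\<dots> = C * q ^ j"
    proof -
      have "lam ^ (2 * (j+5)) = lam ^ 10 * lam ^ (2*j)" "mu ^ (2 * (j+5)) = mu ^ 5 * mu ^ 5 * mu ^ (2*j)"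
        by (simp_all add: power_add[symmetric] add.commute)
      moreover have "q ^ j = lam ^ (2*j) * lam ^ j * mu ^ (2*j)"
        by (simp add: q_def power_mult_distrib power_mult[symmetric] power_add[symmetric])
      ultimately show ?thesis using lam mu
        by (simp add: C_def power_add field_simps eval_nat_numeral)
    qed
    finally show ?thesis .
  qed
  have lmu: "lam * mu \<le> 1/4"
    using zero_le_power2[of "lam - 1/2"] by (simp add: mu_def power2_eq_square algebra_simps)
  have q0: "0 \<le> q" using lam mu by (simp add: q_def)
  have q1: "q \<le> 1/2"
  proof -
    have "q = (lam * mu) * (lam * lam * mu)" by (simp add: q_def eval_nat_numeral)
    also have "\<dots> \<le> (1/4) * 1"
      using lmu lam mu by (intro mult_mono mult_le_one) auto
    finally show ?thesis by simp
  qed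
  have sums_tail: "(\<lambda>j. m (j + 5)) sums (C * (1 / (1 - q)))"
    unfolding tail using q0 q1 by (intro sums_mult geometric_sums) auto
  then show sm: "summable m" using summable_iff_shift sums_summable by blast
  have "suminf m = (\<Sum>j. m (j + 5)) + (\<Sum>i<5. m i)"
    using suminf_split_initial_segment[OF sm] by blast
  also have "(\<Sum>j. m (j + 5)) = C * (1 / (1 - q))" using sums_tail sums_unique by metis
  also have "(\<Sum>i<5. m i) = 1 - (mu ^ 3 * (1 + lam) - lam ^ 3 * mu ^ 4) / 2"
  proof -
    have "m 0 = 1 / 2" "m 1 = lam / 2" using mu by (simp_all add: m_eq kappa_def mu_def[symmetric])
    moreover have "m 2 = lam * mu / 2" "m 3 = lam^2 * mu^2 / 2" "m 4 = lam^3 * mu^4 / 2"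
      using lam by (simp_all add: m_eq kappa_def mu_def[symmetric] eval_nat_numeral)
    moreover have "(\<Sum>i<5. m i) = m 0 + m 1 + m 2 + m 3 + m 4" by (simp add: eval_nat_numeral)
    ultimately have "(\<Sum>i<5. m i) = 1/2 + lam/2 + lam*mu/2 + lam^2*mu^2/2 + lam^3*mu^4/2" by simp
    also have "1/2 + lam/2 + lam*mu/2 + lam^2*mu^2/2 = 1 - mu ^ 3 * (1 + lam) / 2"
      unfolding mu_def by (simp add: field_simps eval_nat_numeral)
    finally show ?thesis by (simp add: field_simps)
  qed
  also have "C * (1 / (1 - q)) \<le> C * 2"
    using q1 lam mu by (intro mult_left_mono) (auto simp: C_def field_simps)
  also have "C * 2 + (1 - (mu ^ 3 * (1 + lam) - lam ^ 3 * mu ^ 4) / 2) \<le> 1"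
  proof -
    have a: "lam ^ 3 * mu \<le> 1" using lam mu by (intro mult_le_one) (auto simp: power_le_one)
    have "(lam * mu) * (lam ^ 3 * mu ^ 2) \<le> (1/4) * 1"
      using lmu lam mu by (intro mult_mono mult_le_one) (auto simp: power_le_one)
    then have "lam * ((lam * mu) * (lam ^ 3 * mu ^ 2)) \<le> lam * (1/4)"
      using lam by (intro mult_left_mono) auto
    then have b: "2 * (lam ^ 5 * mu ^ 3) \<le> lam"
      using lam by (simp add: eval_nat_numeral mult_ac)
    have "mu ^ 3 * (lam ^ 3 * mu + 2 * (lam ^ 5 * mu ^ 3)) \<le> mu ^ 3 * (1 + lam)"
      using a b mu by (intro mult_left_mono) auto
    then show ?thesis by (simp add: C_def algebra_simps eval_nat_numeral)
  qed
  finally show "suminf m \<le> 1" by simp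
qed

lemma is_fmap_exists:
  assumes lam: "0 < lam" "lam < 1"
  shows "\<exists>f. is_fmap lam f"
proof -
  define m where "m = (\<lambda>j. kappa lam j * (zpt lam (Suc j) - zpt lam j))"
  define u where "u j t = kappa lam j * max 0 (min t (zpt lam (Suc j)) - zpt lam j)" for j t
  define h where "h t = (\<Sum>j. u j t)" for t
  define f where "f x = h (min x (1 - x))" for x
  note mass = kappa_mass[OF lam, folded m_def]
  have kn: "kappa lam j \<ge> 0" for j using lam by (simp add: kappa_def)
  have u0: "0 \<le> u j t" and um: "u j t \<le> m j" for j t
    using kn[of j] zpt_strict[OF lam, of j] unfolding u_def m_def
    by (auto intro!: mult_left_mono)
  have su: "summable (\<lambda>j. u j t)" for t
    by (rule summable_comparison_test'[OF mass(1), of 0]) (use u0 um in auto)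
  have h0: "0 \<le> h t" for t unfolding h_def using u0 su by (intro suminf_nonneg) auto
  have h1: "h t \<le> 1" for t
  proof -
    have "h t \<le> suminf m" unfolding h_def using um su mass(1) by (intro suminf_le) auto
    then show ?thesis using mass(2) by simp
  qed
  have "uniform_limit UNIV (\<lambda>n t. \<Sum>j<n. u j t) (\<lambda>t. \<Sum>j. u j t) sequentially"
    by (rule Weierstrass_m_test[OF _ mass(1)]) (use u0 um in auto)
  then have hc: "continuous_on UNIV h"
    unfolding h_def[abs_def]
    by (rule uniform_limit_theorem[rotated])
       (auto intro!: always_eventually continuous_intros simp: u_def)
  have fc: "continuous_on {0..1} f"
    unfolding f_def by (rule continuous_on_compose2[OF hc]) (auto intro!: continuous_intros)
  have hW: "h t = kappa lam j * t + ((\<Sum>i<j. m i) - kappa lam j * zpt lam j)" if t: "t \<in> W lam j" for j t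
  proof -
    have z: "u i t = 0" if "i \<notin> {..j}" for i
      using that t zpt_mono[OF lam, of "Suc j" i] by (auto simp: u_def W_def)
    have "h t = (\<Sum>i\<le>j. u i t)" unfolding h_def by (rule suminf_finite) (use z in auto)
    also have "\<dots> = (\<Sum>i<j. u i t) + u j t" by (simp add: lessThan_Suc_atMost[symmetric])
    also have "(\<Sum>i<j. u i t) = (\<Sum>i<j. m i)"
    proof (rule sum.cong)
      fix i assume "i \<in> {..<j}"
      then have "zpt lam (Suc i) \<le> t" using t zpt_mono[OF lam, of "Suc i" j] by (auto simp: W_def)
      then show "u i t = m i" using zpt_strict[OF lam, of i] by (simp add: u_def m_def)
    qed simp
    also have "u j t = kappa lam j * (t - zpt lam j)" using t by (simp add: u_def W_def)
    finally show ?thesis by (simp add: algebra_simps)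
  qed
  have "u j 0 = 0" for j using zpt_bounds[OF lam] by (simp add: u_def)
  then have "h 0 = 0" by (simp add: h_def)
  then have f01: "f 0 = 0" "f 1 = 0" by (simp_all add: f_def)
  have aff: "affine_with_slope_on (kappa lam j) (W lam j) f" for j
    unfolding affine_with_slope_on_def
  proof (intro exI ballI)
    fix x assume x: "x \<in> W lam j"
    then have "f x = h x" using zpt_bounds[OF lam, of "Suc j"] by (simp add: f_def W_def)
    then show "f x = kappa lam j * x + ((\<Sum>i<j. m i) - kappa lam j * zpt lam j)" using hW[OF x] by simp
  qed
  have aff': "affine_with_slope_on (- kappa lam j) (W_hat lam j) f" for j
    unfolding affine_with_slope_on_def
  proof (intro exI ballI)
    fix x assume x: "x \<in> W_hat lam j"
    then have "f x = h (1 - x)" using zpt_bounds[OF lam, of "Suc j"] by (simp add: f_def W_hat_def min_def)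
    moreover have "1 - x \<in> W lam j" using x by (auto simp: W_hat_def W_def)
    ultimately show "f x = - kappa lam j * x + (kappa lam j + ((\<Sum>i<j. m i) - kappa lam j * zpt lam j))"
      using hW[of "1 - x" j] by (simp add: algebra_simps)
  qed
  have "is_fmap lam f"
    unfolding is_fmap_def using fc f01 aff aff' h0 h1 by (auto simp: f_def)
  then show ?thesis by blast
qed

lemma is_fmap_cong:
  assumes lam: "0 < lam" "lam < 1" and eq: "\<And>x. x \<in> {0..1} \<Longrightarrow> f x = g x" and f: "is_fmap lam f"
  shows "is_fmap lam g"
proof -
  have sub: "W lam j \<subseteq> {0..1}" "W_hat lam j \<subseteq> {0..1}" for j
    using zpt_bounds[OF lam, of j] zpt_bounds[OF lam, of "Suc j"] by (auto simp: W_def W_hat_def)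
  have *: "affine_with_slope_on a S g" if "affine_with_slope_on a S f" "S \<subseteq> {0..1}" for a S
    using that eq unfolding affine_with_slope_on_def by (metis subsetD)
  have "continuous_on {0..1} g"
    using f eq continuous_on_cong[of "{0..1}" "{0..1}" f g] by (auto simp: is_fmap_def)
  moreover have "g \<in> {0..1} \<rightarrow> {0..1}" using f eq by (fastforce simp: is_fmap_def Pi_iff)
  moreover have "g 0 = 0" "g 1 = 0" using f eq[of 0] eq[of 1] by (auto simp: is_fmap_def)
  ultimately show ?thesis using f sub * unfolding is_fmap_def by blast
qed

theorem fmap_ex1:
  assumes lam: "0 < lam" "lam < 1"
  shows "\<exists>!f. is_fmap lam f \<and> (\<forall>x. x \<notin> {0..1} \<longrightarrow> f x = 0)"
proof -
  obtain f where f: "is_fmap lam f" using is_fmap_exists[OF lam] by blast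
  define g where "g x = (if x \<in> {0..1} then f x else 0)" for x
  have "is_fmap lam g" by (rule is_fmap_cong[OF lam _ f]) (simp add: g_def)
  show ?thesis
  proof (rule ex1I[of _ g])
    show "is_fmap lam g \<and> (\<forall>x. x \<notin> {0..1} \<longrightarrow> g x = 0)"
      using \<open>is_fmap lam g\<close> by (simp add: g_def)
    fix k assume k: "is_fmap lam k \<and> (\<forall>x. x \<notin> {0..1} \<longrightarrow> k x = 0)"
    show "k = g"
    proof
      fix x
      show "k x = g x"
        using is_fmap_unique[OF lam, of k g x] k \<open>is_fmap lam g\<close> by (cases "x \<in> {0..1}") (auto simp: g_def)
    qed
  qed
qed

lemma fmap_is_fmap:
  assumes "0 < lam" "lam < 1"
  shows "is_fmap lam (fmap lam)" "x \<notin> {0..1} \<Longrightarrow> fmap lam x = 0"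
  using theI'[OF fmap_ex1[OF assms]] unfolding fmap_def by blast+

section \<open>Omega-limit sets and the basin\<close>

definition omega_limit :: "('a::topological_space \<Rightarrow> 'a) \<Rightarrow> 'a \<Rightarrow> 'a set" where
  "omega_limit f x = (\<Inter>N. closure {(f ^^ n) x | n. N \<le> n})"

text \<open>
  Convergence of an orbit to a set means that the distance to the set tends to 0. Here the
  omega-limit set is nonempty, because the orbit of $c = 1/2$ stays in the compact unit
  interval; so the convention \<open>infdist x {} = 0\<close> plays no role.
\<close>

definition Bas :: "real \<Rightarrow> real set" where
  "Bas lam = {x \<in> {0..1}. (\<lambda>n. infdist ((fmap lam ^^ n) x) (omega_limit (fmap lam) (1/2))) \<longlonglongrightarrow> 0}"

section \<open>Hausdorff dimension\<close>

text \<open>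
  Only exponents \<open>s > 0\<close> are meant: \<open>0 powr 0 = 0\<close>, so for \<open>s = 0\<close> this is not the counting
  measure. Nothing is lost for the dimension: if the s-dimensional measure of a set is 0, then so
  is its t-dimensional measure for every t > s. Boundedness of the covering sets is required since
  \<open>diameter\<close> is meaningless on unbounded sets; finite covers are padded with empty sets,
  which have diameter 0.
\<close>

definition hausdorff_content :: "real \<Rightarrow> real \<Rightarrow> 'a::metric_space set \<Rightarrow> ennreal" where
  "hausdorff_content s \<delta> A =
     (INF U \<in> {U :: nat \<Rightarrow> 'a set. A \<subseteq> (\<Union>i. U i) \<and> (\<forall>i. bounded (U i) \<and> diameter (U i) \<le> \<delta>)}.
        \<Sum>i. ennreal (diameter (U i) powr s))"

definition hausdorff_measure :: "real \<Rightarrow> 'a::metric_space set \<Rightarrow> ennreal" where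
  "hausdorff_measure s A = (SUP \<delta> \<in> {0<..}. hausdorff_content s \<delta> A)"

definition hausdorff_dim :: "'a::metric_space set \<Rightarrow> ereal" where
  "hausdorff_dim A = (INF s \<in> {s. 0 < s \<and> hausdorff_measure s A = 0}. ereal s)"

section \<open>Hyperbolic dimension\<close>

definition hyperbolic_set :: "(real \<Rightarrow> real) \<Rightarrow> real set \<Rightarrow> bool" where
  "hyperbolic_set f \<Lambda> \<longleftrightarrow>
     \<Lambda> \<subseteq> {0..1} \<and> f ` \<Lambda> \<subseteq> \<Lambda> \<and> compact \<Lambda> \<and> (\<exists>\<epsilon>>0. \<forall>x\<in>\<Lambda>. \<epsilon> \<le> \<bar>x - 1/2\<bar>)"

definition dim_hyp :: "(real \<Rightarrow> real) \<Rightarrow> ereal" where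
  "dim_hyp f = (SUP \<Lambda> \<in> {\<Lambda>. hyperbolic_set f \<Lambda>}. hausdorff_dim \<Lambda>)"

section \<open>The dimension values\<close>

definition t2 :: "real \<Rightarrow> real" where
  "t2 lam = - (ln 4 / ln (lam * (1 - lam)))"

definition t1 :: "real \<Rightarrow> real" where
  "t1 lam = (if lam \<le> 1/2 then 1 else t2 lam)"

lemma t2_half: "t2 (1/2) = 1"
  by (simp add: t2_def ln_div)

end

theory Submission
  imports Defs "HOL-Number_Theory.Fib"
begin

text \<open>
  In the coordinate $y = |2x - 1|$ the map $f_\lambda$ becomes a map \<open>g\<close> with critical point 0. Put
  $r = \lambda(1-\lambda)$ and $V_j = (\lambda^{j+1}, \lambda^j]$. For $j \ge 2$ a Fibonacci iterate of \<open>g\<close> maps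
  $V_j$ affinely onto $[0, \lambda^{j-1})$ with slope $-1/r$. So the induced map \<open>G\<close> is a Markov map with
  letters \<open>j\<close>, and a letter decreases by at most one at each step. Weights $v_k = \alpha^k$ satisfy
  $r^t \sum_{k \ge j-1} v_k = v_j$ if and only if $r^t = \alpha(1-\alpha)$; the extremal case
  $\alpha = 1/2$ gives $r^{t_2} = 1/4$.

  Covering by cylinders with the weights $2^{-k}$ bounds the dimension of hyperbolic sets by $t_2$ if
  $\lambda \ge 1/2$, and that of the points whose letters are eventually at least 2 if $\lambda \le 1/2$.
  Basin points are of the latter kind: along the orbit of the critical point the letters grow linearly up
  to a bounded error, and a basin point that comes back to letter 1 would be shadowed for a long
  time by a point of that orbit.

  Lower bounds come from self-similar sets. There are about $4^n$ words of length \<open>n\<close>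
  without total displacement (hyperbolic sets) or with positive displacement (points of the basin),
  each contracting by $r^n$. Dimension 1 is approached by the words that are typical for Lebesgue measure.
\<close>

section \<open>Hausdorff dimension and self-similar sets\<close>

text \<open>Two side conditions decide where t2 is the answer. For hyperbolic sets the letters are
  bounded, so weights dominate diameters up to a constant, but the letters 0 and 1 contract only by
  \<mu> = 1 - \<lambda> and need \<mu>^t2 \<le> 1/2, that is \<lambda> \<ge> 1/2. In the basin these
  letters disappear, but letters are unbounded and \<lambda>^(j t2) \<le> 2^-j is needed, that is
  \<lambda> \<le> 1/2. On the other half of the parameters Lebesgue measure does the work: from a
  letter at least 2 the step x has probability \<mu> \<lambda>^x, and the mean displacement is
  \<lambda>/\<mu> - 1. So letters recur for \<lambda> < 1/2 and escape upwards for \<lambda> > 1/2.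
  The slopes of the map are those for which the Fibonacci iterate on [0, \<lambda>^j] is affine in
  \<open>g y\<close>, by induction: the flight of index j+1 is the flight of index j followed by
  passages through the letters j-2 and max 1 (j-3), and the slopes multiply as required
  (\<open>s_Suc\<close>). The obstacle is that these passages must really hit those two letter
  intervals; that is the inequality \<open>key_bound\<close>.\<close>

lemma hausdorff_content_le:
  assumes "A \<subseteq> (\<Union>i. U i)" "\<And>i. bounded (U i)" "\<And>i. diameter (U i) \<le> \<delta>"
  shows "hausdorff_content s \<delta> A \<le> (\<Sum>i. ennreal (diameter (U i) powr s))"
  unfolding hausdorff_content_def by (rule INF_lower) (use assms in auto)

lemma hausdorff_content_mono:
  assumes "A \<subseteq> B"
  shows "hausdorff_content s \<delta> A \<le> hausdorff_content s \<delta> B"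
  unfolding hausdorff_content_def by (rule INF_superset_mono) (use assms in auto)

lemma hausdorff_content_approx:
  assumes "hausdorff_content s \<delta> A < b"
  obtains U :: "nat \<Rightarrow> 'a::metric_space set" where "A \<subseteq> (\<Union>i. U i)" "\<And>i. bounded (U i)"
    "\<And>i. diameter (U i) \<le> \<delta>" "(\<Sum>i. ennreal (diameter (U i) powr s)) < b"
  using assms unfolding hausdorff_content_def INF_less_iff by auto

lemma hausdorff_content_UN:
  fixes A :: "nat \<Rightarrow> 'a::metric_space set"
  shows "hausdorff_content s \<delta> (\<Union>n. A n) \<le> (\<Sum>n. hausdorff_content s \<delta> (A n))"
proof (cases "(\<Sum>n. hausdorff_content s \<delta> (A n)) = \<infinity>")
  case False
  let ?c = "\<lambda>n. hausdorff_content s \<delta> (A n)"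
  have fin: "?c n < \<infinity>" for n
    using False ennreal_suminf_lessD[of ?c \<infinity> n] by (auto simp: less_top)
  show ?thesis
  proof (rule ennreal_le_epsilon)
    fix e :: real assume e: "0 < e"
    let ?e = "\<lambda>n. ennreal (e * (1/2) ^ Suc n)"
    have ex: "\<exists>U. A n \<subseteq> (\<Union>i. U i) \<and> (\<forall>i. bounded (U i)) \<and> (\<forall>i. diameter (U i) \<le> \<delta>)
        \<and> (\<Sum>i. ennreal (diameter (U i) powr s)) < ?c n + ?e n" for n
    proof -
      have "?c n + 0 < ?c n + ?e n"
        using fin[of n] e by (intro ennreal_add_left_cancel_less[THEN iffD2]) (auto simp: less_top)
      then have "?c n < ?c n + ?e n" by simp
      then obtain U where "A n \<subseteq> (\<Union>i. U i)" "\<And>i. bounded (U i)" "\<And>i. diameter (U i) \<le> \<delta>"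
        "(\<Sum>i. ennreal (diameter (U i) powr s)) < ?c n + ?e n"
        by (rule hausdorff_content_approx) blast
      then show ?thesis by blast
    qed
    define U where "U n = (SOME U. A n \<subseteq> (\<Union>i. U i) \<and> (\<forall>i. bounded (U i)) \<and> (\<forall>i. diameter (U i) \<le> \<delta>)
        \<and> (\<Sum>i. ennreal (diameter (U i) powr s)) < ?c n + ?e n)" for n
    have U: "\<And>n. A n \<subseteq> (\<Union>i. U n i)" "\<And>n i. bounded (U n i)"
      "\<And>n i. diameter (U n i) \<le> \<delta>" "\<And>n. (\<Sum>i. ennreal (diameter (U n i) powr s)) < ?c n + ?e n"
      using someI_ex[OF ex] unfolding U_def by blast+
    define V where "V k = case_prod U (prod_decode k)" for k
    have cov: "(\<Union>n. A n) \<subseteq> (\<Union>k. V k)"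
    proof
      fix x assume "x \<in> (\<Union>n. A n)"
      then obtain n i where "x \<in> U n i" using U(1) by blast
      then have "x \<in> V (prod_encode (n, i))" by (simp add: V_def)
      then show "x \<in> (\<Union>k. V k)" by blast
    qed
    have "hausdorff_content s \<delta> (\<Union>n. A n) \<le> (\<Sum>k. ennreal (diameter (V k) powr s))"
      by (rule hausdorff_content_le[OF cov]) (use U in \<open>auto simp: V_def split: prod.splits\<close>)
    also have "\<dots> = (\<Sum>n. \<Sum>i. ennreal (diameter (U n i) powr s))"
    proof -
      let ?f = "\<lambda>x. ennreal (diameter (U (fst x) (snd x)) powr s)"
      have "(\<Sum>k. ?f (prod_decode k)) = (\<Sum>n. \<Sum>i. ?f (n, i))"
        by (rule suminf_ennreal_2dimen) (rule refl)
      then show ?thesis unfolding V_def case_prod_beta by (simp only: fst_conv snd_conv)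
    qed
    also have "\<dots> \<le> (\<Sum>n. ?c n + ?e n)"
      using U(4) by (intro suminf_le) (auto simp: less_imp_le)
    also have "\<dots> = (\<Sum>n. ?c n) + (\<Sum>n. ?e n)" by (rule suminf_add[symmetric]) auto
    also have "(\<Sum>n. ?e n) = ennreal e"
    proof -
      have "(\<lambda>n. e * (1/2) ^ Suc n) sums (e * 1)" by (intro sums_mult power_half_series)
      then show ?thesis using e by (intro suminf_ennreal_eq) auto
    qed
    finally show "hausdorff_content s \<delta> (\<Union>n. A n) \<le> (\<Sum>n. ?c n) + ennreal e" .
  qed
qed simp

lemma hausdorff_content_lipschitz:
  fixes h :: "real \<Rightarrow> real"
  assumes \<rho>: "0 < \<rho>" and h: "\<And>u v. \<bar>h u - h v\<bar> \<le> \<rho> * \<bar>u - v\<bar>" and s: "0 \<le> s"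
  shows "hausdorff_content s (\<rho> * \<delta>) (h ` A) \<le> ennreal (\<rho> powr s) * hausdorff_content s \<delta> A"
proof -
  let ?c = "ennreal (\<rho> powr s)"
  \<comment> \<open>Dividing by the constant turns the claim into a lower bound for every cover sum,
    so \<open>INF_greatest\<close> applies and no infimum has to be moved through a product.\<close>
  have "hausdorff_content s (\<rho> * \<delta>) (h ` A) / ?c \<le> (\<Sum>i. ennreal (diameter (U i) powr s))"
    if U: "A \<subseteq> (\<Union>i. U i)" "\<And>i. bounded (U i)" "\<And>i. diameter (U i) \<le> \<delta>"
    for U :: "nat \<Rightarrow> real set"
  proof -
    have b: "bounded (h ` U i)" for i
    proof -
      have "uniformly_continuous_on (U i) h"
        by (rule lipschitz_on_uniformly_continuous[OF lipschitz_onI[where L = \<rho>]])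
           (use h \<rho> in \<open>auto simp: dist_real_def\<close>)
      then show ?thesis using bounded_uniformly_continuous_image U(2) by blast
    qed
    have d: "diameter (h ` U i) \<le> \<rho> * diameter (U i)" for i
    proof (rule diameter_le)
      show "h ` U i \<noteq> {} \<or> 0 \<le> \<rho> * diameter (U i)" using \<rho> U(2) by (simp add: diameter_ge_0)
      fix x y assume "x \<in> h ` U i" "y \<in> h ` U i"
      then obtain u v where uv: "u \<in> U i" "v \<in> U i" "x = h u" "y = h v" by auto
      have "\<bar>u - v\<bar> \<le> diameter (U i)"
        using diameter_bounded_bound[OF U(2) uv(1,2)] by (simp add: dist_real_def)
      then have "\<rho> * \<bar>u - v\<bar> \<le> \<rho> * diameter (U i)" using \<rho> by simp
      then show "norm (x - y) \<le> \<rho> * diameter (U i)" using h[of u v] uv by simp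
    qed
    have "hausdorff_content s (\<rho> * \<delta>) (h ` A) \<le> (\<Sum>i. ennreal (diameter (h ` U i) powr s))"
    proof (rule hausdorff_content_le)
      show "h ` A \<subseteq> (\<Union>i. h ` U i)" using U(1) by blast
      fix i show "diameter (h ` U i) \<le> \<rho> * \<delta>"
        using d[of i] U(3)[of i] \<rho> by (meson mult_le_cancel_left_pos order_trans)
    qed (rule b)
    also have "\<dots> \<le> (\<Sum>i. ?c * ennreal (diameter (U i) powr s))"
    proof (intro suminf_le)
      fix i
      have "diameter (h ` U i) powr s \<le> (\<rho> * diameter (U i)) powr s"
        using d s diameter_ge_0[OF b] by (intro powr_mono2) auto
      also have "\<dots> = \<rho> powr s * diameter (U i) powr s"
        using \<rho> diameter_ge_0[OF U(2)] by (simp add: powr_mult)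
      finally show "ennreal (diameter (h ` U i) powr s) \<le> ?c * ennreal (diameter (U i) powr s)"
        by (simp add: ennreal_mult[symmetric])
    qed auto
    also have "\<dots> = ?c * (\<Sum>i. ennreal (diameter (U i) powr s))" by simp
    finally have "hausdorff_content s (\<rho> * \<delta>) (h ` A) / ?c \<le> ?c * (\<Sum>i. ennreal (diameter (U i) powr s)) / ?c"
      by (rule divide_right_mono_ennreal)
    also have "\<dots> = (\<Sum>i. ennreal (diameter (U i) powr s))"
      using \<rho> by (subst mult.commute, intro ennreal_mult_divide_eq) auto
    finally show ?thesis .
  qed
  then have "hausdorff_content s (\<rho> * \<delta>) (h ` A) / ?c \<le> hausdorff_content s \<delta> A"
    by (subst (2) hausdorff_content_def) (auto intro!: INF_greatest)
  then have "?c * (hausdorff_content s (\<rho> * \<delta>) (h ` A) / ?c) \<le> ?c * hausdorff_content s \<delta> A"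
    by (rule mult_left_mono) simp
  moreover have "?c * (hausdorff_content s (\<rho> * \<delta>) (h ` A) / ?c) = hausdorff_content s (\<rho> * \<delta>) (h ` A)"
    using \<rho> unfolding ennreal_times_divide
    by (subst mult.commute, intro ennreal_mult_divide_eq) auto
  ultimately show ?thesis by simp
qed

lemma hausdorff_content_exponent:
  fixes A :: "'a::metric_space set"
  assumes "t \<le> s" "0 < \<delta>" "0 \<le> t"
  shows "hausdorff_content s \<delta> A \<le> ennreal (\<delta> powr (s - t)) * hausdorff_content t \<delta> A"
proof -
  let ?c = "ennreal (\<delta> powr (s - t))"
  have "hausdorff_content s \<delta> A / ?c \<le> (\<Sum>i. ennreal (diameter (U i) powr t))"
    if U: "A \<subseteq> (\<Union>i. U i)" "\<And>i. bounded (U i)" "\<And>i. diameter (U i) \<le> \<delta>"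
    for U :: "nat \<Rightarrow> 'a set"
  proof -
    have "hausdorff_content s \<delta> A \<le> (\<Sum>i. ennreal (diameter (U i) powr s))"
      by (rule hausdorff_content_le) (use U in auto)
    also have "\<dots> \<le> (\<Sum>i. ?c * ennreal (diameter (U i) powr t))"
    proof (intro suminf_le)
      fix i
      have "diameter (U i) powr s = diameter (U i) powr (s - t) * diameter (U i) powr t"
        by (simp add: powr_add[symmetric])
      also have "\<dots> \<le> \<delta> powr (s - t) * diameter (U i) powr t"
        using U(3) assms diameter_ge_0[OF U(2)] by (intro mult_right_mono powr_mono2) auto
      finally show "ennreal (diameter (U i) powr s) \<le> ?c * ennreal (diameter (U i) powr t)"
        by (simp add: ennreal_mult[symmetric])
    qed auto
    also have "\<dots> = ?c * (\<Sum>i. ennreal (diameter (U i) powr t))" by simp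
    finally have "hausdorff_content s \<delta> A / ?c \<le> ?c * (\<Sum>i. ennreal (diameter (U i) powr t)) / ?c"
      by (rule divide_right_mono_ennreal)
    also have "\<dots> = (\<Sum>i. ennreal (diameter (U i) powr t))"
      using assms by (subst mult.commute, intro ennreal_mult_divide_eq) auto
    finally show ?thesis .
  qed
  then have "hausdorff_content s \<delta> A / ?c \<le> hausdorff_content t \<delta> A"
    by (subst (2) hausdorff_content_def) (auto intro!: INF_greatest)
  then have "?c * (hausdorff_content s \<delta> A / ?c) \<le> ?c * hausdorff_content t \<delta> A"
    by (rule mult_left_mono) simp
  moreover have "?c * (hausdorff_content s \<delta> A / ?c) = hausdorff_content s \<delta> A"
    using assms unfolding ennreal_times_divide
    by (subst mult.commute, intro ennreal_mult_divide_eq) auto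
  ultimately show ?thesis by simp
qed

section \<open>Null sets and bounds for the dimension\<close>

text \<open>Vanishing of the content at each scale is equivalent to measure zero, and passes through
  unions, Lipschitz maps and changes of exponent without the supremum over \<delta>.\<close>

definition hausdorff_null :: "real \<Rightarrow> 'a::metric_space set \<Rightarrow> bool" where
  "hausdorff_null s A \<longleftrightarrow> (\<forall>\<delta>>0. hausdorff_content s \<delta> A = 0)"

lemma hausdorff_measure_eq_0_iff: "hausdorff_measure s A = 0 \<longleftrightarrow> hausdorff_null s A"
proof -
  have "hausdorff_measure s A = 0 \<longleftrightarrow> (\<forall>\<delta>\<in>{0<..}. hausdorff_content s \<delta> A \<le> 0)"
    unfolding hausdorff_measure_def le_zero_eq[symmetric] SUP_le_iff ..
  then show ?thesis by (auto simp: hausdorff_null_def)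
qed

lemma hausdorff_null_subset: "A \<subseteq> B \<Longrightarrow> hausdorff_null s B \<Longrightarrow> hausdorff_null s A"
  using hausdorff_content_mono[of A B s] unfolding hausdorff_null_def
  by (metis le_zero_eq)

lemma hausdorff_null_UN:
  assumes "\<And>n::nat. hausdorff_null s (A n)"
  shows "hausdorff_null s (\<Union>n. A n)"
  unfolding hausdorff_null_def
proof (intro allI impI)
  fix \<delta> :: real assume "0 < \<delta>"
  then have "(\<Sum>n. hausdorff_content s \<delta> (A n)) = 0" using assms by (simp add: hausdorff_null_def)
  then show "hausdorff_content s \<delta> (\<Union>n. A n) = 0"
    using hausdorff_content_UN[of s \<delta> A] by simp
qed

lemma hausdorff_null_singleton: "0 < s \<Longrightarrow> hausdorff_null s {x}"
  unfolding hausdorff_null_def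
proof (intro allI impI)
  fix \<delta> :: real assume "0 < \<delta>"
  then have "hausdorff_content s \<delta> {x} \<le> (\<Sum>i::nat. ennreal (diameter {x} powr s))"
    by (intro hausdorff_content_le) auto
  then show "hausdorff_content s \<delta> {x} = 0" by simp
qed

lemma hausdorff_null_Un:
  assumes "hausdorff_null s A" "hausdorff_null s B"
  shows "hausdorff_null s (A \<union> B)"
proof -
  have "hausdorff_null s (\<Union>n::nat. if n = 0 then A else B)"
    by (rule hausdorff_null_UN) (use assms in auto)
  then show ?thesis by (rule hausdorff_null_subset[rotated]) (auto split: if_splits intro: exI[of _ "1::nat"])
qed

lemma hausdorff_null_lipschitz:
  fixes h :: "real \<Rightarrow> real"
  assumes "hausdorff_null s A" "\<And>u v. \<bar>h u - h v\<bar> \<le> \<rho> * \<bar>u - v\<bar>" "0 < \<rho>" "0 \<le> s"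
  shows "hausdorff_null s (h ` A)"
  unfolding hausdorff_null_def
proof (intro allI impI)
  fix \<delta> :: real assume "0 < \<delta>"
  then show "hausdorff_content s \<delta> (h ` A) = 0"
    using hausdorff_content_lipschitz[of \<rho> h s "\<delta> / \<rho>" A] assms by (simp add: hausdorff_null_def)
qed

lemma hausdorff_null_exponent:
  assumes "hausdorff_null t A" "0 \<le> t" "t \<le> s"
  shows "hausdorff_null s A"
  unfolding hausdorff_null_def
proof (intro allI impI)
  fix \<delta> :: real assume "0 < \<delta>"
  then show "hausdorff_content s \<delta> A = 0"
    using hausdorff_content_exponent[of t s \<delta> A] assms by (simp add: hausdorff_null_def)
qed

lemma hausdorff_dim_le:
  assumes "0 \<le> t" "\<And>s. t < s \<Longrightarrow> hausdorff_null s A"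
  shows "hausdorff_dim A \<le> ereal t"
proof (rule ereal_le_epsilon2)
  fix e :: real assume e: "0 < e"
  have "hausdorff_dim A \<le> ereal (t + e)"
    unfolding hausdorff_dim_def using assms e
    by (intro INF_lower) (auto simp: hausdorff_measure_eq_0_iff)
  then show "hausdorff_dim A \<le> ereal t + ereal e" by simp
qed

lemma hausdorff_dim_ge:
  assumes "0 \<le> t" "\<not> hausdorff_null t A"
  shows "ereal t \<le> hausdorff_dim A"
  unfolding hausdorff_dim_def
proof (intro INF_greatest)
  fix s assume "s \<in> {s. 0 < s \<and> hausdorff_measure s A = 0}"
  then show "ereal t \<le> ereal s"
    using hausdorff_null_exponent[of s A t] assms by (force simp: hausdorff_measure_eq_0_iff)
qed

lemma hausdorff_dim_mono: "A \<subseteq> B \<Longrightarrow> hausdorff_dim A \<le> hausdorff_dim B"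
  unfolding hausdorff_dim_def
  by (intro INF_superset_mono) (auto simp: hausdorff_measure_eq_0_iff intro: hausdorff_null_subset)

text \<open>A mass distribution principle without a measure on E: a cover of E is pulled back by p
  to [0,1), where a set of diameter d ends up inside an interval of length 2 * C * d powr t, and the
  Lebesgue measure 1 has to be exhausted. So the content at scale 1 is at least 1 / (2 * C).\<close>

lemma hausdorff_dim_ge_inverse_holder:
  fixes p :: "real \<Rightarrow> real"
  assumes t: "0 < t" and C: "0 < C" and E: "\<And>u. u \<in> {0..<1} \<Longrightarrow> p u \<in> E"
    and H: "\<And>u v. u \<in> {0..<1} \<Longrightarrow> v \<in> {0..<1} \<Longrightarrow> \<bar>u - v\<bar> \<le> C * \<bar>p u - p v\<bar> powr t"
  shows "ereal t \<le> hausdorff_dim E"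
proof (rule hausdorff_dim_ge)
  have "ennreal (1 / (2 * C)) \<le> hausdorff_content t 1 E"
    unfolding hausdorff_content_def
  proof (intro INF_greatest)
    fix U :: "nat \<Rightarrow> real set"
    assume "U \<in> {U. E \<subseteq> (\<Union>i. U i) \<and> (\<forall>i. bounded (U i) \<and> diameter (U i) \<le> 1)}"
    then have U: "E \<subseteq> (\<Union>i. U i)" "\<And>i. bounded (U i)" by auto
    define A where "A i = {u \<in> {0..<1}. p u \<in> U i}" for i
    define d where "d i = C * diameter (U i) powr t" for i
    define c where "c i = (SOME u. u \<in> A i)" for i
    have d0: "0 \<le> d i" for i using C by (simp add: d_def)
    \<comment> \<open>The sets \<open>A i\<close> need not be measurable, hence the intervals around
      a chosen point \<open>c i\<close>. If \<open>A i\<close> is empty the choice is arbitrary, but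
      the inclusion is trivial.\<close>
    have sub: "A i \<subseteq> {c i - d i .. c i + d i}" for i
    proof
      fix u assume u: "u \<in> A i"
      then have c: "c i \<in> A i" unfolding c_def by (rule someI)
      have "\<bar>p u - p (c i)\<bar> \<le> diameter (U i)"
        using diameter_bounded_bound[OF U(2), of "p u" i "p (c i)"] u c by (simp add: A_def dist_real_def)
      then have "\<bar>p u - p (c i)\<bar> powr t \<le> diameter (U i) powr t" using t by (intro powr_mono2) auto
      then have "C * \<bar>p u - p (c i)\<bar> powr t \<le> d i" using C by (simp add: d_def)
      then have "\<bar>u - c i\<bar> \<le> d i" using H[of u "c i"] u c by (auto simp: A_def)
      then show "u \<in> {c i - d i .. c i + d i}" by auto
    qed
    have "{0..<1} \<subseteq> (\<Union>i. A i)" using E U(1) by (fastforce simp: A_def)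
    then have "{0..<1::real} \<subseteq> (\<Union>i. {c i - d i .. c i + d i})" using sub by blast
    then have "emeasure lborel {0..<1::real} \<le> emeasure lborel (\<Union>i. {c i - d i .. c i + d i})"
      by (intro emeasure_mono) auto
    also have "\<dots> \<le> (\<Sum>i. emeasure lborel {c i - d i .. c i + d i})"
      by (intro emeasure_subadditive_countably) auto
    also have "\<dots> = (\<Sum>i. ennreal (2 * C) * ennreal (diameter (U i) powr t))"
      using d0 C by (intro suminf_cong) (simp add: d_def ennreal_mult[symmetric])
    also have "\<dots> = ennreal (2 * C) * (\<Sum>i. ennreal (diameter (U i) powr t))" by simp
    finally have "1 \<le> ennreal (2 * C) * (\<Sum>i. ennreal (diameter (U i) powr t))" by simp
    then have "ennreal (1 / (2 * C)) * 1
        \<le> ennreal (1 / (2 * C)) * (ennreal (2 * C) * (\<Sum>i. ennreal (diameter (U i) powr t)))"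
      by (rule mult_left_mono) simp
    also have "\<dots> = (\<Sum>i. ennreal (diameter (U i) powr t))"
      using C by (simp add: mult.assoc[symmetric] ennreal_mult[symmetric])
    finally show "ennreal (1 / (2 * C)) \<le> (\<Sum>i. ennreal (diameter (U i) powr t))" by simp
  qed
  moreover have "0 < ennreal (1 / (2 * C))" using C by simp
  ultimately have "hausdorff_content t 1 E \<noteq> 0" by (metis leD)
  then show "\<not> hausdorff_null t E" unfolding hausdorff_null_def by (metis zero_less_one)
qed (use t in simp)

lemma hausdorff_content_antimono:
  assumes "\<delta> \<le> \<delta>'"
  shows "hausdorff_content s \<delta>' A \<le> hausdorff_content s \<delta> A"
  unfolding hausdorff_content_def by (rule INF_superset_mono) (use assms order_trans in \<open>auto, blast\<close>)

lemma hausdorff_content_diameter: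
  fixes A :: "'a::metric_space set"
  assumes "bounded A" "diameter A \<le> \<delta>" "0 \<le> \<delta>"
  shows "hausdorff_content s \<delta> A \<le> ennreal (diameter A powr s)"
proof -
  let ?U = "\<lambda>i::nat. if i = 0 then A else {}"
  have "hausdorff_content s \<delta> A \<le> (\<Sum>i. ennreal (diameter (?U i) powr s))"
    by (rule hausdorff_content_le) (use assms in \<open>auto split: if_splits intro: exI[of _ "0::nat"]\<close>)
  also have "\<dots> = (\<Sum>i\<in>{0}. ennreal (diameter (?U i) powr s))" by (rule suminf_finite) auto
  finally show ?thesis by simp
qed

text \<open>Up to the factor C, the weight 2^-j bounds the t-content of \<open>E j\<close> at all
  scales at once: the pieces that may follow j have total weight 2 * 2^(-m j), and \<open>w\<close>
  says that contraction by \<open>\<rho> j\<close> brings this below 2^-j. Hypothesis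
  \<open>d\<close> starts the induction at scale 1. The point 0 belongs to no letter and costs
  nothing.\<close>

lemma hausdorff_null_recursive_cover:
  fixes E :: "nat \<Rightarrow> real set"
  assumes t: "0 < t" "t < s" and C: "0 \<le> C"
    and E: "\<And>j. E j \<subseteq> \<gamma> j ` ({0} \<union> (\<Union>k\<in>{m j..}. E k))"
    and \<gamma>: "\<And>j u v. \<bar>\<gamma> j u - \<gamma> j v\<bar> \<le> \<rho> j * \<bar>u - v\<bar>"
    and \<rho>: "\<And>j. 0 < \<rho> j" "\<And>j. \<rho> j \<le> \<theta>" "\<theta> < 1"
    and w: "\<And>j. \<rho> j powr t * (2 * (1/2) ^ m j) \<le> (1/2) ^ j"
    and d: "\<And>j. bounded (E j)" "\<And>j. diameter (E j) \<le> 1" "\<And>j. diameter (E j) powr t \<le> C * (1/2) ^ j"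
  shows "hausdorff_null s (\<Union>j. E j)"
proof -
  have \<theta>: "0 < \<theta>" using \<rho>(1,2)[of 0] by linarith
  have main: "hausdorff_content t (\<theta> ^ n) (E j) \<le> ennreal (C * (1/2) ^ j)" for n j
  proof (induction n arbitrary: j)
    case 0
    have "hausdorff_content t 1 (E j) \<le> ennreal (diameter (E j) powr t)"
      using d by (intro hausdorff_content_diameter) auto
    also have "\<dots> \<le> ennreal (C * (1/2) ^ j)" using d(3) by (rule ennreal_leI)
    finally show ?case by simp
  next
    case (Suc n)
    define Z where "Z i = (if i = 0 then {0} else E (m j + (i - 1)))" for i
    let ?X = "{0} \<union> (\<Union>k\<in>{m j..}. E k)"
    let ?b = "\<lambda>i. if i = 0 then 0 else C * (1/2) ^ (m j + (i - 1))"
    have X: "?X \<subseteq> (\<Union>i. Z i)"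
    proof
      fix x assume "x \<in> ?X"
      then consider "x = 0" | k where "k \<ge> m j" "x \<in> E k" by auto
      then show "x \<in> (\<Union>i. Z i)"
      proof cases
        case 1 then have "x \<in> Z 0" by (simp add: Z_def)
        then show ?thesis by blast
      next
        case 2 then have "x \<in> Z (Suc (k - m j))" by (simp add: Z_def)
        then show ?thesis by blast
      qed
    qed
    have Zb: "hausdorff_content t (\<theta> ^ n) (Z i) \<le> ennreal (?b i)" for i
    proof (cases "i = 0")
      case True
      then show ?thesis using hausdorff_null_singleton[of t "0::real"] t \<theta> zero_less_power[OF \<theta>, of n] by (simp add: Z_def hausdorff_null_def)
    next
      case False
      then show ?thesis using Suc.IH by (simp add: Z_def)
    qed
    have "(\<lambda>i. C * (1/2) ^ m j * (1/2) ^ i) sums (C * (1/2) ^ m j * (1 / (1 - 1/2)))"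
      by (intro sums_mult geometric_sums) auto
    then have "(\<lambda>i. ?b (Suc i)) sums (C * (2 * (1/2) ^ m j))"
      by (simp add: power_add mult_ac)
    then have b: "?b sums (C * (2 * (1/2) ^ m j))"
      using sums_Suc[of ?b] by fastforce
    have "hausdorff_content t (\<theta> ^ n) ?X \<le> hausdorff_content t (\<theta> ^ n) (\<Union>i. Z i)"
      by (rule hausdorff_content_mono[OF X])
    also have "\<dots> \<le> (\<Sum>i. hausdorff_content t (\<theta> ^ n) (Z i))" by (rule hausdorff_content_UN)
    also have "\<dots> \<le> (\<Sum>i. ennreal (?b i))" by (intro suminf_le Zb) auto
    also have "\<dots> = ennreal (C * (2 * (1/2) ^ m j))"
      by (rule suminf_ennreal_eq[OF _ b]) (use C in auto)
    finally have X2: "hausdorff_content t (\<theta> ^ n) ?X \<le> ennreal (C * (2 * (1/2) ^ m j))" .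
    have "hausdorff_content t (\<theta> ^ Suc n) (E j) \<le> hausdorff_content t (\<rho> j * \<theta> ^ n) (E j)"
      by (rule hausdorff_content_antimono) (use \<theta> \<rho> in simp)
    also have "\<dots> \<le> hausdorff_content t (\<rho> j * \<theta> ^ n) (\<gamma> j ` ?X)"
      by (rule hausdorff_content_mono[OF E])
    also have "\<dots> \<le> ennreal (\<rho> j powr t) * hausdorff_content t (\<theta> ^ n) ?X"
      by (rule hausdorff_content_lipschitz) (use \<rho> \<gamma> t in auto)
    also have "\<dots> \<le> ennreal (\<rho> j powr t) * ennreal (C * (2 * (1/2) ^ m j))"
      by (rule mult_left_mono[OF X2]) simp
    also have "\<dots> = ennreal (C * (\<rho> j powr t * (2 * (1/2) ^ m j)))"
      using C by (simp add: ennreal_mult[symmetric] mult_ac)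
    also have "\<dots> \<le> ennreal (C * (1/2) ^ j)"
      using w C by (intro ennreal_leI mult_left_mono) auto
    finally show ?case .
  qed
  have "hausdorff_null s (E j)" for j
    unfolding hausdorff_null_def
  proof (intro allI impI)
    fix \<delta> :: real assume \<delta>: "0 < \<delta>"
    have "(\<lambda>n. \<theta> ^ n) \<longlonglongrightarrow> 0" using \<theta> \<rho> by (intro LIMSEQ_realpow_zero) auto
    have pw: "(\<theta> ^ n) powr (s - t) = (\<theta> powr (s - t)) ^ n" for n
      using \<theta> by (simp add: powr_realpow[symmetric] powr_powr mult.commute)
    have "\<theta> powr (s - t) < 1" using \<theta> \<rho>(3) t powr_less_mono2[of "s - t" \<theta> 1] by simp
    then have "(\<lambda>n. (\<theta> powr (s - t)) ^ n) \<longlonglongrightarrow> 0" by (intro LIMSEQ_realpow_zero) auto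
    then have "(\<lambda>n. (\<theta> ^ n) powr (s - t) * (C * (1/2) ^ j)) \<longlonglongrightarrow> 0"
      unfolding pw by (rule tendsto_mult_left_zero)
    then have lim: "(\<lambda>n. ennreal ((\<theta> ^ n) powr (s - t) * (C * (1/2) ^ j))) \<longlonglongrightarrow> ennreal 0"
      by (rule tendsto_ennrealI)
    have ev: "\<forall>\<^sub>F n in sequentially. \<theta> ^ n < \<delta>"
      using order_tendstoD(2)[OF \<open>(\<lambda>n. \<theta> ^ n) \<longlonglongrightarrow> 0\<close> \<delta>] .
    \<comment> \<open>At scale \<theta>^n the exponent t is traded for s at the price
      (\<theta>^n)^(s - t), which tends to 0 while the t-content stays bounded.\<close>
    have "\<forall>\<^sub>F n in sequentially. hausdorff_content s \<delta> (E j) \<le> ennreal ((\<theta> ^ n) powr (s - t) * (C * (1/2) ^ j))"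
      using ev
    proof eventually_elim
      case (elim n)
      have "hausdorff_content s \<delta> (E j) \<le> hausdorff_content s (\<theta> ^ n) (E j)"
        by (rule hausdorff_content_antimono) (use elim in simp)
      also have "\<dots> \<le> ennreal ((\<theta> ^ n) powr (s - t)) * hausdorff_content t (\<theta> ^ n) (E j)"
        by (rule hausdorff_content_exponent) (use t \<theta> in auto)
      also have "\<dots> \<le> ennreal ((\<theta> ^ n) powr (s - t)) * ennreal (C * (1/2) ^ j)"
        by (rule mult_left_mono[OF main]) simp
      also have "\<dots> = ennreal ((\<theta> ^ n) powr (s - t) * (C * (1/2) ^ j))"
        using C by (simp add: ennreal_mult)
      finally show ?case .
    qed
    then have "hausdorff_content s \<delta> (E j) \<le> ennreal 0"
      by (intro tendsto_lowerbound[OF lim]) auto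
    then show "hausdorff_content s \<delta> (E j) = 0" by simp
  qed
  then show ?thesis by (rule hausdorff_null_UN)
qed

section \<open>Self-similar sets with a common ratio\<close>

primrec ifs_comp :: "('i \<Rightarrow> 'a \<Rightarrow> 'a) \<Rightarrow> nat \<Rightarrow> (nat \<Rightarrow> 'i) \<Rightarrow> 'a \<Rightarrow> 'a" where
  "ifs_comp \<Psi> 0 d u = u"
| "ifs_comp \<Psi> (Suc n) d u = \<Psi> (d 0) (ifs_comp \<Psi> n (\<lambda>k. d (Suc k)) u)"

lemma ifs_comp_add: "ifs_comp \<Psi> (m + n) d u = ifs_comp \<Psi> m d (ifs_comp \<Psi> n (\<lambda>k. d (m + k)) u)"
  by (induction m arbitrary: d) auto

lemma ifs_comp_cong: "(\<And>k. k < n \<Longrightarrow> d k = d' k) \<Longrightarrow> ifs_comp \<Psi> n d u = ifs_comp \<Psi> n d' u"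
proof (induction n arbitrary: d d')
  case (Suc n)
  from Suc.prems have "d 0 = d' 0" by blast
  moreover have "ifs_comp \<Psi> n (\<lambda>k. d (Suc k)) u = ifs_comp \<Psi> n (\<lambda>k. d' (Suc k)) u"
    by (rule Suc.IH, rule Suc.prems) simp
  ultimately show ?case by simp
qed simp

text \<open>Take the first m for which the floors of K^(m+1) u and K^(m+1) v differ. The floors at
  level m still agree, which gives |u - v| < K^-m and, by division with remainder, different digits
  at m. At level 0 they agree because both points lie in [0,1).\<close>

lemma least_differing_digit:
  fixes u v :: real and K :: nat
  assumes u: "u \<in> {0..<1}" and v: "v \<in> {0..<1}" and uv: "u \<noteq> v" and K: "2 \<le> K"
  defines "dig \<equiv> \<lambda>x m. nat (\<lfloor>real K ^ Suc m * x\<rfloor> mod int K)"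
  obtains m where "\<And>k. k < m \<Longrightarrow> dig u k = dig v k" "dig u m \<noteq> dig v m" "\<bar>u - v\<bar> < 1 / real K ^ m"
proof -
  define P where "P m \<longleftrightarrow> \<lfloor>real K ^ Suc m * u\<rfloor> \<noteq> \<lfloor>real K ^ Suc m * v\<rfloor>" for m
  have "\<exists>m. 1 / \<bar>u - v\<bar> < real K ^ m" using K by (intro real_arch_pow) auto
  then obtain m0 where m0: "1 / \<bar>u - v\<bar> < real K ^ m0" by blast
  have close: "\<bar>real K ^ n * u - real K ^ n * v\<bar> < 1" if "\<lfloor>real K ^ n * u\<rfloor> = \<lfloor>real K ^ n * v\<rfloor>" for n
    using that by linarith
  have "1 < real K ^ m0 * \<bar>u - v\<bar>" using m0 uv by (simp add: field_simps)
  also have "\<dots> \<le> real K ^ Suc m0 * \<bar>u - v\<bar>" using K by (intro mult_right_mono power_increasing) auto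
  also have "\<dots> = \<bar>real K ^ Suc m0 * u - real K ^ Suc m0 * v\<bar>"
    by (simp add: abs_mult right_diff_distrib[symmetric])
  finally have "P m0" using close[of "Suc m0"] unfolding P_def by linarith
  define m where "m = (LEAST m. P m)"
  have Pm: "P m" unfolding m_def by (rule LeastI[of P, OF \<open>P m0\<close>])
  have less: "\<not> P k" if "k < m" for k using that not_less_Least unfolding m_def by blast
  have fm: "\<lfloor>real K ^ m * u\<rfloor> = \<lfloor>real K ^ m * v\<rfloor>"
  proof (cases m)
    case 0
    have "\<lfloor>u\<rfloor> = 0" "\<lfloor>v\<rfloor> = 0" using u v by (auto simp: floor_eq_iff)
    then show ?thesis using 0 by simp
  next
    case (Suc k)
    then show ?thesis using less[of k] by (simp add: P_def)
  qed
  show ?thesis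
  proof (rule that[of m])
    fix k assume "k < m" then show "dig u k = dig v k" using less[of k] by (simp add: P_def dig_def)
  next
    have div: "\<lfloor>real K ^ Suc m * x\<rfloor> div int K = \<lfloor>real K ^ m * x\<rfloor>" for x
      using floor_divide_real_eq_div[of "int K" "real K ^ Suc m * x"] K by simp
    show "dig u m \<noteq> dig v m"
    proof
      assume "dig u m = dig v m"
      then have "\<lfloor>real K ^ Suc m * u\<rfloor> mod int K = \<lfloor>real K ^ Suc m * v\<rfloor> mod int K"
        using K unfolding dig_def by (subst (asm) eq_nat_nat_iff) auto
      then have "\<lfloor>real K ^ Suc m * u\<rfloor> = \<lfloor>real K ^ Suc m * v\<rfloor>"
        using div[of u] div[of v] fm by (metis mult_div_mod_eq)
      then show False using Pm by (simp add: P_def)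
    qed
    have "real K ^ m * \<bar>u - v\<bar> < 1"
      using close[OF fm] by (simp add: abs_mult right_diff_distrib[symmetric])
    then show "\<bar>u - v\<bar> < 1 / real K ^ m" using K by (simp add: field_simps)
  qed
qed

text \<open>The K-adic digits of a point of [0,1) are read as an address. If digits first differ at
  m, then |u - v| < K^-m \<le> \<rho>^(m t), while separation keeps the images at least \<rho>^m
  \<delta> apart: an inverse Hoelder parametrization. E collects the limits of all digit sequences,
  so removing the first digit stays inside E; in the dynamics this is the removal of the first
  block.\<close>

lemma similar_ifs_dimension:
  fixes \<Psi> :: "'i \<Rightarrow> real \<Rightarrow> real"
  assumes fin: "finite I" and J: "compact J" "J \<noteq> {}"
    and maps: "\<And>i u. i \<in> I \<Longrightarrow> u \<in> J \<Longrightarrow> \<Psi> i u \<in> J"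
    and sim: "\<And>i u v. i \<in> I \<Longrightarrow> \<bar>\<Psi> i u - \<Psi> i v\<bar> = \<rho> * \<bar>u - v\<bar>"
    and \<rho>: "0 < \<rho>" "\<rho> < 1" and t: "0 < t"
    and card: "1 \<le> real (card I) * \<rho> powr t"
    and disj: "\<And>i i'. i \<in> I \<Longrightarrow> i' \<in> I \<Longrightarrow> i \<noteq> i' \<Longrightarrow> \<Psi> i ` J \<inter> \<Psi> i' ` J = {}"
  obtains E where "E \<subseteq> J" "\<And>y. y \<in> E \<Longrightarrow> \<exists>i\<in>I. \<exists>y'\<in>E. y = \<Psi> i y'" "ereal t \<le> hausdorff_dim E"
proof -
  define K where "K = card I"
  have "\<rho> powr t < 1" using \<rho> t powr_less_mono2[of t \<rho> 1] by simp
  then have K: "2 \<le> K"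
  proof -
    have "\<not> real K \<le> 1"
    proof
      assume "real K \<le> 1"
      then have "real K * \<rho> powr t \<le> 1 * \<rho> powr t" by (rule mult_right_mono) simp
      then show False using card \<open>\<rho> powr t < 1\<close> by (simp add: K_def)
    qed
    then show ?thesis by simp
  qed
  obtain e where e: "bij_betw e {0..<K} I"
    using ex_bij_betw_nat_finite[OF fin] K_def by blast
  obtain a where a: "a \<in> J" using J by blast
  define D where "D = diameter J"
  have D: "\<bar>u - v\<bar> \<le> D" if "u \<in> J" "v \<in> J" for u v
    using diameter_bounded_bound[OF compact_imp_bounded[OF J(1)] that] by (simp add: D_def dist_real_def)
  have cJ: "ifs_comp \<Psi> n d u \<in> J" if "range d \<subseteq> I" "u \<in> J" for n d u
    using that
  proof (induction n arbitrary: d)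
    case (Suc n)
    then have "ifs_comp \<Psi> n (\<lambda>k. d (Suc k)) u \<in> J" by (intro Suc.IH) auto
    moreover have "d 0 \<in> I" using Suc.prems by auto
    ultimately show ?case using maps by simp
  qed simp
  have csim: "\<bar>ifs_comp \<Psi> n d u - ifs_comp \<Psi> n d v\<bar> = \<rho> ^ n * \<bar>u - v\<bar>" if "range d \<subseteq> I" for n d u v
    using that
  proof (induction n arbitrary: d)
    case (Suc n)
    have "range (\<lambda>k. d (Suc k)) \<subseteq> I" "d 0 \<in> I" using Suc.prems by auto
    then show ?case using Suc.IH[of "\<lambda>k. d (Suc k)"] sim[of "d 0"] by simp
  qed simp
  define pt where "pt d = lim (\<lambda>n. ifs_comp \<Psi> n d a)" for d
  have lim: "(\<lambda>n. ifs_comp \<Psi> n d a) \<longlonglongrightarrow> pt d" if d: "range d \<subseteq> I" for d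
  proof -
    have near: "\<bar>ifs_comp \<Psi> m d a - ifs_comp \<Psi> n d a\<bar> \<le> \<rho> ^ m * D" if "m \<le> n" for m n
    proof -
      have "ifs_comp \<Psi> n d a = ifs_comp \<Psi> m d (ifs_comp \<Psi> (n - m) (\<lambda>k. d (m + k)) a)"
        using ifs_comp_add[of \<Psi> m "n - m" d a] that by simp
      moreover have "ifs_comp \<Psi> (n - m) (\<lambda>k. d (m + k)) a \<in> J" using d a by (intro cJ) auto
      ultimately show ?thesis
        using D[OF a] csim[OF d, of m a] \<rho> by (simp add: mult_left_mono)
    qed
    have "Cauchy (\<lambda>n. ifs_comp \<Psi> n d a)"
    proof (rule CauchyI')
      fix \<epsilon> :: real assume "0 < \<epsilon>"
      have "(\<lambda>n. \<rho> ^ n * D) \<longlonglongrightarrow> 0 * D" using \<rho> by (intro tendsto_intros LIMSEQ_realpow_zero) auto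
      then have "\<forall>\<^sub>F n in sequentially. \<rho> ^ n * D < \<epsilon>" using order_tendstoD(2) \<open>0 < \<epsilon>\<close> by force
      then obtain M where M: "\<And>n. n \<ge> M \<Longrightarrow> \<rho> ^ n * D < \<epsilon>" by (auto simp: eventually_sequentially)
      then show "\<exists>M. \<forall>m\<ge>M. \<forall>n>m. dist (ifs_comp \<Psi> m d a) (ifs_comp \<Psi> n d a) < \<epsilon>"
        using near by (metis dist_real_def le_less_trans less_imp_le)
    qed
    then have "convergent (\<lambda>n. ifs_comp \<Psi> n d a)" by (simp add: Cauchy_convergent_iff)
    then show ?thesis by (simp add: convergent_LIMSEQ_iff pt_def)
  qed
  have ptJ: "pt d \<in> J" if d: "range d \<subseteq> I" for d
    using closed_sequentially[OF compact_imp_closed[OF J(1)] _ lim[OF d]] cJ[OF d a] by blast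
  have pt_step: "pt d = \<Psi> (d 0) (pt (\<lambda>k. d (Suc k)))" if d: "range d \<subseteq> I" for d
  proof -
    have d0: "d 0 \<in> I" using d by auto
    have "range (\<lambda>k. d (Suc k)) \<subseteq> I" using d by auto
    from lim[OF this] have l1: "(\<lambda>n. ifs_comp \<Psi> n (\<lambda>k. d (Suc k)) a) \<longlonglongrightarrow> pt (\<lambda>k. d (Suc k))" .
    have "continuous_on UNIV (\<Psi> (d 0))"
      by (rule lipschitz_on_continuous_on[OF lipschitz_onI[where L = \<rho>]])
         (use sim[OF d0] \<rho> in \<open>auto simp: dist_real_def\<close>)
    then have "isCont (\<Psi> (d 0)) (pt (\<lambda>k. d (Suc k)))" by (simp add: continuous_on_eq_continuous_at)
    from isCont_tendsto_compose[OF this l1]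
    have "(\<lambda>n. ifs_comp \<Psi> (Suc n) d a) \<longlonglongrightarrow> \<Psi> (d 0) (pt (\<lambda>k. d (Suc k)))" by simp
    moreover have "(\<lambda>n. ifs_comp \<Psi> (Suc n) d a) \<longlonglongrightarrow> pt d" using lim[OF d] by (rule LIMSEQ_Suc)
    ultimately show ?thesis by (rule LIMSEQ_unique[symmetric])
  qed
  have pt_shift: "pt d = ifs_comp \<Psi> m d (pt (\<lambda>k. d (m + k)))" if d: "range d \<subseteq> I" for d m
    using d
  proof (induction m arbitrary: d)
    case (Suc m)
    have "range (\<lambda>k. d (Suc k)) \<subseteq> I" using Suc.prems by auto
    from Suc.IH[OF this] show ?case using pt_step[OF Suc.prems] by simp
  qed simp
  obtain \<delta> where \<delta>: "0 < \<delta>"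
    "\<And>i i' u v. i \<in> I \<Longrightarrow> i' \<in> I \<Longrightarrow> i \<noteq> i' \<Longrightarrow> u \<in> J \<Longrightarrow> v \<in> J \<Longrightarrow> \<delta> \<le> \<bar>\<Psi> i u - \<Psi> i' v\<bar>"
  proof -
    have cpt: "compact (\<Psi> i ` J)" if "i \<in> I" for i
      by (rule compact_continuous_image[OF lipschitz_on_continuous_on[OF lipschitz_onI[where L = \<rho>]] J(1)])
         (use sim[OF that] \<rho> in \<open>auto simp: dist_real_def\<close>)
    have "\<exists>\<delta>>0. \<forall>u\<in>J. \<forall>v\<in>J. \<delta> \<le> \<bar>\<Psi> (fst p) u - \<Psi> (snd p) v\<bar>" if "p \<in> {p \<in> I \<times> I. fst p \<noteq> snd p}" for p
    proof -
      have "\<exists>d>0. \<forall>x\<in>\<Psi> (fst p) ` J. \<forall>y\<in>\<Psi> (snd p) ` J. d \<le> dist x y"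
        using that by (intro separate_compact_closed cpt compact_imp_closed disj) auto
      then show ?thesis by (simp add: dist_real_def)
    qed
    then have "\<forall>p\<in>{p \<in> I \<times> I. fst p \<noteq> snd p}. \<exists>\<delta>. 0 < \<delta> \<and> (\<forall>u\<in>J. \<forall>v\<in>J. \<delta> \<le> \<bar>\<Psi> (fst p) u - \<Psi> (snd p) v\<bar>)"
      by blast
    from bchoice[OF this] obtain \<delta> where \<delta>: "\<forall>p\<in>{p \<in> I \<times> I. fst p \<noteq> snd p}.
        0 < \<delta> p \<and> (\<forall>u\<in>J. \<forall>v\<in>J. \<delta> p \<le> \<bar>\<Psi> (fst p) u - \<Psi> (snd p) v\<bar>)" by (rule exE)
    let ?S = "insert 1 (\<delta> ` {p \<in> I \<times> I. fst p \<noteq> snd p})"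
    have fS: "finite ?S" using fin by simp
    show ?thesis
    proof (rule that[of "Min ?S"])
      show "0 < Min ?S" using fS \<delta> by (subst Min_gr_iff) auto
      fix i i' u v assume h: "i \<in> I" "i' \<in> I" "i \<noteq> i'" "u \<in> J" "v \<in> J"
      then have "Min ?S \<le> \<delta> (i, i')" using fS by (intro Min_le) auto
      then show "Min ?S \<le> \<bar>\<Psi> i u - \<Psi> i' v\<bar>" using bspec[OF \<delta>, of "(i, i')"] h by fastforce
    qed
  qed
  define E where "E = pt ` {d. range d \<subseteq> I}"
  define dig where "dig x m = nat (\<lfloor>real K ^ Suc m * x\<rfloor> mod int K)" for x m
  define code where "code x = (\<lambda>m. e (dig x m))" for x
  have dig: "dig x m \<in> {0..<K}" for x m using K by (simp add: dig_def nat_less_iff)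
  have code: "range (code x) \<subseteq> I" for x using e dig unfolding code_def bij_betw_def by blast
  have "ereal t \<le> hausdorff_dim E"
  proof (rule hausdorff_dim_ge_inverse_holder[of t "\<delta> powr (- t)" "\<lambda>x. pt (code x)"])
    fix u v :: real assume u: "u \<in> {0..<1}" and v: "v \<in> {0..<1}"
    show "\<bar>u - v\<bar> \<le> \<delta> powr (- t) * \<bar>pt (code u) - pt (code v)\<bar> powr t"
    proof (cases "u = v")
      case False
      obtain m where m: "\<And>k. k < m \<Longrightarrow> dig u k = dig v k" "dig u m \<noteq> dig v m" "\<bar>u - v\<bar> < 1 / real K ^ m"
        using least_differing_digit[OF u v False K] unfolding dig_def by blast
      let ?su = "\<lambda>k. code u (m + k)" and ?sv = "\<lambda>k. code v (m + k)"
      have r: "range ?su \<subseteq> I" "range ?sv \<subseteq> I" using code by auto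
      have "code u m \<noteq> code v m"
        using m(2) inj_onD[OF bij_betw_imp_inj_on[OF e] _ dig[of u m] dig[of v m]] unfolding code_def by blast
      moreover have "code u m \<in> I" "code v m \<in> I" using code[of u] code[of v] by blast+
      moreover have "pt ?su = \<Psi> (code u m) (pt (\<lambda>k. ?su (Suc k)))" using pt_step[OF r(1)] by simp
      moreover have "pt ?sv = \<Psi> (code v m) (pt (\<lambda>k. ?sv (Suc k)))" using pt_step[OF r(2)] by simp
      moreover have "pt (\<lambda>k. ?su (Suc k)) \<in> J" by (rule ptJ) (use r in blast)
      moreover have "pt (\<lambda>k. ?sv (Suc k)) \<in> J" by (rule ptJ) (use r in blast)
      ultimately have "\<delta> \<le> \<bar>pt ?su - pt ?sv\<bar>" by (metis \<delta>(2))
      then have "\<rho> ^ m * \<delta> \<le> \<rho> ^ m * \<bar>pt ?su - pt ?sv\<bar>" using \<rho> by simp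
      also have "\<dots> = \<bar>pt (code u) - pt (code v)\<bar>"
      proof -
        have "ifs_comp \<Psi> m (code v) (pt ?sv) = ifs_comp \<Psi> m (code u) (pt ?sv)"
          using m(1) by (intro ifs_comp_cong) (simp add: code_def)
        then show ?thesis
          using pt_shift[OF code, of u m] pt_shift[OF code, of v m] csim[OF code, of m u] by simp
      qed
      finally have "\<rho> ^ m \<le> \<bar>pt (code u) - pt (code v)\<bar> / \<delta>" using \<delta>(1) by (simp add: field_simps)
      then have "(\<rho> ^ m) powr t \<le> (\<bar>pt (code u) - pt (code v)\<bar> / \<delta>) powr t"
        using \<rho> t by (intro powr_mono2) auto
      also have "\<dots> = \<delta> powr (- t) * \<bar>pt (code u) - pt (code v)\<bar> powr t"
        using \<delta>(1) by (simp add: powr_divide powr_minus_divide)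
      finally have 1: "(\<rho> ^ m) powr t \<le> \<delta> powr (- t) * \<bar>pt (code u) - pt (code v)\<bar> powr t" .
      have "1 \<le> (real K * \<rho> powr t) ^ m" using card by (simp add: K_def one_le_power)
      then have "1 / real K ^ m \<le> (\<rho> powr t) ^ m" using K by (simp add: power_mult_distrib field_simps)
      also have "\<dots> = (\<rho> ^ m) powr t"
        using \<rho> by (simp add: powr_realpow[symmetric] powr_powr mult.commute)
      finally show ?thesis using m(3) 1 by linarith
    qed (use \<delta> in simp)
  qed (use t \<delta> code in \<open>auto simp: E_def\<close>)
  moreover have "\<exists>i\<in>I. \<exists>y'\<in>E. y = \<Psi> i y'" if y: "y \<in> E" for y
  proof -
    obtain d where d: "range d \<subseteq> I" "y = pt d" using y by (auto simp: E_def)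
    then have "d 0 \<in> I" "pt (\<lambda>k. d (Suc k)) \<in> E" by (auto simp: E_def)
    then show ?thesis using pt_step d by blast
  qed
  moreover have "E \<subseteq> J" using ptJ by (auto simp: E_def)
  ultimately show ?thesis using that by blast
qed

lemma power_bracket:
  fixes l y :: real
  assumes "0 < l" "l < 1" "0 < y" "y \<le> 1"
  obtains j where "l ^ Suc j < y" "y \<le> l ^ j"
proof -
  obtain n where n: "l ^ n < y" using real_arch_pow_inv[of y l] assms by blast
  define k where "k = (LEAST n. l ^ n < y)"
  have k: "l ^ k < y" unfolding k_def using n by (rule LeastI)
  have "k \<noteq> 0" using k assms by (intro notI) simp
  then obtain j where j: "k = Suc j" using not0_implies_Suc by blast
  have "\<not> l ^ j < y" using not_less_Least[of j "\<lambda>n. l ^ n < y"] j k_def by simp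
  then show ?thesis using that[of j] k j by simp
qed

lemma powr_power_swap: "0 \<le> c \<Longrightarrow> (c powr t) ^ n = (c ^ n) powr t" for c :: real
  by (induction n) (auto simp: powr_mult)

text \<open>The shells (2^-(j+1), 2^-j] fit the recursive cover with t = 1: each is a half-size copy
  of (0, 2^-j], and the weight hypothesis holds with equality.\<close>

lemma hausdorff_null_unit_interval:
  assumes "1 < s"
  shows "hausdorff_null s {0..1::real}"
proof -
  define E where "E j = {y::real. (1/2) ^ Suc j < y \<and> y \<le> (1/2) ^ j}" for j
  have diam: "diameter (E j) \<le> (1/2) ^ j" for j
  proof (rule diameter_le)
    fix x y assume "x \<in> E j" "y \<in> E j"
    moreover have "0 < (1/2::real) ^ Suc j" by simp
    ultimately show "norm (x - y) \<le> (1/2) ^ j" unfolding E_def real_norm_def by auto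
  qed simp
  have bd: "bounded (E j)" for j
    by (rule bounded_subset[of "{0..(1/2) ^ j}"]) (auto simp: E_def intro: order_trans[of 0 "(1/2) ^ Suc j"])
  have "hausdorff_null s (\<Union>j. E j)"
  proof (rule hausdorff_null_recursive_cover[where t = 1 and C = 1 and \<gamma> = "\<lambda>j u. (1/2) ^ Suc j + u / 2"
        and m = "\<lambda>j. j" and \<rho> = "\<lambda>j. 1/2" and \<theta> = "1/2"])
    fix j
    show "E j \<subseteq> (\<lambda>u. (1/2) ^ Suc j + u / 2) ` ({0} \<union> (\<Union>k\<in>{j..}. E k))"
    proof
      fix y assume y: "y \<in> E j"
      define u where "u = 2 * y - (1/2) ^ j"
      have u: "0 < u" "u \<le> (1/2) ^ j" using y by (auto simp: E_def u_def)
      moreover have "(1/2::real) ^ j \<le> 1" by (simp add: power_le_one)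
      ultimately obtain k where k: "(1/2) ^ Suc k < u" "u \<le> (1/2) ^ k"
        using power_bracket[of "1/2" u] by auto
      have "j \<le> k"
      proof (rule ccontr)
        assume "\<not> j \<le> k"
        then have "(1/2::real) ^ j \<le> (1/2) ^ Suc k" by (intro power_decreasing) auto
        then show False using k u by simp
      qed
      then have "u \<in> {0} \<union> (\<Union>k\<in>{j..}. E k)" using k by (auto simp: E_def)
      moreover have "y = (1/2) ^ Suc j + u / 2" by (simp add: u_def field_simps)
      ultimately show "y \<in> (\<lambda>u. (1/2) ^ Suc j + u / 2) ` ({0} \<union> (\<Union>k\<in>{j..}. E k))" by blast
    qed
    have "(1/2::real) ^ j \<le> 1" by (simp add: power_le_one)
    then show "diameter (E j) \<le> 1" using diam[of j] by simp
    show "diameter (E j) powr 1 \<le> 1 * (1/2) ^ j"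
      using diam[of j] diameter_ge_0[OF bd[of j]] by (simp add: powr_one)
  qed (use assms bd in \<open>auto simp: abs_if\<close>)
  then have "hausdorff_null s ((\<Union>j. E j) \<union> {0})"
    using assms by (intro hausdorff_null_Un hausdorff_null_singleton) auto
  moreover have "{0..1} \<subseteq> (\<Union>j. E j) \<union> {0}"
  proof
    fix y :: real assume y: "y \<in> {0..1}"
    show "y \<in> (\<Union>j. E j) \<union> {0}"
    proof (cases "y = 0")
      case False
      then obtain j where "(1/2) ^ Suc j < y" "y \<le> (1/2) ^ j" using power_bracket[of "1/2" y] y by auto
      then show ?thesis by (auto simp: E_def)
    qed simp
  qed
  ultimately show ?thesis by (rule hausdorff_null_subset[rotated])
qed

lemma hausdorff_dim_unit_interval_le: "A \<subseteq> {0..1::real} \<Longrightarrow> hausdorff_dim A \<le> ereal 1"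
  by (rule hausdorff_dim_le) (auto intro: hausdorff_null_subset hausdorff_null_unit_interval)

lemma hausdorff_dim_lipschitz:
  fixes h :: "real \<Rightarrow> real"
  assumes "\<And>u v. \<bar>h u - h v\<bar> \<le> L * \<bar>u - v\<bar>" "0 < L"
  shows "hausdorff_dim (h ` A) \<le> hausdorff_dim A"
  unfolding hausdorff_dim_def
  by (intro INF_superset_mono)
     (auto simp: hausdorff_measure_eq_0_iff intro: hausdorff_null_lipschitz[OF _ assms])

section \<open>Counting words\<close>

text \<open>For t strictly below the target dimension an exponential gain \<theta>^n is left; it
  absorbs the loss 4 n of the central binomial bound and any constant \<kappa>.\<close>

lemma exp_beats_linear:
  fixes \<theta> \<kappa> :: real
  assumes "1 < \<theta>" "0 < \<kappa>"
  obtains n where "1 \<le> n" "1 \<le> \<kappa> * \<theta> ^ n / (4 * real n)"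
proof -
  have "(\<lambda>n. real n / \<theta> ^ n) \<longlonglongrightarrow> 0" using assms by (intro lim_n_over_pown) auto
  then have "\<forall>\<^sub>F n in sequentially. real n / \<theta> ^ n < \<kappa> / 4" using assms by (intro order_tendstoD(2)) auto
  then obtain M where M: "\<And>n. n \<ge> M \<Longrightarrow> real n / \<theta> ^ n < \<kappa> / 4" by (auto simp: eventually_sequentially)
  have "real (Suc M) / \<theta> ^ Suc M < \<kappa> / 4" by (rule M) simp
  then have "1 \<le> \<kappa> * \<theta> ^ Suc M / (4 * real (Suc M))" using assms by (simp add: field_simps del: power_Suc)
  then show ?thesis using that[of "Suc M"] by simp
qed

definition step_lists :: "nat \<Rightarrow> nat \<Rightarrow> nat list set" where
  "step_lists n N = {xs. length xs = n \<and> sum_list xs = N}"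

lemma step_lists: "finite (step_lists n N)" "card (step_lists n N) = (N + n - 1) choose N"
proof -
  have "step_lists n N \<subseteq> {xs. set xs \<subseteq> {..N} \<and> length xs = n}"
    using member_le_sum_list by (auto simp: step_lists_def)
  then show "finite (step_lists n N)" by (rule finite_subset) (simp add: finite_lists_length_eq)
  show "card (step_lists n N) = (N + n - 1) choose N"
    unfolding step_lists_def by (rule card_length_sum_list)
qed

text \<open>One extra unit of total step raises the final letter without reducing the number of
  words; this produces rising words for the basin.\<close>

lemma card_step_lists_Suc: assumes "1 \<le> n" shows "card (step_lists n N) \<le> card (step_lists n (Suc N))"
proof -
  obtain m where n: "n = Suc m" using assms by (cases n) auto
  have "Suc N + n - 1 = Suc (N + m)" "N + n - 1 = N + m" using n by auto
  then show ?thesis by (simp add: step_lists)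
qed

lemma card_step_lists_central: assumes "1 \<le> n" shows "4 ^ n / (4 * real n) \<le> real (card (step_lists n n))"
proof -
  obtain m where n: "n = Suc m" using assms by (cases n) auto
  have "(2 * n) choose n = (Suc (2 * m + 1)) choose (Suc m)" by (simp add: n)
  also have "\<dots> = ((2 * m + 1) choose m) + ((2 * m + 1) choose Suc m)" by (rule binomial_Suc_Suc)
  also have "(2 * m + 1) choose m = (2 * m + 1) choose (Suc m)"
    using binomial_symmetric[of m "2 * m + 1"] by simp
  finally have "real ((2 * n) choose n) = 2 * real (card (step_lists n n))"
    by (simp add: step_lists n numeral_2_eq_2)
  then show ?thesis using central_binomial_lower_bound[of n] assms by simp
qed

section \<open>The map in the coordinate $|2x-1|$\<close>

locale fib_map =
  fixes l :: real
  assumes l: "0 < l" "l < 1"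
begin

abbreviation f :: "real \<Rightarrow> real" where "f \<equiv> fmap l"

definition \<mu> :: real where "\<mu> = 1 - l"

definition r :: real where "r = l * \<mu>"

text \<open>The length of V_j divided by that of its image under the induced map: V_0 is mapped to
  (0, 1] and V_1 to [0, l), both with slope 1/\<mu> in modulus, and V_j for j \<ge> 2 to [0,
  l^(j-1)) with slope 1/r in modulus.\<close>

definition \<rho> :: "nat \<Rightarrow> real" where "\<rho> j = (if j \<le> 1 then \<mu> else r)"

text \<open>For y in [0,1] the argument is the point x \<le> 1/2 with |2x - 1| = y. The break point
  \<open>zpt l j\<close> sits at y = l^j, so \<open>W l j\<close> becomes (l^(j+1), l^j).\<close>

definition \<phi> :: "real \<Rightarrow> real" where "\<phi> y = f ((1 - y) / 2)"

text \<open>The map induced by \<open>f\<close> on $y = |2x - 1|$; its critical point is 0.\<close>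

definition g :: "real \<Rightarrow> real" where "g y = \<bar>2 * \<phi> y - 1\<bar>"

definition b :: "nat \<Rightarrow> real" where "b j = g (l ^ j)"

lemma \<mu>_bounds: "0 < \<mu>" "\<mu> < 1" and l_\<mu>: "l + \<mu> = 1" using l by (auto simp: \<mu>_def)

lemma r_bounds: "0 < r" "r < \<mu>" "r < l" using l \<mu>_bounds by (auto simp: r_def)

lemma \<rho>_bounds: "0 < \<rho> j" "\<rho> j \<le> \<mu>" "r \<le> \<rho> j" using \<mu>_bounds r_bounds by (auto simp: \<rho>_def)

lemma lpow_bounds: "0 < l ^ j" "l ^ j \<le> 1" using l by (simp_all add: power_le_one)

lemma lpow_mono: "i \<le> j \<Longrightarrow> l ^ j \<le> l ^ i" using l by (simp add: power_decreasing)

lemma lpow_Suc: "l ^ Suc j < l ^ j" using l by simp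

lemma f_facts: "f \<in> {0..1} \<rightarrow> {0..1}" "continuous_on {0..1} f" "f 0 = 0" "f 1 = 0"
  using fmap_is_fmap[OF l] by (auto simp: is_fmap_def)

lemma f_range: "x \<in> {0..1} \<Longrightarrow> f x \<in> {0..1}" using f_facts(1) by blast

text \<open>The reflected map satisfies the conditions that determine f, so uniqueness
  applies.\<close>

lemma f_symmetric: assumes "x \<in> {0..1}" shows "f (1 - x) = f x"
proof -
  have f: "is_fmap l f" using fmap_is_fmap[OF l] by blast
  have "is_fmap l (\<lambda>x. f (1 - x))"
    unfolding is_fmap_def
  proof (intro conjI allI)
    show "continuous_on {0..1} (\<lambda>x. f (1 - x))"
      by (rule continuous_on_compose2[OF f_facts(2)]) (auto intro!: continuous_intros)
    show "(\<lambda>x. f (1 - x)) \<in> {0..1} \<rightarrow> {0..1}" using f_facts(1) by (auto simp: Pi_iff)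
    fix j
    obtain b where "\<forall>x\<in>W_hat l j. f x = - kappa l j * x + b"
      using f unfolding is_fmap_def affine_with_slope_on_def by blast
    moreover have "1 - x \<in> W_hat l j" if "x \<in> W l j" for x using that by (auto simp: W_def W_hat_def)
    ultimately have "\<forall>x\<in>W l j. f (1 - x) = kappa l j * x + (b - kappa l j)"
      using right_diff_distrib[of "kappa l j" 1] by force
    then show "affine_with_slope_on (kappa l j) (W l j) (\<lambda>x. f (1 - x))"
      unfolding affine_with_slope_on_def by blast
    obtain b where "\<forall>x\<in>W l j. f x = kappa l j * x + b"
      using f unfolding is_fmap_def affine_with_slope_on_def by blast
    moreover have "1 - x \<in> W l j" if "x \<in> W_hat l j" for x using that by (auto simp: W_def W_hat_def)
    ultimately have "\<forall>x\<in>W_hat l j. f (1 - x) = - kappa l j * x + (b + kappa l j)"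
      using right_diff_distrib[of "kappa l j" 1] by force
    then show "affine_with_slope_on (- kappa l j) (W_hat l j) (\<lambda>x. f (1 - x))"
      unfolding affine_with_slope_on_def by blast
  qed (use f_facts in auto)
  from is_fmap_unique[OF l this f assms] show ?thesis .
qed

lemma f_eq_\<phi>: assumes "x \<in> {0..1}" shows "f x = \<phi> \<bar>2 * x - 1\<bar>"
proof (cases "2 * x \<ge> 1")
  case True
  then have "(1 - \<bar>2 * x - 1\<bar>) / 2 = 1 - x" by simp
  then show ?thesis using f_symmetric[OF assms] by (simp only: \<phi>_def)
next
  case False
  then have "(1 - \<bar>2 * x - 1\<bar>) / 2 = x" by simp
  then show ?thesis by (simp only: \<phi>_def)
qed

lemma \<phi>_range: "y \<in> {0..1} \<Longrightarrow> \<phi> y \<in> {0..1}" unfolding \<phi>_def by (rule f_range) auto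

lemma \<phi>_continuous: "continuous_on {0..1} \<phi>"
  unfolding \<phi>_def by (rule continuous_on_compose2[OF f_facts(2)]) (auto intro!: continuous_intros)

lemma g_continuous: "continuous_on {0..1} g"
  unfolding g_def using \<phi>_continuous by (auto intro!: continuous_intros)

lemma g_range: "y \<in> {0..1} \<Longrightarrow> g y \<in> {0..1}" using \<phi>_range[of y] by (auto simp: g_def)

lemma gn_range: "y \<in> {0..1} \<Longrightarrow> (g ^^ n) y \<in> {0..1}"
  by (induction n) (use g_range in auto)

lemma fn_range: "x \<in> {0..1} \<Longrightarrow> (f ^^ n) x \<in> {0..1}"
  by (induction n) (use f_range in auto)

lemma abs_fn: assumes "x \<in> {0..1}" shows "\<bar>2 * (f ^^ n) x - 1\<bar> = (g ^^ n) \<bar>2 * x - 1\<bar>"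
proof (induction n)
  case (Suc n)
  then show ?case using f_eq_\<phi>[OF fn_range[OF assms]] by (simp add: g_def)
qed simp

lemma fn_Suc: "x \<in> {0..1} \<Longrightarrow> (f ^^ Suc n) x = \<phi> ((g ^^ n) \<bar>2 * x - 1\<bar>)"
  using f_eq_\<phi>[OF fn_range, of x n] abs_fn[of x n] by simp

lemma \<phi>_affine:
  assumes "y \<in> {l ^ Suc j .. l ^ j}"
  shows "\<phi> y = \<phi> (l ^ j) + kappa l j * (l ^ j - y) / 2"
proof -
  obtain b where b: "\<forall>x\<in>W l j. f x = kappa l j * x + b"
    using fmap_is_fmap(1)[OF l] unfolding is_fmap_def affine_with_slope_on_def by blast
  define d where "d x = f x - kappa l j * x" for x
  have lt: "zpt l j < zpt l (Suc j)" by (rule zpt_strict[OF l])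
  have cl: "closure (W l j) = {zpt l j .. zpt l (Suc j)}" using lt by (simp add: W_def)
  have "{zpt l j .. zpt l (Suc j)} \<subseteq> {0..1}"
    using zpt_bounds[OF l, of j] zpt_bounds[OF l, of "Suc j"] by auto
  then have "continuous_on (closure (W l j)) d"
    unfolding cl d_def using continuous_on_subset[OF f_facts(2)] by (auto intro!: continuous_intros)
  then have d: "d x = b" if "x \<in> {zpt l j .. zpt l (Suc j)}" for x
    using continuous_constant_on_closure[of "W l j" d b x] that b cl by (auto simp: d_def)
  have "d ((1 - y) / 2) = d ((1 - l ^ j) / 2)"
    using d[of "(1 - y) / 2"] d[of "(1 - l ^ j) / 2"] assms lt by (simp add: zpt_def)
  then show ?thesis by (simp add: d_def \<phi>_def field_simps)
qed

lemma kappa_pos: "0 < kappa l j" using l by (simp add: kappa_def)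

lemma \<phi>_outer: assumes "y \<in> {l..1}" shows "\<phi> y = (1 - y) / (2 * \<mu>)"
proof -
  have "\<phi> 1 = 0" using f_facts by (simp add: \<phi>_def)
  then show ?thesis using \<phi>_affine[of y 0] assms by (simp add: kappa_def \<mu>_def)
qed

lemma g_outer: assumes "y \<in> {l..1}" shows "g y = (y - l) / \<mu>"
proof -
  have "2 * \<phi> y - 1 = (1 - y) / \<mu> - \<mu> / \<mu>" using \<phi>_outer[OF assms] \<mu>_bounds by (simp add: field_simps)
  also have "\<dots> = - ((y - l) / \<mu>)"
    unfolding diff_divide_distrib[symmetric] minus_divide_left by (simp add: \<mu>_def)
  finally have "2 * \<phi> y - 1 = - ((y - l) / \<mu>)" .
  then show ?thesis using assms \<mu>_bounds by (simp add: g_def)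
qed

lemma \<phi>_lpow_mono: "\<phi> (l ^ j) < \<phi> (l ^ Suc j)"
proof -
  have "0 < kappa l j * (l ^ j - l ^ Suc j)" using kappa_pos lpow_Suc[of j] by simp
  then show ?thesis using \<phi>_affine[of "l ^ Suc j" j] lpow_Suc[of j] by simp
qed

text \<open>\<open>\<phi>\<close> takes the value 1/2 already at y = l, so the absolute value in
  \<open>g\<close> flips only the outermost letter, and \<open>g\<close> is decreasing on
  [0, l].\<close>

lemma \<phi>_lpow_ge: "1 \<le> j \<Longrightarrow> 1/2 \<le> \<phi> (l ^ j)"
proof (induction j rule: nat_induct_at_least)
  case base
  have "\<phi> l = \<mu> / (2 * \<mu>)" using \<phi>_outer[of l] l by (simp add: \<mu>_def)
  then show ?case using \<mu>_bounds by simp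
next
  case (Suc n)
  then show ?case using \<phi>_lpow_mono[of n] by simp
qed

lemma g_affine:
  assumes "1 \<le> j" "y \<in> {l ^ Suc j .. l ^ j}"
  shows "g y = b j + kappa l j * (l ^ j - y)"
proof -
  have "0 \<le> kappa l j * (l ^ j - y)" using kappa_pos[of j] assms by simp
  then show ?thesis using \<phi>_affine[OF assms(2)] \<phi>_lpow_ge[OF assms(1)] by (simp add: g_def b_def)
qed

lemma b_Suc: "1 \<le> j \<Longrightarrow> b (Suc j) = b j + kappa l j * l ^ j * \<mu>"
  using g_affine[of j "l ^ Suc j"] lpow_Suc[of j] by (simp add: b_def \<mu>_def algebra_simps)

lemma b_mono: "1 \<le> i \<Longrightarrow> i \<le> j \<Longrightarrow> b i \<le> b j"
proof (induction j rule: nat_induct)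
  case (Suc n)
  show ?case
  proof (cases "i \<le> n")
    case True
    then have "b n \<le> b (Suc n)" using b_Suc[of n] kappa_pos[of n] lpow_bounds(1)[of n] \<mu>_bounds Suc.prems by simp
    then show ?thesis using Suc True by simp
  next
    case False
    then have "i = Suc n" using Suc.prems by simp
    then show ?thesis by simp
  qed
qed simp

lemma b_strict: "1 \<le> i \<Longrightarrow> b i < b (Suc i)" using b_Suc[of i] kappa_pos[of i] lpow_bounds(1)[of i] \<mu>_bounds by simp

lemma b_tendsto: "b \<longlonglongrightarrow> g 0"
proof -
  have "(\<lambda>n. l ^ n) \<longlonglongrightarrow> 0" using l by (intro LIMSEQ_realpow_zero) auto
  then show ?thesis
    unfolding b_def
    by (rule continuous_on_tendsto_compose[OF g_continuous]) (use lpow_bounds less_imp_le[OF lpow_bounds(1)] in \<open>auto intro!: always_eventually\<close>)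
qed

lemma b_le_g0: "1 \<le> i \<Longrightarrow> b i \<le> g 0"
  using b_mono b_tendsto by (intro LIMSEQ_le_const[OF b_tendsto]) blast

lemma b_lt_g0: "1 \<le> i \<Longrightarrow> b i < g 0"
  using b_le_g0[of "Suc i"] b_strict[of i] by simp

lemma g_bounds: assumes "1 \<le> k" "y \<in> {0..l ^ k}" shows "b k \<le> g y" "g y \<le> g 0" "y < l ^ k \<Longrightarrow> b k < g y"
proof -
  have "b k \<le> g y \<and> g y \<le> g 0 \<and> (y < l ^ k \<longrightarrow> b k < g y)"
  proof (cases "y = 0")
    case True
    then show ?thesis using b_lt_g0[of k] assms by simp
  next
    case False
    then have "0 < y" "y \<le> 1" using assms lpow_bounds(2)[of k] by auto
    then obtain j where j: "l ^ Suc j < y" "y \<le> l ^ j" using power_bracket[OF l] by blast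
    have kj: "k \<le> j"
    proof (rule ccontr)
      assume "\<not> k \<le> j"
      then have "l ^ k \<le> l ^ Suc j" by (intro lpow_mono) simp
      then show False using j assms by simp
    qed
    have g: "g y = b j + kappa l j * (l ^ j - y)" using g_affine[of j y] j kj assms by simp
    have 1: "b k \<le> b j" using b_mono kj assms by simp
    have 2: "0 \<le> kappa l j * (l ^ j - y)" using kappa_pos[of j] j by simp
    have "kappa l j * (l ^ j - y) \<le> kappa l j * (l ^ j - l ^ Suc j)" using kappa_pos[of j] j by simp
    also have "\<dots> = b (Suc j) - b j" using b_Suc[of j] kj assms by (simp add: \<mu>_def algebra_simps)
    finally have "g y \<le> b (Suc j)" using g by simp
    then have 3: "g y \<le> g 0" using b_le_g0[of "Suc j"] by simp
    have 4: "b k < g y" if "y < l ^ k"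
    proof (cases "j = k")
      case True
      then have "0 < kappa l j * (l ^ j - y)" using kappa_pos[of j] that by simp
      then show ?thesis using g True by simp
    next
      case False
      then have "b (Suc k) \<le> b j" using b_mono[of "Suc k" j] kj by simp
      then show ?thesis using b_strict[of k] assms g 2 by simp
    qed
    show ?thesis using 1 2 3 4 g by simp
  qed
  then show "b k \<le> g y" "g y \<le> g 0" "y < l ^ k \<Longrightarrow> b k < g y" by auto
qed

section \<open>The tail of the critical value and the slope identities\<close>

text \<open>The ratio of consecutive increments \<open>b (Suc j) - b j\<close> for j \<ge> 5: the
  slope gains the factor r^2 and the letter length the factor l.\<close>

definition q :: real where "q = l ^ 3 * \<mu> ^ 2"

text \<open>The second, third and fourth bounds are what \<open>key_bound\<close> uses for j \<ge>
  5, j = 4 and j = 3.\<close>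

lemma q_bounds: "0 < q" "l ^ 4 < 1 - q" "l ^ 3 < 1 - q" "l ^ 2 * (1 - q) + l ^ 4 * \<mu> ^ 2 < 1 - q" "q < 1"
proof -
  show q0: "0 < q" using l \<mu>_bounds by (simp add: q_def)
  have "l ^ 3 * \<mu> < 1"
  proof -
    have "l ^ 3 * \<mu> \<le> 1 * \<mu>" using lpow_bounds(2)[of 3] \<mu>_bounds by (intro mult_right_mono) auto
    then show ?thesis using \<mu>_bounds by linarith
  qed
  then have a: "l ^ 3 * \<mu> * \<mu> < 1 * \<mu>" using \<mu>_bounds by (intro mult_strict_right_mono) auto
  have c: "1 - l ^ 3 = \<mu> + \<mu> * (l + l ^ 2)"
    by (simp add: \<mu>_def algebra_simps power2_eq_square power3_eq_cube)
  have "0 \<le> \<mu> * (l + l ^ 2)" using l \<mu>_bounds by simp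
  then show 3: "l ^ 3 < 1 - q" using a c by (simp add: q_def power2_eq_square mult_ac)
  have "l ^ 4 \<le> l ^ 3" by (intro lpow_mono) simp
  then show "l ^ 4 < 1 - q" using 3 by simp
  show "q < 1" using 3 lpow_bounds(1)[of 3] by linarith
  have "l ^ 3 * \<mu> * \<mu> * (1 + l) < \<mu> * (1 + l)" using a l by (intro mult_strict_right_mono) auto
  moreover have "\<mu> * (1 + l) = 1 - l ^ 2" by (simp add: \<mu>_def algebra_simps power2_eq_square)
  moreover have "0 \<le> l ^ 2 * q" using q0 by simp
  ultimately show "l ^ 2 * (1 - q) + l ^ 4 * \<mu> ^ 2 < 1 - q"
    by (simp add: q_def algebra_simps power2_eq_square power3_eq_cube power4_eq_xxxx)
qed

lemma kappa_Suc: assumes "5 \<le> j" shows "kappa l (Suc j) = kappa l j * r ^ 2"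
proof -
  have "2 * Suc j = 2 * j + 2" by simp
  then have "kappa l (Suc j) = (l ^ (2 * j + 2) * \<mu> ^ (2 * j + 2)) / (l ^ 10 * \<mu> ^ 5)"
    using assms by (simp only: kappa_def \<mu>_def) simp
  also have "\<dots> = (l ^ (2 * j) * \<mu> ^ (2 * j)) / (l ^ 10 * \<mu> ^ 5) * r ^ 2"
    unfolding power_add r_def power_mult_distrib times_divide_eq_left by (simp only: mult_ac)
  finally show ?thesis using assms unfolding kappa_def \<mu>_def by simp
qed

lemma kappa_values: "kappa l 1 = 1 / \<mu>" "kappa l 2 = 1 / l" "kappa l 3 = \<mu> / l" "kappa l 4 = \<mu> ^ 3 / l"
  "kappa l 5 = \<mu> ^ 5"
proof -
  have "kappa l 5 = (l ^ 10 * \<mu> ^ 10) / (l ^ 10 * \<mu> ^ 5)" by (simp add: kappa_def \<mu>_def)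
  also have "l ^ 10 * \<mu> ^ 10 = \<mu> ^ 5 * (l ^ 10 * \<mu> ^ 5)" by (simp add: power_add[symmetric])
  also have "\<dots> / (l ^ 10 * \<mu> ^ 5) = \<mu> ^ 5" using l \<mu>_bounds by simp
  finally show "kappa l 5 = \<mu> ^ 5" .
qed (simp_all add: kappa_def \<mu>_def)

lemma g0_tail: assumes k: "5 \<le> k" shows "g 0 - b k = kappa l k * l ^ k * \<mu> / (1 - q)"
proof -
  have kap: "kappa l (k + i) * l ^ (k + i) = kappa l k * l ^ k * q ^ i" for i
  proof (induction i)
    case (Suc i)
    have "kappa l (k + Suc i) * l ^ (k + Suc i) = kappa l (k + i) * l ^ (k + i) * (r ^ 2 * l)"
      using kappa_Suc[of "k + i"] k by simp
    also have "r ^ 2 * l = q" by (simp add: r_def q_def power2_eq_square power3_eq_cube)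
    finally show ?case using Suc by simp
  qed simp
  have "b (k + i) - b k = kappa l k * l ^ k * \<mu> * (\<Sum>a<i. q ^ a)" for i
  proof (induction i)
    case (Suc i)
    have "b (k + Suc i) - b k = (b (k + i) - b k) + kappa l (k + i) * l ^ (k + i) * \<mu>"
      using b_Suc[of "k + i"] k by simp
    then show ?case using Suc kap[of i] by (simp add: algebra_simps)
  qed simp
  then have "(\<lambda>i. b (i + k) - b k) = (\<lambda>i. kappa l k * l ^ k * \<mu> * (\<Sum>a<i. q ^ a))"
    by (simp add: add.commute)
  moreover have "(\<lambda>i. kappa l k * l ^ k * \<mu> * (\<Sum>a<i. q ^ a)) \<longlonglongrightarrow> kappa l k * l ^ k * \<mu> * (1 / (1 - q))"
    using geometric_sums[of q] q_bounds by (intro tendsto_mult_left) (simp add: sums_def)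
  ultimately have "(\<lambda>i. b (i + k) - b k) \<longlonglongrightarrow> kappa l k * l ^ k * \<mu> * (1 / (1 - q))" by simp
  moreover have "(\<lambda>i. b (i + k) - b k) \<longlonglongrightarrow> g 0 - b k"
    using LIMSEQ_ignore_initial_segment[OF b_tendsto, of k] by (intro tendsto_intros)
  ultimately show ?thesis using LIMSEQ_unique by fastforce
qed

text \<open>The slope of the flight of index j as a function of \<open>g y\<close>. It is forced by
  the wish that on V_j, where g has slope \<open>kappa l j\<close> in modulus, the whole flight has
  slope 1 / \<rho> j in modulus.\<close>

definition s :: "nat \<Rightarrow> real" where "s j = 1 / (kappa l j * \<rho> j)"

lemma s_pos: "0 < s j" using kappa_pos \<rho>_bounds by (simp add: s_def)

lemma s_kappa: "s j * kappa l j = 1 / \<rho> j" using kappa_pos[of j] by (simp add: s_def)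

text \<open>The flight of index j takes [0, l^(j+1)] to points above l^(j-1), and the left side is
  the largest overshoot. The right side is the overshoot at which the next passage, through letter
  j-2, would reach the lower end of letter max 1 (j-3). The tail of \<open>g 0\<close> is geometric
  from index 5 on; j = 3 involves the increment at 4 as well.\<close>

lemma key_bound:
  assumes "3 \<le> j"
  shows "s j * (g 0 - b (Suc j)) < \<rho> (j - 2) * l ^ (max 1 (j - 3)) * \<mu>"
proof -
  consider "j = 3" | "j = 4" | "5 \<le> j" using assms by linarith
  then show ?thesis
  proof cases
    case 1
    have "g 0 - b 4 = (g 0 - b 5) + kappa l 4 * l ^ 4 * \<mu>" using b_Suc[of 4] by simp
    also have "\<dots> = \<mu> ^ 5 * l ^ 5 * \<mu> / (1 - q) + \<mu> ^ 4 * l ^ 3"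
    proof -
      have "\<mu> ^ 3 / l * l ^ 4 * \<mu> = \<mu> ^ 4 * l ^ 3" using l by (simp add: field_simps eval_nat_numeral)
      then show ?thesis using g0_tail[of 5] by (simp add: kappa_values)
    qed
    finally have *: "g 0 - b 4 = \<mu> ^ 5 * l ^ 5 * \<mu> / (1 - q) + \<mu> ^ 4 * l ^ 3" .
    have s3: "s 3 = 1 / \<mu> ^ 2" using l \<mu>_bounds by (simp add: s_def kappa_values \<rho>_def r_def power2_eq_square)
    have "s 3 * (g 0 - b 4) = l * \<mu> ^ 2 * (l ^ 2 + l ^ 4 * \<mu> ^ 2 / (1 - q))"
      unfolding * s3 using \<mu>_bounds by (simp add: field_simps eval_nat_numeral)
    also have "l ^ 2 + l ^ 4 * \<mu> ^ 2 / (1 - q) = (l ^ 2 * (1 - q) + l ^ 4 * \<mu> ^ 2) / (1 - q)"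
      using q_bounds by (simp add: field_simps)
    also have "l * \<mu> ^ 2 * ((l ^ 2 * (1 - q) + l ^ 4 * \<mu> ^ 2) / (1 - q)) < l * \<mu> ^ 2 * 1"
      using q_bounds l \<mu>_bounds by (intro mult_strict_left_mono) (auto simp: divide_less_eq)
    finally show ?thesis using 1 by (simp add: \<rho>_def power2_eq_square mult_ac)
  next
    case 2
    have s4: "s 4 = 1 / \<mu> ^ 4" using l \<mu>_bounds by (simp add: s_def kappa_values \<rho>_def r_def power2_eq_square
          power3_eq_cube power4_eq_xxxx)
    have "s 4 * (g 0 - b 5) = l ^ 2 * \<mu> ^ 2 * (l ^ 3 / (1 - q))"
    proof -
      have g5: "g 0 - b 5 = \<mu> ^ 5 * l ^ 5 * \<mu> / (1 - q)" using g0_tail[of 5] by (simp add: kappa_values)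
      show ?thesis unfolding s4 g5 using \<mu>_bounds q_bounds by (simp add: field_simps eval_nat_numeral)
    qed
    also have "\<dots> < l ^ 2 * \<mu> ^ 2 * 1"
      using q_bounds l \<mu>_bounds by (intro mult_strict_left_mono) (auto simp: divide_less_eq)
    finally show ?thesis using 2 by (simp add: \<rho>_def r_def power2_eq_square mult_ac)
  next
    case 3
    have "s j * (g 0 - b (Suc j)) = (s j * kappa l j) * r ^ 2 * l ^ Suc j * \<mu> / (1 - q)"
      using g0_tail[of "Suc j"] kappa_Suc[OF 3] 3 by simp
    also have "\<dots> = r * l ^ Suc j * \<mu> / (1 - q)"
      unfolding s_kappa using 3 r_bounds by (simp add: \<rho>_def power2_eq_square)
    also have "l ^ Suc j = l ^ 4 * l ^ (j - 3)"
      using 3 by (simp add: power_add[symmetric])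
    also have "r * (l ^ 4 * l ^ (j - 3)) * \<mu> / (1 - q) = r * l ^ (j - 3) * \<mu> * (l ^ 4 / (1 - q))" by simp
    also have "\<dots> < r * l ^ (j - 3) * \<mu> * 1"
      using q_bounds l \<mu>_bounds r_bounds by (intro mult_strict_left_mono) (auto simp: divide_less_eq)
    finally have "s j * (g 0 - b (Suc j)) < r * l ^ (j - 3) * \<mu>" by simp
    moreover have "\<rho> (j - 2) = r" "max 1 (j - 3) = j - 3" using 3 by (auto simp: \<rho>_def)
    ultimately show ?thesis by simp
  qed
qed

text \<open>The chain rule for a flight made of the preceding flight and two passages, whose
  reversals of orientation cancel. For j = 3 and j = 4 it determines the slopes with index 4 and 5
  from that with index 3; from then on it is the factor r^2.\<close>

lemma s_Suc: assumes "3 \<le> j" shows "s (Suc j) = s j / (\<rho> (j - 2) * \<rho> (max 1 (j - 3)))"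
proof -
  consider "j = 3" | "j = 4" | "5 \<le> j" using assms by linarith
  then show ?thesis
  proof cases
    case 1
    then show ?thesis unfolding 1 using l \<mu>_bounds by (simp add: s_def kappa_values \<rho>_def r_def field_simps
          power2_eq_square power3_eq_cube power4_eq_xxxx power_Suc[of _ 4, simplified])
  next
    case 2
    then show ?thesis unfolding 2 using l \<mu>_bounds by (simp add: s_def kappa_values \<rho>_def r_def field_simps
          power2_eq_square power3_eq_cube power4_eq_xxxx power_Suc[of _ 4, simplified])
  next
    case 3
    have "\<rho> j = r" "\<rho> (Suc j) = r" "\<rho> (j - 2) = r" "\<rho> (max 1 (j - 3)) = r" using 3 by (auto simp: \<rho>_def)
    then show ?thesis using kappa_Suc[OF 3] by (simp add: s_def power2_eq_square)
  qed
qed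

text \<open>For $y \in (\lambda^{j+1}, \lambda^j]$ the induced map is the \<open>T j\<close>-th iterate (Fibonacci return times).\<close>

definition T :: "nat \<Rightarrow> nat" where "T j = fib (Suc j)"

lemma T_simps: "T 0 = 1" "T 1 = 1" "T (Suc 0) = 1" "T 2 = 2" "T 3 = 3"
  by (simp_all add: T_def eval_nat_numeral)

lemma T_pos: "1 \<le> T j" unfolding T_def using fib_neq_0_nat[of "Suc j"] by simp

text \<open>Two Fibonacci steps: T(j+1) = T j + T(j-2) + T(j-3). For j = 3 the index 0 may be
  replaced by 1 because T 0 = T 1.\<close>

lemma T_rec: assumes "3 \<le> j" shows "T (Suc j) = T (max 1 (j - 3)) + (T (j - 2) + T j)"
proof -
  obtain i where i: "j = i + 3" using assms by (metis add.commute le_Suc_ex)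
  have "T (max 1 i) = T i" by (cases i) (auto simp: T_def)
  then show ?thesis unfolding i by (simp add: T_def eval_nat_numeral)
qed

section \<open>Affine returns by induction along the Fibonacci times\<close>

text \<open>The conditions refer to the whole interval [0, l^j], so that the critical point is
  included. The second one, no visit to 0 before the return, serves hyperbolic sets. The third,
  intermediate distances dominated by the distance at the return, serves to follow the critical
  orbit; it starts at i = 1 because g itself is flat near 0.\<close>

definition flight :: "nat \<Rightarrow> bool" where
  "flight j \<longleftrightarrow>
    (\<forall>y\<in>{0..l ^ j}. (g ^^ T j) y = s j * (g y - b j)) \<and>
    (\<forall>y\<in>{0..<l ^ j}. \<forall>i. 1 \<le> i \<and> i < T j \<longrightarrow> 0 < (g ^^ i) y) \<and>
    (\<forall>y\<in>{0..l ^ j}. \<forall>y'\<in>{0..l ^ j}. \<forall>i. 1 \<le> i \<and> i \<le> T j \<longrightarrow>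
       \<bar>(g ^^ i) y - (g ^^ i) y'\<bar> \<le> \<bar>(g ^^ T j) y - (g ^^ T j) y'\<bar>)"

lemma funpow_add': "(h ^^ (m + n)) x = (h ^^ m) ((h ^^ n) x)"
  by (simp add: funpow_add)

lemma flightD:
  assumes "flight k"
  shows "y \<in> {0..l ^ k} \<Longrightarrow> (g ^^ T k) y = s k * (g y - b k)"
    and "y \<in> {0..<l ^ k} \<Longrightarrow> 1 \<le> i \<Longrightarrow> i < T k \<Longrightarrow> 0 < (g ^^ i) y"
    and "y \<in> {0..l ^ k} \<Longrightarrow> y' \<in> {0..l ^ k} \<Longrightarrow> 1 \<le> i \<Longrightarrow> i \<le> T k \<Longrightarrow>
      \<bar>(g ^^ i) y - (g ^^ i) y'\<bar> \<le> \<bar>(g ^^ T k) y - (g ^^ T k) y'\<bar>"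
  using assms unfolding flight_def by blast+

lemma flight_return:
  assumes "flight k" "1 \<le> k" "u \<in> {l ^ Suc k..l ^ k}"
  shows "(g ^^ T k) u = (l ^ k - u) / \<rho> k"
proof -
  have "0 < l ^ Suc k" by (rule lpow_bounds)
  then have "u \<in> {0..l ^ k}" using assms(3) by auto
  then have "(g ^^ T k) u = s k * (g u - b k)" using assms(1) by (simp add: flight_def)
  also have "\<dots> = (s k * kappa l k) * (l ^ k - u)" using g_affine[OF assms(2,3)] by simp
  finally show ?thesis by (simp add: s_kappa)
qed

text \<open>The point u lies just above l^(j-1), the lower end of V_(j-2). The passage through that
  letter reverses orientation, so v lies just below the top of its image; \<open>key_bound\<close>
  keeps v in letter k, and the return from there completes the flight of index j+1.\<close>

lemma flight_step:
  assumes j: "3 \<le> j" and fl: "flight j" "flight (j - 2)" "flight (max 1 (j - 3))"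
    and y: "y \<in> {0..l ^ Suc j}"
  defines "k \<equiv> max 1 (j - 3)"
  defines "u \<equiv> (g ^^ T j) y"
  defines "v \<equiv> (g ^^ T (j - 2)) u"
  shows "l ^ (j - 1) \<le> u" "u \<le> l ^ (j - 2)" "y < l ^ Suc j \<Longrightarrow> l ^ (j - 1) < u"
    "l ^ Suc k < v" "v \<le> l ^ k" "v = (l ^ (j - 2) - u) / \<rho> (j - 2)"
    "(g ^^ T k) v = s (Suc j) * (g y - b (Suc j))" "(g ^^ T (Suc j)) y = (g ^^ T k) v"
proof -
  \<comment> \<open>d is the excess of u over l^(j-1). In terms of it v = l^k - d / \<rho> (j - 2),
    and the end of the flight is the same drop divided by \<rho> k.\<close>
  define d where "d = s j * (g y - b (Suc j))"
  have Sj: "Suc (j - 2) = j - 1" "Suc (j - 1) = j" using j by auto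
  have gy: "b (Suc j) \<le> g y" "g y \<le> g 0" "y < l ^ Suc j \<Longrightarrow> b (Suc j) < g y"
    using g_bounds[OF _ y] by auto
  have d0: "0 \<le> d" using gy s_pos[of j] by (simp add: d_def)
  have "d \<le> s j * (g 0 - b (Suc j))" using gy s_pos[of j] by (simp add: d_def)
  then have dk: "d < \<rho> (j - 2) * l ^ k * \<mu>" using key_bound[OF j] by (simp add: k_def)
  have "y \<in> {0..l ^ j}" using y lpow_Suc[of j] by auto
  then have "u = s j * (g y - b j)" using fl(1) by (simp add: flight_def u_def)
  also have "\<dots> = d + (s j * kappa l j) * l ^ j * \<mu>" using b_Suc[of j] j by (simp add: d_def algebra_simps)
  also have "(s j * kappa l j) * l ^ j * \<mu> = l ^ (j - 1)"
  proof -
    have "\<rho> j = r" using j by (simp add: \<rho>_def)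
    moreover have "l ^ j = l * l ^ (j - 1)" using power_Suc[of l "j - 1"] Sj(2) by simp
    ultimately show ?thesis using l \<mu>_bounds by (simp add: s_kappa r_def)
  qed
  finally have u: "u = l ^ (j - 1) + d" by simp
  have drop: "l ^ (j - 2) - l ^ (j - 1) = \<rho> (j - 2) * l ^ k"
  proof -
    have "l ^ (j - 1) = l * l ^ (j - 2)" using power_Suc[of l "j - 2"] Sj(1) by simp
    then have 1: "l ^ (j - 2) - l ^ (j - 1) = \<mu> * l ^ (j - 2)" by (simp add: \<mu>_def algebra_simps)
    show ?thesis
    proof (cases "j = 3")
      case True
      then show ?thesis using 1 by (simp add: k_def \<rho>_def)
    next
      case False
      then have "l ^ (j - 2) = l * l ^ (j - 3)" "k = j - 3"
        using power_Suc[of l "j - 3"] j by (auto simp: k_def Suc_diff_Suc numeral_eq_Suc)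
      then show ?thesis using 1 False j by (simp add: \<rho>_def r_def mult_ac)
    qed
  qed
  have "\<rho> (j - 2) * l ^ k * \<mu> \<le> \<rho> (j - 2) * l ^ k * 1"
    using \<rho>_bounds(1)[of "j - 2"] lpow_bounds(1)[of k] \<mu>_bounds by (intro mult_left_mono) auto
  then have "d \<le> \<rho> (j - 2) * l ^ k" using dk by simp
  then show ub: "u \<le> l ^ (j - 2)" using u drop by simp
  show lb: "l ^ (j - 1) \<le> u" using u d0 by simp
  show "l ^ (j - 1) < u" if "y < l ^ Suc j" using u gy(3)[OF that] s_pos[of j] by (simp add: d_def)
  have "u \<in> {l ^ Suc (j - 2)..l ^ (j - 2)}" using lb ub Sj by simp
  then show v: "v = (l ^ (j - 2) - u) / \<rho> (j - 2)"
    unfolding v_def by (intro flight_return) (use fl j in auto)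
  then have v': "v = l ^ k - d / \<rho> (j - 2)"
    using u drop \<rho>_bounds(1)[of "j - 2"] by (simp add: field_simps)
  then show vk: "v \<le> l ^ k" using d0 \<rho>_bounds(1)[of "j - 2"] by simp
  have "d / \<rho> (j - 2) < l ^ k * \<mu>" using dk \<rho>_bounds(1)[of "j - 2"] by (simp add: field_simps)
  then show vl: "l ^ Suc k < v" using v' by (simp add: \<mu>_def algebra_simps)
  have "(g ^^ T k) v = (l ^ k - v) / \<rho> k"
    by (rule flight_return) (use fl vk vl in \<open>auto simp: k_def\<close>)
  also have "\<dots> = s (Suc j) * (g y - b (Suc j))"
    unfolding v' s_Suc[OF j] d_def k_def by simp
  finally show "(g ^^ T k) v = s (Suc j) * (g y - b (Suc j))" .
  show "(g ^^ T (Suc j)) y = (g ^^ T k) v"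
    unfolding T_rec[OF j] funpow_add' v_def u_def k_def ..
qed

lemma abs_scale_le: fixes c x y :: real assumes "0 < c" "c \<le> 1" shows "\<bar>x - y\<bar> \<le> \<bar>x / c - y / c\<bar>"
proof -
  have "\<bar>x - y\<bar> * c \<le> \<bar>x - y\<bar> * 1" using assms by (intro mult_left_mono) auto
  then show ?thesis using assms by (simp add: diff_divide_distrib[symmetric] field_simps)
qed

lemma flight_Suc:
  assumes j: "3 \<le> j" and fl: "flight j" "flight (j - 2)" "flight (max 1 (j - 3))"
  shows "flight (Suc j)"
proof -
  let ?k = "max 1 (j - 3)"
  let ?u = "\<lambda>y. (g ^^ T j) y" and ?v = "\<lambda>y. (g ^^ T (j - 2)) ((g ^^ T j) y)"
  note st = flight_step[OF j fl]
  have sub: "{0..l ^ Suc j} \<subseteq> {0..l ^ j}" "{0..<l ^ Suc j} \<subseteq> {0..<l ^ j}" using lpow_Suc[of j] by auto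
  have u: "?u y \<in> {0..l ^ (j - 2)}" if "y \<in> {0..l ^ Suc j}" for y
    using st(1,2)[OF that] lpow_bounds(1)[of "j - 1"] by auto
  have v: "?v y \<in> {0..l ^ ?k}" if "y \<in> {0..l ^ Suc j}" for y
    using st(4,5)[OF that] lpow_bounds(1)[of "Suc ?k"] by auto
  have split: "(i < T j) \<or> (\<exists>i'. i = i' + T j \<and> i' < T (j - 2)) \<or> (\<exists>i'. i = i' + (T (j - 2) + T j) \<and> i' \<le> T ?k)"
    if "i \<le> T (Suc j)" for i
  proof (cases "i < T (j - 2) + T j")
    case True
    then show ?thesis by (cases "i < T j") (auto intro!: exI[of _ "i - T j"])
  next
    case False
    then show ?thesis using that T_rec[OF j] by (auto intro!: exI[of _ "i - (T (j - 2) + T j)"])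
  qed
  \<comment> \<open>\<open>flight\<close> says nothing about i = 0, but v lies in letter k itself,
    where the return is affine with slope at least 1 in modulus. \<open>exp2\<close> treats u in
    letter j-2 in the same way.\<close>
  have exp3: "\<bar>(g ^^ i) (?v y) - (g ^^ i) (?v y')\<bar> \<le> \<bar>(g ^^ T (Suc j)) y - (g ^^ T (Suc j)) y'\<bar>"
    if "i \<le> T ?k" "y \<in> {0..l ^ Suc j}" "y' \<in> {0..l ^ Suc j}" for i y y'
  proof (cases "i = 0")
    case False
    then have "1 \<le> i" by simp
    from flightD(3)[OF fl(3) v[OF that(2)] v[OF that(3)] this that(1)]
    show ?thesis using st(8)[OF that(2)] st(8)[OF that(3)] by simp
  next
    case True
    have "(g ^^ T ?k) (?v x) = (l ^ ?k - ?v x) / \<rho> ?k" if "x \<in> {0..l ^ Suc j}" for x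
      by (rule flight_return) (use fl st(4,5)[OF that] in auto)
    then have eq: "(l ^ ?k - ?v x) / \<rho> ?k = (g ^^ T (Suc j)) x" if "x \<in> {0..l ^ Suc j}" for x
      using that st(8)[OF that] by simp
    have "\<bar>?v y - ?v y'\<bar> = \<bar>(l ^ ?k - ?v y) - (l ^ ?k - ?v y')\<bar>" by simp
    also have "\<dots> \<le> \<bar>(l ^ ?k - ?v y) / \<rho> ?k - (l ^ ?k - ?v y') / \<rho> ?k\<bar>"
      by (rule abs_scale_le) (use \<rho>_bounds[of ?k] \<mu>_bounds in auto)
    also have "\<dots> = \<bar>(g ^^ T (Suc j)) y - (g ^^ T (Suc j)) y'\<bar>"
      unfolding eq[OF that(2)] eq[OF that(3)] ..
    finally show ?thesis using True by simp
  qed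
  have exp2: "\<bar>(g ^^ i) (?u y) - (g ^^ i) (?u y')\<bar> \<le> \<bar>(g ^^ T (Suc j)) y - (g ^^ T (Suc j)) y'\<bar>"
    if "i \<le> T (j - 2)" "y \<in> {0..l ^ Suc j}" "y' \<in> {0..l ^ Suc j}" for i y y'
  proof -
    have "\<bar>(g ^^ i) (?u y) - (g ^^ i) (?u y')\<bar> \<le> \<bar>?v y - ?v y'\<bar>"
    proof (cases "i = 0")
      case False
      then have "1 \<le> i" by simp
      from flightD(3)[OF fl(2) u[OF that(2)] u[OF that(3)] this that(1)] show ?thesis .
    next
      case True
      have "\<bar>?u y - ?u y'\<bar> = \<bar>(l ^ (j - 2) - ?u y) - (l ^ (j - 2) - ?u y')\<bar>" by simp
      also have "\<dots> \<le> \<bar>(l ^ (j - 2) - ?u y) / \<rho> (j - 2) - (l ^ (j - 2) - ?u y') / \<rho> (j - 2)\<bar>"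
        by (rule abs_scale_le) (use \<rho>_bounds[of "j - 2"] \<mu>_bounds in auto)
      also have "\<dots> = \<bar>?v y - ?v y'\<bar>" unfolding st(6)[OF that(2)] st(6)[OF that(3)] ..
      finally show ?thesis using True by simp
    qed
    also have "\<dots> \<le> \<bar>(g ^^ T (Suc j)) y - (g ^^ T (Suc j)) y'\<bar>"
      using exp3[of 0 y y'] that by simp
    finally show ?thesis .
  qed
  show ?thesis
    unfolding flight_def
  proof (intro conjI ballI allI impI)
    fix y assume "y \<in> {0..l ^ Suc j}"
    then show "(g ^^ T (Suc j)) y = s (Suc j) * (g y - b (Suc j))" using st(7,8) by simp
  next
    fix y i assume y: "y \<in> {0..<l ^ Suc j}" and i: "1 \<le> i \<and> i < T (Suc j)"
    then have y': "y \<in> {0..l ^ Suc j}" "y < l ^ Suc j" by auto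
    have u': "?u y \<in> {0..<l ^ (j - 2)}" "0 < ?u y"
    proof -
      have "0 < ?v y" using st(4)[OF y'(1)] lpow_bounds(1)[of "Suc ?k"] by linarith
      then show "?u y \<in> {0..<l ^ (j - 2)}" using st(6)[OF y'(1)] u[OF y'(1)] \<rho>_bounds(1)[of "j - 2"]
        by (simp add: zero_less_divide_iff)
      show "0 < ?u y" using st(1)[OF y'(1)] lpow_bounds(1)[of "j - 1"] by linarith
    qed
    have v': "?v y \<in> {0..<l ^ ?k}" "0 < ?v y"
    proof -
      show v0: "0 < ?v y" using st(4)[OF y'(1)] lpow_bounds(1)[of "Suc ?k"] by linarith
      have "b (Suc j) < g y" by (rule g_bounds(3)) (use y' in auto)
      then have "0 < (g ^^ T ?k) (?v y)" using st(7)[OF y'(1)] s_pos[of "Suc j"] by simp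
      also have "(g ^^ T ?k) (?v y) = (l ^ ?k - ?v y) / \<rho> ?k"
        by (rule flight_return) (use fl st(4,5)[OF y'(1)] in auto)
      finally show "?v y \<in> {0..<l ^ ?k}" using \<rho>_bounds(1)[of ?k] v0 by (simp add: zero_less_divide_iff)
    qed
    consider "i < T j" | i' where "i = i' + T j" "i' < T (j - 2)"
      | i' where "i = i' + (T (j - 2) + T j)" "i' \<le> T ?k" using split[of i] i by auto
    then show "0 < (g ^^ i) y"
    proof cases
      case 1
      then show ?thesis using flightD(2)[OF fl(1), of y i] y sub(2) i by blast
    next
      case 2
      then show ?thesis using flightD(2)[OF fl(2) u'(1), of i'] u'(2) unfolding 2(1) funpow_add'
        by (cases "i' = 0") auto
    next
      case 3
      then have "i' < T ?k" using i T_rec[OF j] by simp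
      then show ?thesis using flightD(2)[OF fl(3) v'(1), of i'] v'(2) unfolding 3(1) funpow_add'
        by (cases "i' = 0") auto
    qed
  next
    fix y y' i assume y: "y \<in> {0..l ^ Suc j}" "y' \<in> {0..l ^ Suc j}" and i: "1 \<le> i \<and> i \<le> T (Suc j)"
    consider "i < T j" | i' where "i = i' + T j" "i' < T (j - 2)"
      | i' where "i = i' + (T (j - 2) + T j)" "i' \<le> T ?k" using split[of i] i by auto
    then show "\<bar>(g ^^ i) y - (g ^^ i) y'\<bar> \<le> \<bar>(g ^^ T (Suc j)) y - (g ^^ T (Suc j)) y'\<bar>"
    proof cases
      case 1
      have "\<bar>(g ^^ i) y - (g ^^ i) y'\<bar> \<le> \<bar>?u y - ?u y'\<bar>"
        using flightD(3)[OF fl(1), of y y' i] y sub(1) i 1 by force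
      also have "\<dots> \<le> \<bar>(g ^^ T (Suc j)) y - (g ^^ T (Suc j)) y'\<bar>" using exp2[of 0 y y'] y by simp
      finally show ?thesis .
    next
      case 2
      then show ?thesis using exp2[of i' y y'] y by (simp only: funpow_add')
    next
      case 3
      then show ?thesis using exp3[of i' y y'] y by (simp only: funpow_add')
    qed
  qed
qed

lemma b_values: "b 1 = 0" "b 2 = l" "b 3 = l + l * \<mu>"
proof -
  have "l \<in> {l..1}" using l by simp
  then show b1: "b 1 = 0" using g_outer[of l] by (simp add: b_def)
  show b2: "b 2 = l" using b_Suc[of 1] b1 \<mu>_bounds by (simp add: kappa_values[simplified] numeral_2_eq_2)
  show "b 3 = l + l * \<mu>" using b_Suc[of 2] b2 l
    by (simp add: kappa_values numeral_3_eq_3 power2_eq_square field_simps)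
qed

text \<open>The inductive step starts at j = 3, since it refers to the index j - 2 \<ge> 1; the
  flights of index 1, 2 and 3 are computed directly.\<close>

lemma flight_1: "flight 1"
proof -
  have "s 1 = 1" using \<mu>_bounds by (simp add: s_def kappa_values[simplified] \<rho>_def)
  then show ?thesis by (auto simp: flight_def T_simps b_values[simplified])
qed

lemma flight_2: "flight 2"
proof -
  have g1: "g y \<in> {l..1}" if "y \<in> {0..l ^ 2}" for y
    using g_bounds(1)[of 2 y] g_range[of y] that lpow_bounds(2)[of 2] b_values by auto
  have g2: "g (g y) = (g y - l) / \<mu>" if "y \<in> {0..l ^ 2}" for y using g_outer[OF g1[OF that]] .
  have s2: "s 2 = 1 / \<mu>" using l \<mu>_bounds by (simp add: s_def kappa_values \<rho>_def r_def)
  have T2: "(g ^^ T 2) y = g (g y)" for y unfolding T_simps by (simp add: numeral_2_eq_2)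
  show ?thesis
    unfolding flight_def T2
  proof (intro conjI ballI allI impI)
    fix y assume "y \<in> {0..l ^ 2}"
    then show "g (g y) = s 2 * (g y - b 2)" using g2 by (simp add: s2 b_values)
  next
    fix y i assume "y \<in> {0..<l ^ 2}" "1 \<le> i \<and> i < T 2"
    moreover from this have "i = 1" by (auto simp: T_simps)
    ultimately show "0 < (g ^^ i) y" using g1[of y] l by auto
  next
    fix y y' i assume y: "y \<in> {0..l ^ 2}" "y' \<in> {0..l ^ 2}" and "1 \<le> i \<and> i \<le> T 2"
    then consider "i = 1" | "i = 2" unfolding T_simps by linarith
    then show "\<bar>(g ^^ i) y - (g ^^ i) y'\<bar> \<le> \<bar>g (g y) - g (g y')\<bar>"
    proof cases
      case 1
      then show ?thesis using abs_scale_le[of \<mu> "g y - l" "g y' - l"] g2 y \<mu>_bounds by simp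
    qed (simp add: numeral_2_eq_2)
  qed
qed

lemma flight_3_steps:
  assumes "y \<in> {0..l ^ 3}"
  shows "g y \<in> {l..1}" "g (g y) \<in> {l..1}" "g (g y) = (g y - l) / \<mu>" "g (g (g y)) = (g (g y) - l) / \<mu>"
    "y < l ^ 3 \<Longrightarrow> l < g (g y)"
proof -
  have 1: "l + l * \<mu> \<le> g y" "y < l ^ 3 \<Longrightarrow> l + l * \<mu> < g y" "g y \<le> 1"
    using g_bounds(1,3)[of 3 y] g_range[of y] assms lpow_bounds(2)[of 3] b_values by auto
  moreover have "0 < l * \<mu>" using l \<mu>_bounds by simp
  ultimately show g1: "g y \<in> {l..1}" by simp
  show g2: "g (g y) = (g y - l) / \<mu>" using g_outer[OF g1] .
  show "g (g y) \<in> {l..1}" using 1 \<mu>_bounds g_range[of "g y"] g1 l by (simp add: g2 field_simps)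
  then show "g (g (g y)) = (g (g y) - l) / \<mu>" by (rule g_outer)
  show "l < g (g y)" if "y < l ^ 3" using 1(2)[OF that] \<mu>_bounds by (simp add: g2 field_simps)
qed

lemma flight_3: "flight 3"
proof -
  note st = flight_3_steps
  have s3: "s 3 = 1 / \<mu> ^ 2" using l \<mu>_bounds by (simp add: s_def kappa_values \<rho>_def r_def power2_eq_square)
  have T3: "(g ^^ T 3) y = g (g (g y))" for y unfolding T_simps by (simp add: numeral_3_eq_3)
  show ?thesis
    unfolding flight_def T3
  proof (intro conjI ballI allI impI)
    fix y assume y: "y \<in> {0..l ^ 3}"
    have "g (g (g y)) = ((g y - l) / \<mu> - l) / \<mu>" using st(3,4)[OF y] by simp
    also have "\<dots> = s 3 * (g y - b 3)" using \<mu>_bounds by (simp add: s3 b_values field_simps power2_eq_square)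
    finally show "g (g (g y)) = s 3 * (g y - b 3)" .
  next
    fix y i assume "y \<in> {0..<l ^ 3}" "1 \<le> i \<and> i < T 3"
    moreover from this have "i = 1 \<or> i = 2" by (auto simp: T_simps)
    ultimately show "0 < (g ^^ i) y" using st(1,2)[of y] l by (auto simp: numeral_2_eq_2)
  next
    fix y y' i assume y: "y \<in> {0..l ^ 3}" "y' \<in> {0..l ^ 3}" and "1 \<le> i \<and> i \<le> T 3"
    then have "i = 1 \<or> i = 2 \<or> i = 3" by (auto simp: T_simps)
    moreover have "\<bar>g y - g y'\<bar> \<le> \<bar>g (g y) - g (g y')\<bar>"
      using abs_scale_le[of \<mu> "g y - l" "g y' - l"] st(3) y \<mu>_bounds by simp
    moreover have "\<bar>g (g y) - g (g y')\<bar> \<le> \<bar>g (g (g y)) - g (g (g y'))\<bar>"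
      using abs_scale_le[of \<mu> "g (g y) - l" "g (g y') - l"] st(4) y \<mu>_bounds by simp
    ultimately show "\<bar>(g ^^ i) y - (g ^^ i) y'\<bar> \<le> \<bar>g (g (g y)) - g (g (g y'))\<bar>"
      by (auto simp: numeral_2_eq_2 numeral_3_eq_3)
  qed
qed

lemma flight: "1 \<le> j \<Longrightarrow> flight j"
proof (induction j rule: less_induct)
  case (less j)
  consider "j = 1" | "j = 2" | "j = 3" | "4 \<le> j" using less.prems by linarith
  then show ?case
  proof cases
    case 4
    then have "flight (Suc (j - 1))" by (intro flight_Suc less.IH) auto
    then show ?thesis using 4 by simp
  qed (use flight_1 flight_2 flight_3 in auto)
qed

section \<open>Itineraries and the critical orbit\<close>

text \<open>For y in (0,1] this is the index of the V_j that contains y. For y \<le> 0 no index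
  qualifies and the value is unspecified; statements on letters therefore ask for positive points,
  while \<open>Gn_eq\<close> and \<open>Gn_range\<close> hold in any case.\<close>

definition ell :: "real \<Rightarrow> nat" where "ell y = (LEAST j. l ^ Suc j < y)"

definition G :: "real \<Rightarrow> real" where "G y = (g ^^ T (ell y)) y"

text \<open>The letter at the top of the image of V_j, hence the smallest one that can follow j; in
  particular letter 1 never drops to 0.\<close>

definition lowest :: "nat \<Rightarrow> nat" where "lowest j = (if j = 0 then 0 else max 1 (j - 1))"

definition \<tau> :: "nat \<Rightarrow> real \<Rightarrow> nat" where "\<tau> n y = (\<Sum>i<n. T (ell ((G ^^ i) y)))"

lemma ell_eqI: assumes "l ^ Suc j < y" "y \<le> l ^ j" shows "ell y = j"
  unfolding ell_def
proof (rule Least_equality)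
  fix i assume "l ^ Suc i < y"
  show "j \<le> i"
  proof (rule ccontr)
    assume "\<not> j \<le> i"
    then have "l ^ j \<le> l ^ Suc i" by (intro lpow_mono) simp
    then show False using \<open>l ^ Suc i < y\<close> assms by simp
  qed
qed (rule assms)

lemma ell_bounds: assumes "0 < y" "y \<le> 1" shows "l ^ Suc (ell y) < y" "y \<le> l ^ ell y"
  using power_bracket[OF l assms] ell_eqI by metis+

lemma ell_ge: assumes "0 < y" "y \<le> l ^ k" shows "k \<le> ell y"
proof (rule ccontr)
  assume "\<not> k \<le> ell y"
  then have "l ^ k \<le> l ^ Suc (ell y)" by (intro lpow_mono) simp
  moreover have "y \<le> 1" using assms lpow_bounds(2)[of k] by simp
  ultimately show False using ell_bounds(1)[OF assms(1)] assms(2) by simp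
qed

lemma G_eq: assumes "0 < y" "y \<le> 1"
  shows "G y = (if ell y = 0 then (y - l) / \<mu> else (l ^ ell y - y) / \<rho> (ell y))"
proof (cases "ell y = 0")
  case True
  then show ?thesis using g_outer[of y] ell_bounds[OF assms] assms by (simp add: G_def T_simps)
next
  case False
  then show ?thesis using flight_return[OF flight, of "ell y" y] ell_bounds[OF assms] by (simp add: G_def)
qed

lemma image_length: assumes "1 \<le> j" shows "l ^ j * \<mu> = \<rho> j * l ^ lowest j"
proof (cases "j = 1")
  case False
  then have "l ^ j = l * l ^ (j - 1)" using power_Suc[of l "j - 1"] assms by simp
  then show ?thesis using False assms by (simp add: \<rho>_def r_def lowest_def max_def mult_ac)
qed (simp add: \<rho>_def lowest_def)

text \<open>Here and in \<open>G_upper_gap\<close> the distance of y to an end of its letter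
  interval is read off from the position of \<open>G y\<close> in the image. This turns lower bounds
  along the later orbit into room for perturbation.\<close>

lemma G_lower_gap:
  assumes "0 < y" "y \<le> 1" "1 \<le> ell y"
  shows "y - l ^ Suc (ell y) = \<rho> (ell y) * (l ^ lowest (ell y) - G y)"
proof -
  have "\<rho> (ell y) * G y = l ^ ell y - y" using G_eq[OF assms(1,2)] assms(3) \<rho>_bounds(1)[of "ell y"] by simp
  then have "\<rho> (ell y) * (l ^ lowest (ell y) - G y) = l ^ ell y * \<mu> - (l ^ ell y - y)"
    by (simp add: image_length[OF assms(3)] right_diff_distrib)
  then show ?thesis by (simp add: \<mu>_def algebra_simps)
qed

lemma G_upper_gap:
  assumes "0 < y" "y \<le> 1" "1 \<le> ell y"
  shows "l ^ ell y - y = \<rho> (ell y) * G y"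
  using G_eq[OF assms(1,2)] assms(3) \<rho>_bounds(1)[of "ell y"] by simp

lemma G_range: assumes "0 < y" "y \<le> 1" shows "0 \<le> G y" "G y \<le> l ^ lowest (ell y)" "G y \<le> 1"
proof -
  note e = ell_bounds[OF assms]
  show "0 \<le> G y" using G_eq[OF assms] e \<mu>_bounds \<rho>_bounds(1)[of "ell y"] by (auto simp: zero_le_divide_iff)
  show "G y \<le> l ^ lowest (ell y)"
  proof (cases "ell y = 0")
    case True
    then have "G y = (y - l) / \<mu>" using G_eq[OF assms] by simp
    also have "\<dots> \<le> \<mu> / \<mu>" using assms \<mu>_bounds by (intro divide_right_mono) (auto simp: \<mu>_def)
    finally show ?thesis using True \<mu>_bounds by (simp add: lowest_def)
  next
    case False
    then have "0 < \<rho> (ell y) * (l ^ lowest (ell y) - G y)" using G_lower_gap[OF assms] e by simp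
    then show ?thesis using \<rho>_bounds(1)[of "ell y"] by (simp add: zero_less_mult_iff)
  qed
  then show "G y \<le> 1" using lpow_bounds(2)[of "lowest (ell y)"] by linarith
qed

lemma ell_G: "0 < y \<Longrightarrow> y \<le> 1 \<Longrightarrow> 0 < G y \<Longrightarrow> lowest (ell y) \<le> ell (G y)"
  using ell_ge G_range by blast

lemma Gn_eq: "(G ^^ n) y = (g ^^ \<tau> n y) y"
proof (induction n)
  case (Suc n)
  have "\<tau> (Suc n) y = T (ell ((G ^^ n) y)) + \<tau> n y" by (simp add: \<tau>_def)
  then show ?case using Suc by (simp add: G_def funpow_add')
qed (simp add: \<tau>_def)

lemma \<tau>_ge: "n \<le> \<tau> n y"
proof (induction n)
  case (Suc n)
  then show ?case using T_pos[of "ell ((G ^^ n) y)"] by (simp add: \<tau>_def)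
qed simp

lemma Gn_range: assumes "y \<in> {0..1}" shows "(G ^^ n) y \<in> {0..1}"
  unfolding Gn_eq by (rule gn_range[OF assms])

text \<open>The letters of the itinerary of \<open>g y\<close>, for \<open>y\<close> near 0, are $0,0,1,1,2,1,3,2,4,3,\ldots$\<close>

lemma itinerary_prefix:
  assumes "3 \<le> k" "0 \<le> y" "y < l ^ k"
  shows "(\<forall>i<2*k-4. 0 < (G ^^ i) (g y) \<and> 2 * ell ((G ^^ i) (g y)) \<le> i \<and> i \<le> 2 * ell ((G ^^ i) (g y)) + 3) \<and>
    (G ^^ (2*k-4)) (g y) = (g ^^ T k) y"
  using assms
proof (induction k rule: nat_induct_at_least)
  case base
  have y: "y \<in> {0..l ^ 3}" using base by simp
  have "b 3 < g y" by (rule g_bounds(3)) (use base in auto)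
  moreover have "0 < l * \<mu>" using l \<mu>_bounds by simp
  ultimately have z: "l < g y" "g y \<le> 1" using flight_3_steps(1)[OF y] unfolding b_values by auto
  have z2: "l < g (g y)" "g (g y) \<le> 1" using flight_3_steps(2,5)[OF y] base by auto
  have e: "ell (g y) = 0" "ell (g (g y)) = 0" by (rule ell_eqI; use z z2 in simp)+
  have G1: "(G ^^ 1) (g y) = g (g y)" and G2: "G (g (g y)) = g (g (g y))" by (simp_all add: G_def e T_simps)
  have T3: "(g ^^ T 3) y = g (g (g y))" unfolding T_simps by (simp add: numeral_3_eq_3)
  have letters: "0 < (G ^^ i) (g y) \<and> 2 * ell ((G ^^ i) (g y)) \<le> i \<and> i \<le> 2 * ell ((G ^^ i) (g y)) + 3"
    if i: "i < 2" for i
  proof -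
    consider "i = 0" | "i = 1" using i by linarith
    then show ?thesis
    proof cases
      case 1
      then show ?thesis using e(1) z l by simp
    next
      case 2
      then show ?thesis using e(2) z2 l G1 by simp
    qed
  qed
  have "2 * 3 - 4 = Suc 1" by simp
  then have "(G ^^ (2 * 3 - 4)) (g y) = G ((G ^^ 1) (g y))" by (simp only: funpow.simps o_apply)
  then have "(G ^^ (2 * 3 - 4)) (g y) = (g ^^ T 3) y" unfolding G1 G2 T3 .
  then show ?case using letters by simp
next
  case (Suc k)
  have yk: "y < l ^ k" using Suc.prems lpow_Suc[of k] by simp
  note IH = Suc.IH[OF Suc.prems(1) yk]
  let ?k = "max 1 (k - 3)"
  have y: "y \<in> {0..l ^ Suc k}" using Suc.prems by simp
  note st = flight_step[OF Suc.hyps flight flight flight y]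
  have fl: "1 \<le> k" "1 \<le> k - 2" "1 \<le> ?k" using Suc.hyps by auto
  let ?u = "(g ^^ T k) y" and ?v = "(g ^^ T (k - 2)) ((g ^^ T k) y)"
  have sk: "Suc (k - 2) = k - 1" using Suc.hyps by simp
  \<comment> \<open>Passing from k to k+1 appends two letters, k-2 and max 1 (k-3), at the positions
    2k-4 and 2k-3. The two bounds on the letters are attained there for k \<ge> 4.\<close>
  have eu: "ell ?u = k - 2" by (rule ell_eqI) (use st(2,3)[OF fl] Suc.prems sk in auto)
  have ev: "ell ?v = ?k" by (rule ell_eqI) (use st(4,5)[OF fl] in auto)
  have u0: "0 < ?u" using st(1)[OF fl] lpow_bounds(1)[of "k - 1"] by linarith
  have v0: "0 < ?v" using st(4)[OF fl] lpow_bounds(1)[of "Suc ?k"] by linarith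
  have Gu: "(G ^^ (2*k-4)) (g y) = ?u" using IH by blast
  have "Suc (2*k-4) = 2*k-3" using Suc.hyps by simp
  then have Gv: "(G ^^ (2*k-3)) (g y) = ?v" using Gu by (metis G_def eu funpow.simps(2) o_apply)
  have "Suc (2*k-3) = 2 * Suc k - 4" using Suc.hyps by simp
  then have Gw: "(G ^^ (2 * Suc k - 4)) (g y) = (g ^^ T (Suc k)) y"
    using Gv st(8)[OF fl] by (metis G_def ev funpow.simps(2) o_apply)
  show ?case
  proof (intro conjI allI impI Gw)
    fix i assume i: "i < 2 * Suc k - 4"
    have "i < 2*k-4 \<or> i = 2*k-4 \<or> i = 2*k-3" using i Suc.hyps by arith
    then consider "i < 2*k-4" | "i = 2*k-4" | "i = 2*k-3" by blast
    then have "0 < (G ^^ i) (g y) \<and> 2 * ell ((G ^^ i) (g y)) \<le> i \<and> i \<le> 2 * ell ((G ^^ i) (g y)) + 3"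
    proof cases
      case 1
      then show ?thesis using IH by blast
    next
      case 2
      then show ?thesis using Gu eu u0 Suc.hyps by auto
    next
      case 3
      have "2 * ?k \<le> 2*k-3" "2*k-3 \<le> 2 * ?k + 3" using Suc.hyps by (auto simp: max_def)
      then show ?thesis unfolding 3 Gv ev using v0 by simp
    qed
    then show "0 < (G ^^ i) (g y)" "2 * ell ((G ^^ i) (g y)) \<le> i" "i \<le> 2 * ell ((G ^^ i) (g y)) + 3"
      by auto
  qed
qed

text \<open>
  Up to a bounded error the letters increase linearly. This holds along the critical orbit, and
  it is what prevents a point of the basin from coming back to small letters.
\<close>

definition climbing :: "real \<Rightarrow> bool" where
  "climbing y \<longleftrightarrow> y \<le> 1 \<and> (\<forall>n. 0 < (G ^^ n) y) \<and>
     (\<forall>i j. i \<le> j \<longrightarrow> 4 * ell ((G ^^ i) y) + (j - i) \<le> 4 * ell ((G ^^ j) y) + 8)"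

lemma climbing_g0: "climbing (g 0)"
proof -
  have *: "0 < (G ^^ i) (g 0) \<and> 2 * ell ((G ^^ i) (g 0)) \<le> i \<and> i \<le> 2 * ell ((G ^^ i) (g 0)) + 3" for i
    using itinerary_prefix[of "i + 3" 0] lpow_bounds(1) by simp
  have "4 * ell ((G ^^ i) (g 0)) + (j - i) \<le> 4 * ell ((G ^^ j) (g 0)) + 8" if "i \<le> j" for i j
    using *[of i] *[of j] that by linarith
  then show ?thesis using * g_range[of 0] by (auto simp: climbing_def)
qed

text \<open>\<open>g u\<close> stands inside the flight of u. What remains of the flight spells out
  L letters of its own, those of \<open>itinerary_prefix\<close> if k \<ge> 3, and ends at
  \<open>G u\<close>, from where the itinerary is that of u. Since L \<le> 2 k - 3, the spelled-out
  letters stay low enough to join the climb that starts from letter k.\<close>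

lemma climbing_g: assumes c: "climbing u" shows "climbing (g u)"
proof -
  define k where "k = ell u"
  have u: "0 < u" "u \<le> 1" "0 < G u"
    using c by (auto simp: climbing_def dest: spec[of _ 0] spec[of _ 1])
  have pos: "0 < (G ^^ n) u" for n using c by (simp add: climbing_def)
  have cl: "4 * ell ((G ^^ i) u) + (j - i) \<le> 4 * ell ((G ^^ j) u) + 8" if "i \<le> j" for i j
    using c that by (simp add: climbing_def)
  have "\<exists>L. L \<le> 2 * k - 3 \<and> (\<forall>i<L. 0 < (G ^^ i) (g u) \<and> 2 * ell ((G ^^ i) (g u)) \<le> i \<and>
      i \<le> 2 * ell ((G ^^ i) (g u)) + 3) \<and> (G ^^ L) (g u) = G u"
  proof -
    have lt: "u < l ^ k" if "1 \<le> k"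
    proof -
      have "0 < \<rho> k * G u" using \<rho>_bounds(1)[of k] u(3) by simp
      then show ?thesis using G_upper_gap[OF u(1,2)] that by (simp add: k_def)
    qed
    consider "k \<le> 1" | "k = 2" | "3 \<le> k" by linarith
    then show ?thesis
    proof cases
      case 1
      then have "T k = 1" by (cases k) (auto simp: T_simps)
      then have "G u = g u" by (simp add: G_def k_def)
      then show ?thesis by (intro exI[of _ 0]) simp
    next
      case 2
      have "b 2 < g u" by (rule g_bounds(3)) (use lt 2 u in auto)
      then have "l < g u" "g u \<le> 1" using g_range[of u] u b_values by auto
      then have "ell (g u) = 0" by (intro ell_eqI) auto
      moreover have "(g ^^ T 2) u = g (g u)" unfolding T_simps by (simp add: numeral_2_eq_2)
      then have "G (g u) = G u" using 2 calculation by (simp add: G_def k_def T_simps)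
      ultimately show ?thesis using 2 \<open>l < g u\<close> l by (intro exI[of _ 1]) simp
    next
      case 3
      then show ?thesis using itinerary_prefix[OF 3, of u] lt u
        by (intro exI[of _ "2 * k - 4"]) (simp add: G_def k_def)
    qed
  qed
  then obtain L where L: "L \<le> 2 * k - 3" "(G ^^ L) (g u) = G u"
    "\<And>i. i < L \<Longrightarrow> 0 < (G ^^ i) (g u) \<and> 2 * ell ((G ^^ i) (g u)) \<le> i \<and> i \<le> 2 * ell ((G ^^ i) (g u)) + 3"
    by blast
  have shift: "(G ^^ i) (g u) = (G ^^ (i - L + 1)) u" if "L \<le> i" for i
  proof -
    have "(G ^^ i) (g u) = (G ^^ (i - L)) ((G ^^ L) (g u))" using that by (simp add: funpow_add'[symmetric])
    also have "\<dots> = (G ^^ (i - L)) (G u)" using L(2) by simp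
    finally show ?thesis by (simp add: funpow_swap1)
  qed
  have "0 < (G ^^ n) (g u)" for n
    using L(3)[of n] shift[of n] pos[of "Suc (n - L)"] by (cases "n < L") auto
  moreover have "4 * ell ((G ^^ i) (g u)) + (j - i) \<le> 4 * ell ((G ^^ j) (g u)) + 8" if ij: "i \<le> j" for i j
  proof -
    consider "j < L" | "i < L" "L \<le> j" | "L \<le> i" using ij by linarith
    then show ?thesis
    proof cases
      case 1
      then show ?thesis using L(3)[of i] L(3)[of j] ij by linarith
    next
      case 2
      have "4 * k + (j - L + 1) \<le> 4 * ell ((G ^^ j) (g u)) + 8"
        using cl[of 0 "j - L + 1"] shift[OF 2(2)] by (simp add: k_def)
      then show ?thesis using L(1) L(3)[OF 2(1)] 2 by linarith
    next
      case 3
      then show ?thesis using cl[of "i - L + 1" "j - L + 1"] shift[of i] shift[of j] ij by simp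
    qed
  qed
  ultimately show ?thesis using g_range[of u] u by (simp add: climbing_def)
qed

lemma climbing_critical_orbit: assumes "1 \<le> n" shows "climbing ((g ^^ n) 0)"
  using assms by (induction n rule: nat_induct_at_least) (use climbing_g0 climbing_g in auto)

section \<open>Stability of letters and the exclusion of late returns to letter 1\<close>

text \<open>Near the upper end of its interval a point has small \<open>G u\<close>. Near the lower
  end, \<open>G u\<close> is close to the top of the image, hence in the top letter, and
  \<open>G (G u)\<close> is small. So lower bounds for two further iterates keep u away from both
  ends, and each step back costs a factor r.\<close>

lemma letter_stable:
  assumes u: "0 < u" "u \<le> 1" "1 \<le> ell u" "1 \<le> ell (G u)" "c \<le> G u" "c \<le> G (G u)" and c: "0 < c"
    and near: "\<bar>u' - u\<bar> < r ^ 2 * c"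
  shows "ell u' = ell u"
proof (rule ell_eqI)
  have r1: "r < 1" using r_bounds \<mu>_bounds by simp
  have G1: "0 < G u" "G u \<le> 1" using u c G_range[OF u(1,2)] by auto
  have "r ^ 2 * c \<le> r * c" using r_bounds r1 c by (simp add: power2_eq_square)
  also have "\<dots> \<le> \<rho> (ell u) * G u" using u(5) \<rho>_bounds(1,3)[of "ell u"] c r_bounds by (intro mult_mono) auto
  also have "\<dots> = l ^ ell u - u" using G_upper_gap[OF u(1-3)] by simp
  finally show "u' \<le> l ^ ell u" using near by simp
  have "r * c \<le> l ^ lowest (ell u) - G u"
  proof (cases "ell (G u) = lowest (ell u)")
    case True
    have "r * c \<le> \<rho> (ell (G u)) * G (G u)" using u(6) \<rho>_bounds(1,3)[of "ell (G u)"] c r_bounds by (intro mult_mono) auto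
    also have "\<dots> = l ^ ell (G u) - G u" using G_upper_gap[OF G1 u(4)] by simp
    finally show ?thesis using True by simp
  next
    case False
    then have "Suc (lowest (ell u)) \<le> ell (G u)" using ell_G[OF u(1,2) G1(1)] by simp
    then have "G u \<le> l ^ Suc (lowest (ell u))" using ell_bounds(2)[OF G1] lpow_mono order_trans by blast
    then have 1: "l ^ lowest (ell u) * \<mu> \<le> l ^ lowest (ell u) - G u" by (simp add: \<mu>_def algebra_simps)
    have "c \<le> l ^ lowest (ell u)" using u(5) G_range(2)[OF u(1,2)] by simp
    then have "r * c \<le> \<mu> * l ^ lowest (ell u)" using r_bounds c \<mu>_bounds by (intro mult_mono) auto
    then show ?thesis using 1 by (simp add: mult.commute)
  qed
  then have "r * (r * c) \<le> \<rho> (ell u) * (l ^ lowest (ell u) - G u)"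
    using \<rho>_bounds(1,3)[of "ell u"] c r_bounds by (intro mult_mono) auto
  also have "\<dots> = u - l ^ Suc (ell u)" using G_lower_gap[OF u(1-3)] by simp
  finally show "l ^ Suc (ell u) < u'" using near by (simp add: power2_eq_square mult.assoc)
qed

text \<open>As long as letters agree, G expands distances by at most 1/r per step. An initial error
  below r^(n+2) * c is thus below r^2 * c up to time n, as \<open>letter_stable\<close> requires;
  the two extra times are those it looks ahead.\<close>

lemma letters_stable:
  assumes w: "0 < w" "w \<le> 1" and pos: "\<And>i. i \<le> n + 2 \<Longrightarrow> c \<le> (G ^^ i) w"
    and c: "0 < c" and ell: "\<And>i. i \<le> n + 2 \<Longrightarrow> 1 \<le> ell ((G ^^ i) w)"
    and w': "w' \<le> 1" "\<And>i. 0 < (G ^^ i) w'" and near: "\<bar>w' - w\<bar> < r ^ (n + 2) * c"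
    and i: "i \<le> n"
  shows "ell ((G ^^ i) w') = ell ((G ^^ i) w) \<and> \<bar>(G ^^ i) w' - (G ^^ i) w\<bar> * r ^ i \<le> \<bar>w' - w\<bar>"
  using i
proof (induction i)
  have r1: "r \<le> 1" using r_bounds \<mu>_bounds by simp
  have st: "ell ((G ^^ i) w') = ell ((G ^^ i) w)"
    if "i \<le> n" "\<bar>(G ^^ i) w' - (G ^^ i) w\<bar> * r ^ i \<le> \<bar>w' - w\<bar>" for i
  proof (rule letter_stable[where c = c])
    show "0 < (G ^^ i) w" using pos[of i] c that by simp
    show "(G ^^ i) w \<le> 1" using Gn_range[of w i] w by simp
    show "1 \<le> ell ((G ^^ i) w)" "1 \<le> ell (G ((G ^^ i) w))" using ell[of i] ell[of "Suc i"] that by auto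
    show "c \<le> G ((G ^^ i) w)" "c \<le> G (G ((G ^^ i) w))" using pos[of "Suc i"] pos[of "Suc (Suc i)"] that by auto
    have 1: "r ^ (n + 2) * c \<le> r ^ (i + 2) * c" using that r_bounds r1 c by (intro mult_right_mono power_decreasing) auto
    then have "\<bar>(G ^^ i) w' - (G ^^ i) w\<bar> * r ^ i < (r ^ 2 * c) * r ^ i"
    proof -
      have "r ^ (i + 2) * c = (r ^ 2 * c) * r ^ i" by (simp add: power_add mult_ac power2_eq_square)
      moreover have "\<bar>w' - w\<bar> < r ^ (i + 2) * c" using near 1 by linarith
      ultimately show ?thesis using that(2) by linarith
    qed
    then show "\<bar>(G ^^ i) w' - (G ^^ i) w\<bar> < r ^ 2 * c" using r_bounds by simp
  qed (rule c)
  {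
    case 0
    then show ?case using st[of 0] by simp
  next
    case (Suc i)
    define p p' where "p = (G ^^ i) w" and "p' = (G ^^ i) w'"
    have IH: "ell p' = ell p" "\<bar>p' - p\<bar> * r ^ i \<le> \<bar>w' - w\<bar>" using Suc by (auto simp: p_def p'_def)
    have p: "0 < p" "p \<le> 1" "1 \<le> ell p" "0 < p'" "p' \<le> 1"
      using pos[of i] c ell[of i] Suc.prems Gn_range[of w i] Gn_range[of w' i] w w' w'(2)[of 0] by (auto simp: p_def p'_def)
    have "G p' - G p = (p - p') / \<rho> (ell p)"
      using G_eq[OF p(1,2)] G_eq[OF p(4,5)] IH(1) p(3) by (simp add: diff_divide_distrib[symmetric])
    then have "\<bar>G p' - G p\<bar> * r = \<bar>p' - p\<bar> * (r / \<rho> (ell p))"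
      using \<rho>_bounds(1)[of "ell p"] by (simp add: abs_minus_commute)
    also have "\<dots> \<le> \<bar>p' - p\<bar> * 1" using \<rho>_bounds[of "ell p"] by (intro mult_left_mono) auto
    finally have "\<bar>G p' - G p\<bar> * r * r ^ i \<le> \<bar>p' - p\<bar> * r ^ i" using r_bounds by (intro mult_right_mono) auto
    then have "\<bar>(G ^^ Suc i) w' - (G ^^ Suc i) w\<bar> * r ^ Suc i \<le> \<bar>w' - w\<bar>"
      using IH(2) by (simp add: p_def p'_def mult_ac)
    then show ?case using st[of "Suc i"] Suc.prems by blast
  }
qed

text \<open>Letters drop by at most one per step, so a window of 19 steps ending at letter 1 has
  letters at most 20, and its points are at least l^21. Then w' shares the letters of w up to time
  17 = 19 - 2, where the letter is at most 3. As the first letter is at least 1, climbing would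
  require 4 + 17 \<le> 12 + 8.\<close>

lemma no_return_to_1:
  assumes w: "0 < w" "w \<le> 1" and pos: "\<And>i. i \<le> 19 \<Longrightarrow> 0 < (G ^^ i) w"
    and ell: "\<And>i. i \<le> 19 \<Longrightarrow> 1 \<le> ell ((G ^^ i) w)" "ell ((G ^^ 19) w) = 1"
    and w': "climbing w'" and near: "\<bar>w' - w\<bar> < r ^ 19 * l ^ 21"
  shows False
proof -
  have range: "(G ^^ i) w \<le> 1" for i using Gn_range[of w i] w by simp
  have desc: "ell ((G ^^ (19 - i)) w) \<le> 1 + i" if "i \<le> 19" for i
    using that
  proof (induction i)
    case (Suc i)
    have "Suc (19 - Suc i) = 19 - i" using Suc.prems by simp
    then have "lowest (ell ((G ^^ (19 - Suc i)) w)) \<le> ell ((G ^^ (19 - i)) w)"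
      using ell_G[of "(G ^^ (19 - Suc i)) w"] pos[of "19 - Suc i"] pos[of "19 - i"] range
      by (metis diff_le_self funpow.simps(2) o_apply)
    then show ?case using Suc by (auto simp: lowest_def split: if_splits)
  qed (use ell in simp)
  have low: "l ^ 21 \<le> (G ^^ i) w" if "i \<le> 19" for i
  proof -
    have "ell ((G ^^ i) w) \<le> 20" using desc[of "19 - i"] that by simp
    then have "l ^ 21 \<le> l ^ Suc (ell ((G ^^ i) w))" by (intro lpow_mono) simp
    then show ?thesis using ell_bounds(1)[OF pos[OF that] range] by simp
  qed
  have "ell ((G ^^ i) w') = ell ((G ^^ i) w)" if "i \<le> 17" for i
    using letters_stable[of w 17 "l ^ 21" w' i] w low lpow_bounds(1)[of 21] ell w' near that
    by (auto simp: climbing_def)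
  from this[of 0] this[of 17] have "ell ((G ^^ 0) w') = ell ((G ^^ 0) w)" "ell ((G ^^ 17) w') = ell ((G ^^ 17) w)"
    by simp_all
  moreover have "4 * ell ((G ^^ 0) w') + (17 - 0) \<le> 4 * ell ((G ^^ 17) w') + 8"
    using w' unfolding climbing_def by blast
  moreover have "1 \<le> ell ((G ^^ 0) w)" "ell ((G ^^ 17) w) \<le> 3" using ell(1)[of 0] desc[of 2] by auto
  ultimately show False by linarith
qed

section \<open>Upper bounds\<close>

lemma r_powr_t2: "r powr t2 l = 1 / 4" "0 < t2 l"
proof -
  have r1: "ln r < 0" using r_bounds \<mu>_bounds by simp
  have t: "t2 l = - (ln 4 / ln r)" by (simp add: t2_def r_def \<mu>_def)
  then show "0 < t2 l" using r1 by (simp add: divide_less_0_iff)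
  have "t2 l * ln r = - ln 4" using r1 by (simp add: t)
  then have "r powr t2 l = exp (- ln 4)" using r_bounds unfolding powr_def by simp
  then show "r powr t2 l = 1 / 4" by (simp add: exp_minus)
qed

text \<open>The square of the left side is at most r^t2 = 1/4. Used with c = \<mu> when l \<ge> 1/2
  and with c = l when l \<le> 1/2.\<close>

lemma powr_t2_le_half: assumes "0 < c" "c ^ 2 \<le> r" shows "c powr t2 l \<le> 1 / 2"
proof -
  have "(c powr t2 l) ^ 2 = (c ^ 2) powr t2 l"
    using assms(1) by (simp add: powr_power_swap)
  also have "\<dots> \<le> r powr t2 l" using assms r_powr_t2 by (intro powr_mono2) auto
  also have "\<dots> = (1 / 2) ^ 2" by (simp add: r_powr_t2 power2_eq_square)
  finally show ?thesis by (rule power2_le_imp_le) simp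
qed

text \<open>g has countably many affine branches with Lipschitz inverses \<open>h j\<close>, and
  only 0 lies on none of them. This allows finitely many initial iterates to be ignored.\<close>

lemma hausdorff_null_g_vimage:
  assumes "hausdorff_null \<sigma> N" "0 < \<sigma>"
  shows "hausdorff_null \<sigma> {y \<in> {0..1}. g y \<in> N}"
proof -
  define h where "h j u = (if j = 0 then l + \<mu> * u else l ^ j - (u - b j) / kappa l j)" for j u
  have "hausdorff_null \<sigma> (h j ` N)" for j
  proof (rule hausdorff_null_lipschitz[OF assms(1), of _ "if j = 0 then \<mu> else 1 / kappa l j"])
    fix u v
    show "\<bar>h j u - h j v\<bar> \<le> (if j = 0 then \<mu> else 1 / kappa l j) * \<bar>u - v\<bar>"
    proof (cases "j = 0")
      case True
      then have "h j u - h j v = \<mu> * (u - v)" by (simp add: h_def algebra_simps)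
      then show ?thesis using True \<mu>_bounds by (simp add: abs_mult)
    next
      case False
      then have "h j u - h j v = (v - u) / kappa l j" by (simp add: h_def diff_divide_distrib)
      then show ?thesis using False kappa_pos[of j] by (simp add: abs_minus_commute)
    qed
  qed (use \<mu>_bounds kappa_pos assms in auto)
  then have "hausdorff_null \<sigma> ((\<Union>j. h j ` N) \<union> {0})"
    using assms(2) by (intro hausdorff_null_Un hausdorff_null_UN hausdorff_null_singleton)
  moreover have "{y \<in> {0..1}. g y \<in> N} \<subseteq> (\<Union>j. h j ` N) \<union> {0}"
  proof
    fix y assume y: "y \<in> {y \<in> {0..1}. g y \<in> N}"
    show "y \<in> (\<Union>j. h j ` N) \<union> {0}"
    proof (cases "y = 0")
      case False
      then have y': "0 < y" "y \<le> 1" using y by auto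
      note e = ell_bounds[OF y']
      have "y = h (ell y) (g y)"
      proof (cases "ell y = 0")
        case True
        then show ?thesis using g_outer[of y] e y' \<mu>_bounds by (simp add: h_def)
      next
        case False
        then show ?thesis using g_affine[of "ell y" y] e kappa_pos[of "ell y"] by (simp add: h_def)
      qed
      then show ?thesis using y by blast
    qed simp
  qed
  ultimately show ?thesis by (rule hausdorff_null_subset[rotated])
qed

lemma hausdorff_null_gn_vimage:
  assumes "hausdorff_null \<sigma> N" "0 < \<sigma>"
  shows "hausdorff_null \<sigma> {y \<in> {0..1}. (g ^^ n) y \<in> N}"
proof (induction n)
  case 0
  show ?case by (rule hausdorff_null_subset[OF _ assms(1)]) auto
next
  case (Suc n)
  have "{y \<in> {0..1}. (g ^^ Suc n) y \<in> N} = {y \<in> {0..1}. g y \<in> {y \<in> {0..1}. (g ^^ n) y \<in> N}}"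
    using g_range by (auto simp: funpow_swap1)
  then show ?case using hausdorff_null_g_vimage[OF Suc assms(2)] by simp
qed

lemma hausdorff_null_unfold:
  fixes N :: "real set"
  assumes "hausdorff_null \<sigma> N" "0 < \<sigma>"
  shows "hausdorff_null \<sigma> {x. \<bar>2 * x - 1\<bar> \<in> N}"
proof -
  have "hausdorff_null \<sigma> ((\<lambda>u. (1 - u) / 2) ` N \<union> (\<lambda>u. (1 + u) / 2) ` N)"
    by (intro hausdorff_null_Un hausdorff_null_lipschitz[OF assms(1), of _ "1/2"])
       (use assms in \<open>auto simp: abs_if field_simps\<close>)
  moreover have "{x. \<bar>2 * x - 1\<bar> \<in> N} \<subseteq> (\<lambda>u. (1 - u) / 2) ` N \<union> (\<lambda>u. (1 + u) / 2) ` N"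
  proof
    fix x assume x: "x \<in> {x. \<bar>2 * x - 1\<bar> \<in> N}"
    show "x \<in> (\<lambda>u. (1 - u) / 2) ` N \<union> (\<lambda>u. (1 + u) / 2) ` N"
    proof (cases "2 * x \<ge> 1")
      case True
      then have "x = (1 + \<bar>2 * x - 1\<bar>) / 2" by simp
      then show ?thesis using x by blast
    next
      case False
      then have "x = (1 - \<bar>2 * x - 1\<bar>) / 2" by simp
      then show ?thesis using x by blast
    qed
  qed
  ultimately show ?thesis by (rule hausdorff_null_subset[rotated])
qed

lemma hyperbolic_dim_le:
  assumes half: "1/2 \<le> l" and \<Lambda>: "hyperbolic_set f \<Lambda>"
  shows "hausdorff_dim \<Lambda> \<le> ereal (t2 l)"
proof (rule hausdorff_dim_le)
  fix \<sigma> assume \<sigma>: "t2 l < \<sigma>"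
  obtain \<epsilon> where \<epsilon>: "0 < \<epsilon>" "\<And>x. x \<in> \<Lambda> \<Longrightarrow> \<epsilon> \<le> \<bar>x - 1/2\<bar>" and L: "\<Lambda> \<subseteq> {0..1}" "f ` \<Lambda> \<subseteq> \<Lambda>"
    using \<Lambda> unfolding hyperbolic_set_def by blast
  \<comment> \<open>All orbit points exceed l^N, so letters above N do not occur. This replaces a
    decay of diameters and gives the constant 2^N.\<close>
  obtain N where N: "l ^ N < \<epsilon>" using real_arch_pow_inv[of \<epsilon> l] \<epsilon> l by blast
  define E where "E j = {y. 0 < y \<and> y \<le> 1 \<and> ell y = j \<and> (\<forall>n. \<epsilon> \<le> (g ^^ n) y)}" for j
  have bd: "bounded (E j)" for j by (rule bounded_subset[of "{0..1}"]) (auto simp: E_def)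
  have diam: "diameter (E j) \<le> 1" for j
    by (rule diameter_le) (auto simp: E_def)
  have \<mu>2: "\<mu> powr t2 l \<le> 1/2"
    by (rule powr_t2_le_half) (use half \<mu>_bounds in \<open>auto simp: r_def \<mu>_def power2_eq_square\<close>)
  have "hausdorff_null \<sigma> (\<Union>j. E j)"
  \<comment> \<open>The weight inequality is an equality for j \<ge> 2, by r^t2 = 1/4; for the
    letters 0 and 1 it says \<mu>^t2 \<le> 1/2.\<close>
  proof (rule hausdorff_null_recursive_cover[where t = "t2 l" and C = "2 ^ N" and m = lowest and \<rho> = \<rho> and \<theta> = \<mu>
        and \<gamma> = "\<lambda>j u. if j = 0 then l + \<mu> * u else l ^ j - \<rho> j * u"])
    fix j
    let ?\<gamma> = "\<lambda>u. if j = 0 then l + \<mu> * u else l ^ j - \<rho> j * u"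
    show "E j \<subseteq> ?\<gamma> ` ({0} \<union> (\<Union>k\<in>{lowest j..}. E k))"
    proof
      fix y assume y: "y \<in> E j"
      then have y': "0 < y" "y \<le> 1" "ell y = j" by (auto simp: E_def)
      have "\<epsilon> \<le> (g ^^ n) (G y)" for n using y by (simp add: E_def G_def funpow_add'[symmetric])
      moreover from this[of 0] have "0 < G y" using \<epsilon> by simp
      ultimately have "G y \<in> E (ell (G y))" using G_range[OF y'(1,2)] by (simp add: E_def)
      moreover have "lowest j \<le> ell (G y)" using ell_G[OF y'(1,2) \<open>0 < G y\<close>] y' by simp
      ultimately have "G y \<in> {0} \<union> (\<Union>k\<in>{lowest j..}. E k)" by blast
      moreover have "y = ?\<gamma> (G y)" using G_eq[OF y'(1,2)] y'(3) \<mu>_bounds \<rho>_bounds(1)[of j] by simp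
      ultimately show "y \<in> ?\<gamma> ` ({0} \<union> (\<Union>k\<in>{lowest j..}. E k))" by blast
    qed
    show "\<bar>?\<gamma> u - ?\<gamma> v\<bar> \<le> \<rho> j * \<bar>u - v\<bar>" for u v
    proof (cases "j = 0")
      case True
      have "\<mu> * u - \<mu> * v = \<mu> * (u - v)" by (simp add: algebra_simps)
      then show ?thesis using True \<mu>_bounds by (simp add: \<rho>_def abs_mult)
    next
      case False
      have "l ^ j - \<rho> j * u - (l ^ j - \<rho> j * v) = \<rho> j * (v - u)" by (simp add: algebra_simps)
      then show ?thesis using False \<rho>_bounds(1)[of j] by (simp add: abs_mult abs_minus_commute)
    qed
    show "\<rho> j powr t2 l * (2 * (1/2) ^ lowest j) \<le> (1/2) ^ j"
    proof -
      consider "j = 0" | "j = 1" | i where "j = i + 2" by (metis One_nat_def add_2_eq_Suc' not0_implies_Suc)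
      then show ?thesis
      proof cases
        case 3
        then show ?thesis by (simp add: \<rho>_def lowest_def r_powr_t2)
      qed (use \<mu>2 in \<open>auto simp: \<rho>_def lowest_def\<close>)
    qed
    show "diameter (E j) powr t2 l \<le> 2 ^ N * (1/2) ^ j"
    proof (cases "j \<le> N")
      case True
      have "diameter (E j) powr t2 l \<le> 1" using diam diameter_ge_0[OF bd] r_powr_t2 by (intro powr_le1) auto
      also have "(1::real) \<le> 2 ^ (N - j)" by simp
      also have "\<dots> = 2 ^ N * (1/2) ^ j" using True by (simp add: power_diff power_divide)
      finally show ?thesis .
    next
      case False
      have "E j = {}"
      proof -
        have "False" if "y \<in> E j" for y
        proof -
          have "y \<le> l ^ j" using ell_bounds(2)[of y] that by (auto simp: E_def)
          also have "\<dots> \<le> l ^ N" using False by (intro lpow_mono) simp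
          moreover have "\<epsilon> \<le> (g ^^ 0) y" using that unfolding E_def by blast
          ultimately show False using N by simp
        qed
        then show ?thesis by blast
      qed
      then show ?thesis by simp
    qed
  qed (use \<sigma> r_powr_t2 \<rho>_bounds \<mu>_bounds bd diam in auto)
  then have "hausdorff_null \<sigma> {x. \<bar>2 * x - 1\<bar> \<in> (\<Union>j. E j)}" using \<sigma> r_powr_t2 by (intro hausdorff_null_unfold) auto
  moreover have "\<Lambda> \<subseteq> {x. \<bar>2 * x - 1\<bar> \<in> (\<Union>j. E j)}"
  proof
    fix x assume x: "x \<in> \<Lambda>"
    have inv: "(f ^^ n) x \<in> \<Lambda>" for n using x L(2) by (induction n) auto
    have "\<epsilon> \<le> (g ^^ n) \<bar>2 * x - 1\<bar>" for n
    proof -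
      have "\<bar>2 * (f ^^ n) x - 1\<bar> = 2 * \<bar>(f ^^ n) x - 1/2\<bar>" by (simp add: abs_if)
      then show ?thesis using abs_fn[of x n] x L(1) \<epsilon>(2)[OF inv[of n]] \<epsilon>(1) by force
    qed
    moreover from this[of 0] have "0 < \<bar>2 * x - 1\<bar>" using \<epsilon> by simp
    moreover have "\<bar>2 * x - 1\<bar> \<le> 1" using x L(1) by (auto simp: abs_if)
    ultimately show "x \<in> {x. \<bar>2 * x - 1\<bar> \<in> (\<Union>j. E j)}" by (simp add: E_def)
  qed
  ultimately show "hausdorff_null \<sigma> \<Lambda>" by (rule hausdorff_null_subset[rotated])
qed (use r_powr_t2 in simp)

section \<open>The omega-limit set and the letters of basin points\<close>

definition \<omega> :: "real set" where "\<omega> = omega_limit f (1/2)"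

lemma T_ge: "k \<le> T k"
proof -
  have "k \<le> T k \<and> k + 1 \<le> T (k + 1)"
  proof (induction k)
    case (Suc k)
    have "T (Suc k + 1) = T (Suc k) + T k" by (simp add: T_def)
    then show ?case using Suc T_pos[of k] by simp
  qed (simp add: T_simps)
  then show ?thesis ..
qed

lemma gT_le: assumes "3 \<le> k" "y \<in> {0..l ^ Suc k}" shows "(g ^^ T k) y \<le> l ^ (k - 2)"
  using flight_step(2)[OF assms(1) flight flight flight assms(2)] assms(1) by simp

lemma fn_critical: "\<bar>2 * (f ^^ n) (1/2) - 1\<bar> = (g ^^ n) 0"
  using abs_fn[of "1/2" n] by simp

text \<open>The critical point is recurrent: by \<open>gT_le\<close> the iterate T k brings it back
  within l^(k-2) in the coordinate y.\<close>

lemma critical_in_\<omega>: "1/2 \<in> \<omega>"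
  unfolding \<omega>_def omega_limit_def
proof (intro INT_I)
  fix N
  show "1/2 \<in> closure {(f ^^ n) (1/2) |n. N \<le> n}"
    unfolding closure_approachable
  proof (intro allI impI)
    fix e :: real assume e: "0 < e"
    obtain M where M: "l ^ M < e" using real_arch_pow_inv[of e l] e l by blast
    define k where "k = N + M + 3"
    have "(g ^^ T k) 0 \<le> l ^ (k - 2)" by (rule gT_le) (use lpow_bounds(1)[of "Suc k"] in \<open>auto simp: k_def\<close>)
    also have "\<dots> \<le> l ^ M" by (rule lpow_mono) (simp add: k_def)
    finally have "\<bar>2 * (f ^^ T k) (1/2) - 1\<bar> < e" using M fn_critical by simp
    then have "dist ((f ^^ T k) (1/2)) (1/2) < e" by (simp add: dist_real_def abs_if split: if_splits)
    moreover have "N \<le> T k" using T_ge[of k] by (simp add: k_def)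
    ultimately show "\<exists>y\<in>{(f ^^ n) (1/2) |n. N \<le> n}. dist y (1/2) < e" by blast
  qed
qed

text \<open>The omega-limit set lies in the closure of the critical orbit from time 1 on, so points
  of that orbit can replace it; a time at least 1 is what \<open>climbing_critical_orbit\<close>
  asks for. The two errors \<eta>/4 are doubled by the change of coordinate.\<close>

lemma basin_approx:
  assumes x: "x \<in> Bas l" and \<eta>: "0 < \<eta>"
  shows "\<exists>N. \<forall>n\<ge>N. \<exists>m\<ge>1. \<bar>(g ^^ n) \<bar>2 * x - 1\<bar> - (g ^^ m) 0\<bar> < \<eta>"
proof -
  have x01: "x \<in> {0..1}" and lim: "(\<lambda>n. infdist ((f ^^ n) x) \<omega>) \<longlonglongrightarrow> 0" using x by (auto simp: Bas_def \<omega>_def)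
  obtain N where N: "\<And>n. n \<ge> N \<Longrightarrow> infdist ((f ^^ n) x) \<omega> < \<eta> / 4"
    using order_tendstoD(2)[OF lim, of "\<eta> / 4"] \<eta> by (auto simp: eventually_sequentially)
  have "\<exists>m\<ge>1. \<bar>(g ^^ n) \<bar>2 * x - 1\<bar> - (g ^^ m) 0\<bar> < \<eta>" if "n \<ge> N" for n
  proof -
    have ne: "\<omega> \<noteq> {}" using critical_in_\<omega> by blast
    have "(INF p\<in>\<omega>. dist ((f ^^ n) x) p) < \<eta> / 4" using N[OF that] ne by (simp add: infdist_def)
    then obtain p where p: "p \<in> \<omega>" "dist ((f ^^ n) x) p < \<eta> / 4"
      using ne by (subst (asm) cINF_less_iff) (auto intro!: bdd_belowI[of _ 0])
    have pc: "p \<in> closure {(f ^^ m) (1/2) |m. 1 \<le> m}" using p(1) unfolding \<omega>_def omega_limit_def by blast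
    obtain m where m: "1 \<le> m" "dist ((f ^^ m) (1/2)) p < \<eta> / 4"
    proof -
      have "\<exists>q\<in>{(f ^^ m) (1/2) |m. 1 \<le> m}. dist q p < \<eta> / 4"
        using pc \<eta> unfolding closure_approachable by (elim allE[of _ "\<eta> / 4"]) simp
      then show ?thesis using that by blast
    qed
    have "\<bar>(f ^^ n) x - (f ^^ m) (1/2)\<bar> < \<eta> / 2" using p(2) m(2) unfolding dist_real_def by linarith
    then have "\<bar>\<bar>2 * (f ^^ n) x - 1\<bar> - \<bar>2 * (f ^^ m) (1/2) - 1\<bar>\<bar> < \<eta>" by linarith
    then have "\<bar>(g ^^ n) \<bar>2 * x - 1\<bar> - (g ^^ m) 0\<bar> < \<eta>" unfolding abs_fn[OF x01] fn_critical .
    then show ?thesis using m(1) by blast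
  qed
  then show ?thesis by blast
qed

text \<open>A late letter 1 is viewed through the window of 19 letters before it. At the start of
  the window the point is close to a point of the critical orbit, against
  \<open>no_return_to_1\<close>; \<open>\<tau>_ge\<close> ensures that late in induced time is late
  for g.\<close>

lemma basin_letters:
  assumes x: "x \<in> Bas l" and y: "y = \<bar>2 * x - 1\<bar>" and pos: "\<And>n. 0 < (G ^^ n) y"
    and ge1: "\<And>n. N0 \<le> n \<Longrightarrow> 1 \<le> ell ((G ^^ n) y)"
  shows "\<exists>N\<ge>N0. \<forall>n\<ge>N. 2 \<le> ell ((G ^^ n) y)"
proof (rule ccontr)
  assume neg: "\<not> ?thesis"
  have y01: "y \<in> {0..1}" using x by (auto simp: Bas_def y abs_if)
  obtain N where N: "\<And>n. N \<le> n \<Longrightarrow> \<exists>m\<ge>1. \<bar>(g ^^ n) y - (g ^^ m) 0\<bar> < r ^ 19 * l ^ 21"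
    using basin_approx[OF x, of "r ^ 19 * l ^ 21"] l r_bounds by (auto simp: y)
  obtain n where n: "N0 + N + 19 \<le> n" "ell ((G ^^ n) y) < 2"
    using neg by (metis le_add1 le_trans not_le trans_le_add1)
  define w where "w = (G ^^ (n - 19)) y"
  have Gw: "(G ^^ i) w = (G ^^ (n - 19 + i)) y" for i by (simp add: w_def funpow_add'[symmetric] add.commute)
  have "N \<le> \<tau> (n - 19) y" using \<tau>_ge[of "n - 19" y] n by simp
  then obtain m where m: "m \<ge> 1" "\<bar>w - (g ^^ m) 0\<bar> < r ^ 19 * l ^ 21"
    using N unfolding w_def Gn_eq by blast
  show False
  proof (rule no_return_to_1[of w "(g ^^ m) 0"])
    show "0 < w" "w \<le> 1" using pos Gn_range[OF y01] by (auto simp: w_def)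
    show "0 < (G ^^ i) w" for i unfolding Gw by (rule pos)
    show "1 \<le> ell ((G ^^ i) w)" for i unfolding Gw by (rule ge1) (use n in simp)
    have "ell ((G ^^ n) y) = 1" using n ge1[of n] by simp
    then show "ell ((G ^^ 19) w) = 1" unfolding Gw using n by simp
    show "climbing ((g ^^ m) 0)" by (rule climbing_critical_orbit[OF m(1)])
    show "\<bar>(g ^^ m) 0 - w\<bar> < r ^ 19 * l ^ 21" using m(2) by (simp add: abs_minus_commute)
  qed
qed

lemma basin_dim_le:
  assumes half: "l \<le> 1/2"
  shows "hausdorff_dim (Bas l) \<le> ereal (t2 l)"
proof (rule hausdorff_dim_le)
  fix \<sigma> assume \<sigma>: "t2 l < \<sigma>"
  have \<sigma>0: "0 < \<sigma>" using \<sigma> r_powr_t2 by simp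
  define E where "E j = {y. 0 < y \<and> y \<le> 1 \<and> ell y = j \<and> (\<forall>n. 0 < (G ^^ n) y \<and> 2 \<le> ell ((G ^^ n) y))}" for j
  have El: "y \<in> {0..l ^ j}" if "y \<in> E j" for y j
    using ell_bounds(2)[of y] that by (auto simp: E_def)
  have bd: "bounded (E j)" for j by (rule bounded_subset[of "{0..1}"]) (auto simp: E_def)
  have diam: "diameter (E j) \<le> l ^ j" for j
  proof (rule diameter_le)
    show "E j \<noteq> {} \<or> 0 \<le> l ^ j" using l by simp
    fix x y assume "x \<in> E j" "y \<in> E j"
    then show "norm (x - y) \<le> l ^ j" using El[of x j] El[of y j] by auto
  qed
  have l2: "l powr t2 l \<le> 1/2"
    by (rule powr_t2_le_half) (use half l in \<open>auto simp: r_def \<mu>_def power2_eq_square\<close>)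
  \<comment> \<open>Letters below 2 do not occur in E, so r is the only contraction. Letters are
    unbounded, however, and diameters have to be compared with weights: l^(j t2) \<le> 2^-j by
    \<open>l2\<close>.\<close>
  have "hausdorff_null \<sigma> (\<Union>j. E j)"
  proof (rule hausdorff_null_recursive_cover[where t = "t2 l" and C = 1 and m = "\<lambda>j. j - 1" and \<rho> = "\<lambda>j. r"
        and \<theta> = r and \<gamma> = "\<lambda>j u. l ^ j - r * u"])
    fix j
    show "E j \<subseteq> (\<lambda>u. l ^ j - r * u) ` ({0} \<union> (\<Union>k\<in>{j - 1..}. E k))"
    proof
      fix y assume y: "y \<in> E j"
      then have y': "0 < y" "y \<le> 1" "ell y = j" and al: "\<And>n. 0 < (G ^^ n) y \<and> 2 \<le> ell ((G ^^ n) y)"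
        by (auto simp: E_def)
      have "0 < (G ^^ n) (G y) \<and> 2 \<le> ell ((G ^^ n) (G y))" for n
        using al[of "Suc n"] by (simp add: funpow_swap1)
      moreover from this[of 0] have "0 < G y" by simp
      ultimately have "G y \<in> E (ell (G y))" using G_range[OF y'(1,2)] by (simp add: E_def)
      moreover have "j - 1 \<le> ell (G y)"
        using ell_G[OF y'(1,2) \<open>0 < G y\<close>] y' by (auto simp: lowest_def split: if_splits)
      ultimately have "G y \<in> {0} \<union> (\<Union>k\<in>{j - 1..}. E k)" by blast
      moreover have "\<rho> j = r" "j \<noteq> 0" using al[of 0] y' by (auto simp: \<rho>_def)
      then have "y = l ^ j - r * G y" using G_eq[OF y'(1,2)] y'(3) r_bounds by simp
      ultimately show "y \<in> (\<lambda>u. l ^ j - r * u) ` ({0} \<union> (\<Union>k\<in>{j - 1..}. E k))" by blast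
    qed
    show "\<bar>(l ^ j - r * u) - (l ^ j - r * v)\<bar> \<le> r * \<bar>u - v\<bar>" for u v
    proof -
      have "l ^ j - r * u - (l ^ j - r * v) = r * (v - u)" by (simp add: algebra_simps)
      then show ?thesis using r_bounds by (simp add: abs_mult abs_minus_commute)
    qed
    show "r powr t2 l * (2 * (1/2) ^ (j - 1)) \<le> (1/2) ^ j" by (cases j) (auto simp: r_powr_t2)
    show "diameter (E j) \<le> 1" using diam[of j] lpow_bounds(2)[of j] by simp
    have "diameter (E j) powr t2 l \<le> (l ^ j) powr t2 l"
      using diam diameter_ge_0[OF bd] r_powr_t2 by (intro powr_mono2) auto
    also have "\<dots> = (l powr t2 l) ^ j" using l by (simp add: powr_power_swap)
    also have "\<dots> \<le> (1/2) ^ j" using l2 by (intro power_mono) auto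
    finally show "diameter (E j) powr t2 l \<le> 1 * (1/2) ^ j" by simp
  qed (use \<sigma> r_powr_t2 r_bounds \<mu>_bounds bd in auto)
  then have N: "hausdorff_null \<sigma> ((\<Union>j. E j) \<union> ({0} \<union> {1}))" (is "hausdorff_null \<sigma> ?N")
    using \<sigma>0 by (intro hausdorff_null_Un hausdorff_null_singleton)
  \<comment> \<open>Either the induced orbit hits 0, or all letters are 0, or some letter is at
    least 1; then all later ones are, and eventually they are at least 2. The union over n undoes
    the initial part of the orbit.\<close>
  have "Bas l \<subseteq> (\<Union>n. {x. \<bar>2 * x - 1\<bar> \<in> {y \<in> {0..1}. (g ^^ n) y \<in> ?N}})"
  proof
    fix x assume x: "x \<in> Bas l"
    define y where "y = \<bar>2 * x - 1\<bar>"
    have y01: "y \<in> {0..1}" using x by (auto simp: Bas_def y_def abs_if)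
    have "\<exists>n. (g ^^ n) y \<in> ?N"
    proof (cases "\<exists>n. (G ^^ n) y = 0")
      case True
      then show ?thesis unfolding Gn_eq by auto
    next
      case False
      then have pos: "0 < (G ^^ n) y" for n using Gn_range[OF y01, of n] by (auto simp: le_less)
      show ?thesis
      proof (cases "\<forall>n. ell ((G ^^ n) y) = 0")
        case True
        \<comment> \<open>With letters 0 only, the distance to 1 is multiplied by 1/\<mu> each time,
          which forces y = 1.\<close>
        have eq: "1 - y = \<mu> ^ n * (1 - (G ^^ n) y)" for n
        proof (induction n)
          case (Suc n)
          have "(G ^^ Suc n) y = ((G ^^ n) y - l) / \<mu>"
            using G_eq[of "(G ^^ n) y"] pos[of n] Gn_range[OF y01, of n] True by simp
          then have "\<mu> * (G ^^ Suc n) y = (G ^^ n) y - l" using \<mu>_bounds by simp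
          then have "\<mu> * (1 - (G ^^ Suc n) y) = 1 - (G ^^ n) y" using l_\<mu> by (simp add: right_diff_distrib)
          then show ?case using Suc by (simp add: mult_ac)
        qed simp
        have le: "1 - y \<le> \<mu> ^ n" for n
        proof -
          have "\<mu> ^ n * (1 - (G ^^ n) y) \<le> \<mu> ^ n * 1" using \<mu>_bounds pos[of n] by (intro mult_left_mono) auto
          then show ?thesis using eq[of n] by simp
        qed
        have "(\<lambda>n. \<mu> ^ n) \<longlonglongrightarrow> 0" using \<mu>_bounds by (intro LIMSEQ_realpow_zero) auto
        then have "1 - y \<le> 0" by (rule LIMSEQ_le_const) (use le in blast)
        then have "(g ^^ 0) y = 1" using y01 by simp
        then show ?thesis by blast
      next
        case False
        then obtain N0 where N0: "1 \<le> ell ((G ^^ N0) y)" by (metis One_nat_def Suc_leI gr0I)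
        have ge1: "1 \<le> ell ((G ^^ n) y)" if "N0 \<le> n" for n
          using that
        proof (induction n rule: dec_induct)
          case (step n)
          have "lowest (ell ((G ^^ n) y)) \<le> ell ((G ^^ Suc n) y)"
            using ell_G[of "(G ^^ n) y"] pos[of n] pos[of "Suc n"] Gn_range[OF y01, of n] by simp
          then show ?case using step.IH by (auto simp: lowest_def)
        qed (rule N0)
        obtain N where N: "\<And>n. N \<le> n \<Longrightarrow> 2 \<le> ell ((G ^^ n) y)"
          using basin_letters[OF x y_def pos ge1] by blast
        have "(G ^^ n) ((G ^^ N) y) = (G ^^ (N + n)) y" for n by (simp add: funpow_add'[symmetric] add.commute)
        then have "(G ^^ N) y \<in> E (ell ((G ^^ N) y))" using pos N Gn_range[OF y01, of N] by (simp add: E_def)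
        then show ?thesis unfolding Gn_eq by blast
      qed
    qed
    then show "x \<in> (\<Union>n. {x. \<bar>2 * x - 1\<bar> \<in> {y \<in> {0..1}. (g ^^ n) y \<in> ?N}})"
      using y01 by (auto simp: y_def)
  qed
  moreover have "hausdorff_null \<sigma> (\<Union>n. {x. \<bar>2 * x - 1\<bar> \<in> {y \<in> {0..1}. (g ^^ n) y \<in> ?N}})"
    by (intro hausdorff_null_UN hausdorff_null_unfold hausdorff_null_gn_vimage N \<sigma>0)
  ultimately show "hausdorff_null \<sigma> (Bas l)" by (rule hausdorff_null_subset)
qed (use r_powr_t2 in simp)

section \<open>Lower bounds\<close>

text \<open>
  A word is a list of nonnegative steps: from letter \<open>j\<close> the step \<open>x\<close> leads to the
  letter \<open>lowest j + x\<close>, so that every list is an admissible itinerary from every letter \<open>a\<close>.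
\<close>

primrec end_letter :: "nat list \<Rightarrow> nat \<Rightarrow> nat" where
  "end_letter [] a = a"
| "end_letter (x # xs) a = end_letter xs (lowest a + x)"

text \<open>The inverse branch of the induced map along a word. The formula is that of the
  decreasing branches, so wherever it is related to g the starting letter is at least 1.\<close>

primrec branch :: "nat list \<Rightarrow> nat \<Rightarrow> real \<Rightarrow> real" where
  "branch [] a u = u"
| "branch (x # xs) a u = l ^ a - \<rho> a * branch xs (lowest a + x) u"

primrec ratio :: "nat list \<Rightarrow> nat \<Rightarrow> real" where
  "ratio [] a = 1"
| "ratio (x # xs) a = \<rho> a * ratio xs (lowest a + x)"

primrec time :: "nat list \<Rightarrow> nat \<Rightarrow> nat" where
  "time [] a = 0"
| "time (x # xs) a = time xs (lowest a + x) + T a"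

text \<open>Shrunken letter intervals that are mapped into each other by all branches with steps up to \<open>N\<close>.\<close>

definition right :: "nat \<Rightarrow> real" where "right N = 1 - r * l ^ Suc N"

definition left :: "nat \<Rightarrow> real" where "left N = 1 - \<mu> * right N"

definition J :: "nat \<Rightarrow> nat \<Rightarrow> real set" where "J N j = {l ^ j * left N..l ^ j * right N}"

lemma right_bounds: "0 < right N" "right N < 1"
proof -
  have "r * l ^ Suc N \<le> r * 1" by (rule mult_left_mono) (use lpow_bounds(2)[of "Suc N"] r_bounds in linarith)+
  also have "\<dots> < 1" using r_bounds \<mu>_bounds by simp
  finally show "0 < right N" unfolding right_def by linarith
  show "right N < 1" using r_bounds l by (simp add: right_def)
qed

lemma left_bounds: "l < left N" "left N \<le> right N"
proof -
  have "\<mu> * right N < \<mu> * 1" using right_bounds \<mu>_bounds by (intro mult_strict_left_mono) auto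
  then show "l < left N" using l_\<mu> by (simp add: left_def)
  have "r * l ^ Suc N \<le> r * l" using lpow_mono[of 1 "Suc N"] r_bounds by (intro mult_left_mono) auto
  then have 1: "1 - \<mu> * l ^ 2 \<le> right N" by (simp add: right_def r_def power2_eq_square mult_ac)
  have "0 \<le> (1 - l) ^ 2" by simp
  then have "l * (1 + \<mu>) \<le> 1" by (simp add: \<mu>_def power2_eq_square algebra_simps)
  then have "l * (l * (1 + \<mu>)) \<le> l * 1" using l by (intro mult_left_mono) auto
  also have "l * 1 \<le> 1" using l by simp
  finally have "l ^ 2 * (1 + \<mu>) \<le> 1" by (simp add: power2_eq_square mult.assoc)
  then have "\<mu> * (l ^ 2 * (1 + \<mu>)) \<le> \<mu> * 1" using \<mu>_bounds by (intro mult_left_mono) auto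
  then have "1 \<le> (1 - \<mu> * l ^ 2) * (1 + \<mu>)" by (simp add: algebra_simps)
  also have "\<dots> \<le> right N * (1 + \<mu>)" using 1 \<mu>_bounds by (intro mult_right_mono) auto
  finally show "left N \<le> right N" by (simp add: left_def algebra_simps)
qed

lemma J_nonempty: "J N j \<noteq> {}" using left_bounds(2)[of N] l by (simp add: J_def)

lemma J_bounds: assumes "u \<in> J N j" shows "l ^ Suc j < u" "u < l ^ j" "0 < u" "u \<le> 1"
proof -
  have "l ^ j * l < l ^ j * left N" "l ^ j * right N < l ^ j * 1"
    using left_bounds(1)[of N] right_bounds(2)[of N] l by (auto intro!: mult_strict_left_mono)
  then show 1: "l ^ Suc j < u" "u < l ^ j" using assms by (auto simp: J_def mult_ac)
  show "0 < u" using 1(1) lpow_bounds(1)[of "Suc j"] by linarith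
  show "u \<le> 1" using 1(2) lpow_bounds(2)[of j] by linarith
qed

lemma ell_J: "u \<in> J N j \<Longrightarrow> ell u = j" by (rule ell_eqI) (use J_bounds in \<open>auto simp: less_imp_le\<close>)

lemma J_scale: "u \<in> J N j \<Longrightarrow> l ^ c * u \<in> J N (j + c)"
  using l by (simp add: J_def power_add mult_ac)

text \<open>In the relative position c = u / l^(lowest a + x) the branch is c -> 1 - \<mu> * l^x *
  c. Here l^x * c is at most \<open>right N\<close>, which gives the left end, and at least l^(N+2),
  which gives the right end since \<mu> * l^(N+2) = r * l^(N+1).\<close>

lemma branch_step:
  assumes "1 \<le> a" "x \<le> N" "u \<in> J N (lowest a + x)"
  shows "l ^ a - \<rho> a * u \<in> J N a"
proof -
  define c where "c = u / l ^ (lowest a + x)"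
  have c: "left N \<le> c" "c \<le> right N" "u = l ^ (lowest a + x) * c"
    using assms(3) l by (auto simp: c_def J_def field_simps)
  have "\<rho> a * u = l ^ a * \<mu> * (l ^ x * c)"
    unfolding c(3) image_length[OF assms(1)] by (simp add: power_add mult_ac)
  then have eq: "l ^ a - \<rho> a * u = l ^ a * (1 - \<mu> * (l ^ x * c))" by (simp add: algebra_simps)
  have c0: "l \<le> c" "0 < c" using c(1) left_bounds(1)[of N] l by linarith+
  have "l ^ x * c \<le> 1 * right N" using c c0 lpow_bounds[of x] by (intro mult_mono) auto
  then have 1: "left N \<le> 1 - \<mu> * (l ^ x * c)" using \<mu>_bounds by (simp add: left_def)
  have "l ^ N * (l * l) \<le> l ^ x * c"
    using lpow_mono[OF assms(2)] c0 l lpow_bounds(1)[of x] by (intro mult_mono) (auto intro: order_trans[of _ l])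
  then have "\<mu> * (l ^ N * (l * l)) \<le> \<mu> * (l ^ x * c)" using \<mu>_bounds by (intro mult_left_mono) auto
  then have 2: "1 - \<mu> * (l ^ x * c) \<le> right N" by (simp add: right_def r_def mult_ac)
  show ?thesis unfolding eq J_def using 1 2 l by simp
qed

lemma lowest_ge_1: "1 \<le> a \<Longrightarrow> 1 \<le> lowest a + x" by (simp add: lowest_def)

lemma branch_in_J:
  assumes "1 \<le> a" "set xs \<subseteq> {..N}" "u \<in> J N (end_letter xs a)"
  shows "branch xs a u \<in> J N a"
  using assms
proof (induction xs arbitrary: a)
  case (Cons x xs)
  then have "branch xs (lowest a + x) u \<in> J N (lowest a + x)" using lowest_ge_1 by (intro Cons.IH) auto
  then show ?case using branch_step[of a x N] Cons.prems by simp
qed simp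

lemma ratio_pos: "0 < ratio xs a"
  by (induction xs arbitrary: a) (use \<rho>_bounds(1) in auto)

lemma ratio_le: "ratio xs a \<le> \<mu> ^ length xs"
proof (induction xs arbitrary: a)
  case (Cons x xs)
  then show ?case using \<rho>_bounds(1,2)[of a] ratio_pos[of xs] \<mu>_bounds by (auto intro!: mult_mono simp: less_imp_le)
qed simp

lemma branch_similar: "\<bar>branch xs a u - branch xs a v\<bar> = ratio xs a * \<bar>u - v\<bar>"
proof (induction xs arbitrary: a)
  case (Cons x xs)
  have "branch (x # xs) a u - branch (x # xs) a v
      = \<rho> a * (branch xs (lowest a + x) v - branch xs (lowest a + x) u)" by (simp add: algebra_simps)
  then show ?case using Cons[of "lowest a + x"] \<rho>_bounds(1)[of a] by (simp add: abs_mult abs_minus_commute)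
qed simp

lemma branch_inject:
  assumes "1 \<le> a" "length xs = length ys" "set xs \<subseteq> {..N}" "set ys \<subseteq> {..N}"
    "u \<in> J N (end_letter xs a)" "v \<in> J N (end_letter ys a)" "branch xs a u = branch ys a v"
  shows "xs = ys"
  using assms
proof (induction xs arbitrary: ys a)
  case (Cons x xs)
  then obtain y ys' where ys: "ys = y # ys'" by (cases ys) auto
  have eq: "branch xs (lowest a + x) u = branch ys' (lowest a + y) v"
    using Cons.prems(7) \<rho>_bounds(1)[of a] by (simp add: ys)
  have "branch xs (lowest a + x) u \<in> J N (lowest a + x)" "branch ys' (lowest a + y) v \<in> J N (lowest a + y)"
    using Cons.prems lowest_ge_1 by (auto intro!: branch_in_J simp: ys)
  then have "lowest a + x = lowest a + y" using ell_J eq by metis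
  then have xy: "x = y" by simp
  have "xs = ys'"
    by (rule Cons.IH[of "lowest a + x"]) (use Cons.prems lowest_ge_1 eq xy in \<open>auto simp: ys\<close>)
  then show ?case using xy ys by simp
qed simp

lemma branch_return:
  assumes "1 \<le> a" "x \<le> N" "u \<in> J N (lowest a + x)"
  shows "(g ^^ T a) (l ^ a - \<rho> a * u) = u"
proof -
  have "l ^ a - \<rho> a * u \<in> J N a" by (rule branch_step[OF assms])
  then have "(g ^^ T a) (l ^ a - \<rho> a * u) = (l ^ a - (l ^ a - \<rho> a * u)) / \<rho> a"
    using J_bounds by (intro flight_return flight assms) (auto simp: less_imp_le)
  then show ?thesis using \<rho>_bounds(1)[of a] by simp
qed

lemma g_time_branch:
  assumes "1 \<le> a" "set xs \<subseteq> {..N}" "u \<in> J N (end_letter xs a)"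
  shows "(g ^^ time xs a) (branch xs a u) = u"
  using assms
proof (induction xs arbitrary: a)
  case (Cons x xs)
  have k: "1 \<le> lowest a + x" using Cons.prems lowest_ge_1 by simp
  have "branch xs (lowest a + x) u \<in> J N (lowest a + x)" using Cons.prems k by (intro branch_in_J) auto
  then show ?case using Cons.IH[OF k] Cons.prems branch_return[of a x N] by (simp add: funpow_add')
qed simp

lemma gn_branch_pos:
  assumes "1 \<le> a" "set xs \<subseteq> {..N}" "u \<in> J N (end_letter xs a)" "i \<le> time xs a"
  shows "0 < (g ^^ i) (branch xs a u)"
  using assms
proof (induction xs arbitrary: a i)
  case Nil
  then show ?case using J_bounds(3) by simp
next
  case (Cons x xs)
  have k: "1 \<le> lowest a + x" using Cons.prems lowest_ge_1 by simp
  let ?w = "branch xs (lowest a + x) u"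
  have w: "?w \<in> J N (lowest a + x)" using Cons.prems k by (intro branch_in_J) auto
  then have y: "branch (x # xs) a u \<in> J N a" using branch_step[of a x N ?w] Cons.prems by simp
  consider "i = 0" | "1 \<le> i" "i < T a" | i' where "i = i' + T a" by (metis le_add_diff_inverse2 not_less less_one)
  then show ?case
  proof cases
    case 1
    then show ?thesis using J_bounds(3)[OF y] by simp
  next
    case 2
    then show ?thesis using flightD(2)[OF flight[OF Cons.prems(1)]] J_bounds[OF y] by simp
  next
    case 3
    have "0 < (g ^^ i') ?w" by (rule Cons.IH[OF k]) (use Cons.prems 3 in auto)
    then show ?thesis using branch_return[OF Cons.prems(1) _ w] Cons.prems 3 by (simp add: funpow_add')
  qed
qed

text \<open>At return times the point itself is within l^K of 0, the start of the critical orbit. In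
  between it is compared with the same iterate of 0: by \<open>flight\<close> the distance is at
  most that at the return, where both points are small. A word lowers the letter by at most its
  length, whence the premise on a.\<close>

lemma gn_branch_shadow:
  assumes "length xs + K + 3 \<le> a" "set xs \<subseteq> {..N}" "u \<in> J N (end_letter xs a)" "i \<le> time xs a"
  shows "\<exists>m. \<bar>(g ^^ i) (branch xs a u) - (g ^^ m) 0\<bar> \<le> l ^ K"
  using assms
proof (induction xs arbitrary: a i)
  case Nil
  have "u \<le> l ^ K" using J_bounds(2)[of u N a] lpow_mono[of K a] Nil by simp
  then show ?case using J_bounds(3)[of u N a] Nil by (intro exI[of _ 0]) auto
next
  case (Cons x xs)
  have a: "3 \<le> a" "1 \<le> a" "length xs + K + 3 \<le> lowest a + x" "1 \<le> lowest a + x"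
    using Cons.prems(1) by (auto simp: lowest_def)
  let ?w = "branch xs (lowest a + x) u" and ?y = "branch (x # xs) a u"
  have w: "?w \<in> J N (lowest a + x)" using Cons.prems a by (intro branch_in_J) auto
  then have y: "?y \<in> J N a" using branch_step[of a x N ?w] Cons.prems a by simp
  have ret: "(g ^^ T a) ?y = ?w" using branch_return[OF a(2) _ w] Cons.prems by simp
  consider "i = 0" | "1 \<le> i" "i < T a" | i' where "i = i' + T a" by (metis le_add_diff_inverse2 not_less less_one)
  then show ?case
  proof cases
    case 1
    have "?y \<le> l ^ K" using J_bounds(2)[OF y] lpow_mono[of K a] Cons.prems by simp
    then show ?thesis using J_bounds(3)[OF y] 1 by (intro exI[of _ 0]) auto
  next
    case 2
    have "\<bar>(g ^^ i) ?y - (g ^^ i) 0\<bar> \<le> \<bar>(g ^^ T a) ?y - (g ^^ T a) 0\<bar>"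
      by (rule flightD(3)[OF flight]) (use a 2 J_bounds[OF y] l in auto)
    also have "\<dots> \<le> l ^ K"
    proof -
      have "(g ^^ T a) 0 \<le> l ^ (a - 2)" by (rule gT_le) (use a l in auto)
      also have "\<dots> \<le> l ^ K" by (rule lpow_mono) (use Cons.prems in simp)
      finally have "(g ^^ T a) 0 \<le> l ^ K" .
      moreover have "0 \<le> (g ^^ T a) 0" using gn_range[of 0 "T a"] by simp
      moreover have "?w \<le> l ^ K" using J_bounds(2)[OF w] lpow_mono[of K "lowest a + x"] a by simp
      moreover have "0 < ?w" by (rule J_bounds(3)[OF w])
      ultimately show ?thesis unfolding ret by linarith
    qed
    finally show ?thesis by blast
  next
    case 3
    have "\<exists>m. \<bar>(g ^^ i') ?w - (g ^^ m) 0\<bar> \<le> l ^ K" by (rule Cons.IH[OF a(3)]) (use Cons.prems 3 in auto)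
    then show ?thesis unfolding 3 funpow_add' ret .
  qed
qed

text \<open>While letters stay at least 2, the induced dynamics commutes with scaling by l: raising
  all letters by c multiplies all points by l^c. So one word serves at all heights.\<close>

lemma high_word:
  assumes "length xs + 2 \<le> a"
  shows "end_letter xs a + length xs = a + sum_list xs" "ratio xs a = r ^ length xs"
    "branch xs (a + c) (l ^ c * u) = l ^ c * branch xs a u"
proof -
  have "end_letter xs a + length xs = a + sum_list xs \<and> ratio xs a = r ^ length xs \<and>
    branch xs (a + c) (l ^ c * u) = l ^ c * branch xs a u"
    using assms
  proof (induction xs arbitrary: a)
    case (Cons x xs)
    have t: "lowest a = a - 1" "\<rho> a = r" "\<rho> (a + c) = r" "lowest (a + c) + x = lowest a + x + c"
      using Cons.prems by (auto simp: lowest_def \<rho>_def)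
    have k: "length xs + 2 \<le> lowest a + x" using Cons.prems t by simp
    have "end_letter (x # xs) a + length (x # xs) = a + sum_list (x # xs)"
      using Cons.IH[OF k] Cons.prems t(1) by simp
    moreover have "ratio (x # xs) a = r ^ length (x # xs)" using Cons.IH[OF k] t by simp
    moreover have "branch (x # xs) (a + c) (l ^ c * u) = l ^ c * branch (x # xs) a u"
      using Cons.IH[OF k] unfolding branch.simps t(2-4) by (simp add: power_add right_diff_distrib)
    ultimately show ?case by blast
  qed auto
  then show "end_letter xs a + length xs = a + sum_list xs" "ratio xs a = r ^ length xs"
    "branch xs (a + c) (l ^ c * u) = l ^ c * branch xs a u" by auto
qed

section \<open>Self-similar subsets of hyperbolic sets and of the basin\<close>

text \<open>A block from letter a to a + c ends in \<open>J N (a + c)\<close>, which the factor l^c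
  identifies with \<open>J N a\<close>. So rising words too form an iterated function system on one
  interval, of ratio R * l^c. Hyperbolic sets use c = 0, the basin c \<ge> 1.\<close>

lemma block_ifs:
  assumes fin: "finite X" and a: "1 \<le> a" and n: "1 \<le> n"
    and X: "\<And>xs. xs \<in> X \<Longrightarrow> length xs = n \<and> set xs \<subseteq> {..N} \<and> end_letter xs a = a + c \<and> ratio xs a = R"
    and t: "0 < t" and card: "1 \<le> real (card X) * (R * l ^ c) powr t"
  obtains E where "E \<subseteq> J N a" "\<And>y. y \<in> E \<Longrightarrow> \<exists>xs\<in>X. \<exists>y'\<in>E. y = branch xs a (l ^ c * y')"
    "ereal t \<le> hausdorff_dim E"
proof -
  have "X \<noteq> {}" using card by auto
  then obtain zs where zs: "zs \<in> X" by blast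
  have R0: "0 < R" using X[OF zs] ratio_pos[of zs a] by simp
  have "R \<le> \<mu> ^ n" using X[OF zs] ratio_le[of zs a] by simp
  also have "\<dots> < 1" using \<mu>_bounds n by (simp add: power_less_one_iff)
  finally have "R * l ^ c < 1 * 1" using R0 lpow_bounds[of c] by (intro mult_less_le_imp_less) auto
  then have R1: "R * l ^ c < 1" by simp
  have Je: "l ^ c * u \<in> J N (end_letter xs a)" if "xs \<in> X" "u \<in> J N a" for xs u
    using X[OF that(1)] J_scale[OF that(2)] by simp
  show ?thesis
  proof (rule similar_ifs_dimension[of X "J N a" "\<lambda>xs u. branch xs a (l ^ c * u)" "R * l ^ c" t])
    show "branch xs a (l ^ c * u) \<in> J N a" if "xs \<in> X" "u \<in> J N a" for xs u
      using branch_in_J[OF a] X[OF that(1)] Je[OF that] by simp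
    show "\<bar>branch xs a (l ^ c * u) - branch xs a (l ^ c * v)\<bar> = R * l ^ c * \<bar>u - v\<bar>" if "xs \<in> X" for xs u v
    proof -
      have "\<bar>l ^ c * u - l ^ c * v\<bar> = l ^ c * \<bar>u - v\<bar>"
        using l by (simp add: right_diff_distrib[symmetric] abs_mult)
      then show ?thesis using branch_similar[of xs a] X[OF that] by simp
    qed
    show "(\<lambda>u. branch xs a (l ^ c * u)) ` J N a \<inter> (\<lambda>u. branch ys a (l ^ c * u)) ` J N a = {}"
      if "xs \<in> X" "ys \<in> X" "xs \<noteq> ys" for xs ys
    proof -
      have "branch xs a (l ^ c * u) \<noteq> branch ys a (l ^ c * v)" if "u \<in> J N a" "v \<in> J N a" for u v
        using branch_inject[OF a, of xs ys N "l ^ c * u" "l ^ c * v"] X[OF \<open>xs \<in> X\<close>] X[OF \<open>ys \<in> X\<close>]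
          Je[OF \<open>xs \<in> X\<close> that(1)] Je[OF \<open>ys \<in> X\<close> that(2)] \<open>xs \<noteq> ys\<close> by auto
      then show ?thesis by blast
    qed
    show "compact (J N a)" by (simp add: J_def)
  qed (use fin t card J_nonempty R0 R1 l that in auto)
qed

lemma gn_continuous: "continuous_on {0..1} (g ^^ n)"
proof (induction n)
  case (Suc n)
  have "continuous_on {0..1} (\<lambda>y. g ((g ^^ n) y))"
    by (rule continuous_on_compose2[OF g_continuous Suc]) (use gn_range in blast)
  then show ?case by (simp add: o_def)
qed (simp add: id_def continuous_on_id)

lemma fn_continuous: "continuous_on {0..1} (f ^^ n)"
proof (induction n)
  case (Suc n)
  have "continuous_on {0..1} (\<lambda>y. f ((f ^^ n) y))"
    by (rule continuous_on_compose2[OF f_facts(2) Suc]) (use fn_range in blast)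
  then show ?case by (simp add: o_def)
qed (simp add: id_def continuous_on_id)

lemma gn_branch_bounded_below:
  assumes "1 \<le> a" "set xs \<subseteq> {..N}"
  shows "\<exists>\<epsilon>>0. \<forall>i\<le>time xs a. \<forall>u\<in>J N (end_letter xs a). \<epsilon> \<le> (g ^^ i) (branch xs a u)"
proof -
  let ?J = "J N (end_letter xs a)"
  have b01: "branch xs a u \<in> {0..1}" if "u \<in> ?J" for u
    using J_bounds[OF branch_in_J[OF assms that]] by simp
  have cb: "continuous_on ?J (branch xs a)"
    by (rule lipschitz_on_continuous_on[OF lipschitz_onI[where L = "ratio xs a"]])
       (use branch_similar ratio_pos[of xs a] in \<open>auto simp: dist_real_def\<close>)
  have "\<exists>\<epsilon>>0. \<forall>u\<in>?J. \<epsilon> \<le> (g ^^ i) (branch xs a u)" if "i \<le> time xs a" for i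
  proof -
    have "continuous_on ?J (\<lambda>u. (g ^^ i) (branch xs a u))"
      by (rule continuous_on_compose2[OF gn_continuous cb]) (use b01 in blast)
    moreover have "compact ?J" by (simp add: J_def)
    ultimately obtain u0 where "u0 \<in> ?J" "\<forall>u\<in>?J. (g ^^ i) (branch xs a u0) \<le> (g ^^ i) (branch xs a u)"
      using continuous_attains_inf[of ?J] J_nonempty by blast
    then show ?thesis using gn_branch_pos[OF assms] that by blast
  qed
  then have "\<forall>i\<in>{..time xs a}. \<exists>\<epsilon>>0. \<forall>u\<in>?J. \<epsilon> \<le> (g ^^ i) (branch xs a u)" by blast
  from bchoice[OF this] obtain e where e: "\<forall>i\<in>{..time xs a}. 0 < e i \<and> (\<forall>u\<in>?J. e i \<le> (g ^^ i) (branch xs a u))"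
    by (rule exE)
  let ?m = "Min (e ` {..time xs a})"
  have "0 < ?m" using e by (subst Min_gr_iff) auto
  moreover have "?m \<le> (g ^^ i) (branch xs a u)" if "i \<le> time xs a" "u \<in> ?J" for i u
  proof -
    have "?m \<le> e i" using that by (intro Min_le) auto
    moreover have "e i \<le> (g ^^ i) (branch xs a u)" using bspec[OF e, of i] that by auto
    ultimately show ?thesis by simp
  qed
  ultimately show ?thesis by blast
qed

lemma time_pos: "1 \<le> length xs \<Longrightarrow> 1 \<le> time xs a"
  using T_pos[of a] by (cases xs) auto

lemma dim_hyp_ge_block:
  assumes fin: "finite X" and a: "1 \<le> a" and n: "1 \<le> n"
    and X: "\<And>xs. xs \<in> X \<Longrightarrow> length xs = n \<and> set xs \<subseteq> {..N} \<and> end_letter xs a = a \<and> ratio xs a = R"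
    and t: "0 < t" and card: "1 \<le> real (card X) * R powr t"
  shows "ereal t \<le> dim_hyp f"
proof -
  obtain E where E: "E \<subseteq> J N a" "\<And>y. y \<in> E \<Longrightarrow> \<exists>xs\<in>X. \<exists>y'\<in>E. y = branch xs a y'" "ereal t \<le> hausdorff_dim E"
    using block_ifs[OF fin a n, of N 0 R t] X t card by auto
  have "\<forall>xs\<in>X. \<exists>\<epsilon>>0. \<forall>i\<le>time xs a. \<forall>u\<in>J N a. \<epsilon> \<le> (g ^^ i) (branch xs a u)"
    using gn_branch_bounded_below[OF a] X by metis
  from bchoice[OF this] obtain e where
    e: "\<forall>xs\<in>X. 0 < e xs \<and> (\<forall>i\<le>time xs a. \<forall>u\<in>J N a. e xs \<le> (g ^^ i) (branch xs a u))" by (rule exE)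
  define \<epsilon> where "\<epsilon> = Min (insert 1 (e ` X))"
  have \<epsilon>0: "0 < \<epsilon>" unfolding \<epsilon>_def using e fin by (subst Min_gr_iff) auto
  have \<epsilon>e: "\<epsilon> \<le> e xs" if "xs \<in> X" for xs unfolding \<epsilon>_def using that fin by (intro Min_le) auto
  have gm: "\<epsilon> \<le> (g ^^ m) y" if "y \<in> E" for m y
    using that
  proof (induction m arbitrary: y rule: less_induct)
    case (less m)
    then obtain xs y' where xs: "xs \<in> X" "y' \<in> E" "y = branch xs a y'" using E(2) by blast
    show ?case
    proof (cases "m \<le> time xs a")
      case True
      then show ?thesis using bspec[OF e xs(1)] \<epsilon>e[OF xs(1)] E(1) xs(2,3) by fastforce
    next
      case False
      then obtain i where i: "m = i + time xs a" by (metis le_add_diff_inverse2 nat_le_linear)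
      have "i < m" using i time_pos[of xs a] X[OF xs(1)] n by simp
      moreover have "(g ^^ m) y = (g ^^ i) y'"
        using g_time_branch[OF a, of xs N y'] X[OF xs(1)] E(1) xs i by (auto simp: funpow_add')
      ultimately show ?thesis using less.IH[of i y'] xs by simp
    qed
  qed
  \<comment> \<open>The set of all points whose orbit keeps its distance from the critical point:
    invariant by definition, closed by continuity, and containing (1 - y) / 2 for y in E.\<close>
  define \<Lambda> where "\<Lambda> = {x \<in> {0..1}. \<forall>n. \<epsilon> \<le> \<bar>2 * (f ^^ n) x - 1\<bar>}"
  have "hyperbolic_set f \<Lambda>"
    unfolding hyperbolic_set_def
  proof (intro conjI)
    show "\<Lambda> \<subseteq> {0..1}" by (auto simp: \<Lambda>_def)
    show "f ` \<Lambda> \<subseteq> \<Lambda>"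
    proof
      fix z assume "z \<in> f ` \<Lambda>"
      then obtain x where x: "x \<in> \<Lambda>" "z = f x" by blast
      then have "\<epsilon> \<le> \<bar>2 * (f ^^ n) z - 1\<bar>" for n
        using \<Lambda>_def funpow_swap1[of f n x] by (auto dest: spec[of _ "Suc n"])
      then show "z \<in> \<Lambda>" using x f_range by (auto simp: \<Lambda>_def)
    qed
    have "closed (\<Inter>n. {x \<in> {0..1}. \<bar>2 * (f ^^ n) x - 1\<bar> \<in> {\<epsilon>..}})"
      by (intro closed_INT ballI continuous_closed_preimage[unfolded Int_def vimage_def mem_Collect_eq])
         (auto intro!: continuous_intros fn_continuous continuous_closed_preimage simp: Collect_conj_eq vimage_def Int_def)
    moreover have "(\<Inter>n. {x \<in> {0..1}. \<bar>2 * (f ^^ n) x - 1\<bar> \<in> {\<epsilon>..}}) = \<Lambda>" by (auto simp: \<Lambda>_def)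
    moreover have "bounded \<Lambda>" by (rule bounded_subset[of "{0..1}"]) (auto simp: \<Lambda>_def)
    ultimately show "compact \<Lambda>" by (simp add: compact_eq_bounded_closed)
    show "\<exists>\<epsilon>>0. \<forall>x\<in>\<Lambda>. \<epsilon> \<le> \<bar>x - 1 / 2\<bar>"
    proof (intro exI[of _ "\<epsilon> / 2"] conjI ballI)
      fix x assume "x \<in> \<Lambda>"
      then have "\<epsilon> \<le> \<bar>2 * (f ^^ 0) x - 1\<bar>" unfolding \<Lambda>_def by blast
      then show "\<epsilon> / 2 \<le> \<bar>x - 1 / 2\<bar>" by (simp add: abs_if split: if_splits)
    qed (use \<epsilon>0 in simp)
  qed
  then have "hausdorff_dim \<Lambda> \<le> dim_hyp f" unfolding dim_hyp_def by (intro SUP_upper) simp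
  moreover have "hausdorff_dim E \<le> hausdorff_dim \<Lambda>"
  proof -
    have "E \<subseteq> (\<lambda>x. 1 - 2 * x) ` \<Lambda>"
    proof
      fix y assume y: "y \<in> E"
      then have y01: "0 < y" "y \<le> 1" using E(1) J_bounds by auto
      have "2 * ((1 - y) / 2) - 1 = - y" by (simp add: field_simps)
      then have "\<bar>2 * ((1 - y) / 2) - 1\<bar> = y" using y01 by simp
      then have "(1 - y) / 2 \<in> \<Lambda>" using gm[OF y] abs_fn[of "(1 - y) / 2"] y01 by (simp add: \<Lambda>_def)
      moreover have "y = 1 - 2 * ((1 - y) / 2)" by (simp add: field_simps)
      ultimately show "y \<in> (\<lambda>x. 1 - 2 * x) ` \<Lambda>" by blast
    qed
    then have "hausdorff_dim E \<le> hausdorff_dim ((\<lambda>x. 1 - 2 * x) ` \<Lambda>)" by (rule hausdorff_dim_mono)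
    also have "\<dots> \<le> hausdorff_dim \<Lambda>" by (rule hausdorff_dim_lipschitz[where L = 2]) (auto simp: abs_if)
    finally show ?thesis .
  qed
  ultimately show ?thesis using E(3) by (meson order_trans)
qed

lemma critical_orbit_in_\<omega>: "(f ^^ m) (1/2) \<in> \<omega>"
  unfolding \<omega>_def omega_limit_def
proof (intro INT_I)
  fix N
  let ?S = "{(f ^^ n) (1/2) |n. N \<le> n}"
  have S: "?S \<subseteq> {0..1}" using fn_range[of "1/2"] by auto
  then have cS: "closure ?S \<subseteq> {0..1}" by (rule closure_minimal) simp
  have "(f ^^ m) ` closure ?S \<subseteq> closure ?S"
  proof (rule image_closure_subset)
    show "continuous_on (closure ?S) (f ^^ m)" by (rule continuous_on_subset[OF fn_continuous cS])
    have "(f ^^ m) ((f ^^ n) (1/2)) \<in> ?S" if "N \<le> n" for n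
      using that by (auto simp: funpow_add'[symmetric] intro: trans_le_add2)
    then have "(f ^^ m) ` ?S \<subseteq> ?S" by blast
    then show "(f ^^ m) ` ?S \<subseteq> closure ?S" using closure_subset by blast
  qed simp
  moreover have "1/2 \<in> closure ?S" using critical_in_\<omega> unfolding \<omega>_def omega_limit_def by blast
  ultimately show "(f ^^ m) (1/2) \<in> closure ?S" by blast
qed

text \<open>By \<open>high_word\<close> the system built at letter a also describes the copy of E
  scaled by l^(k c) at letter a + k c, and each block leads from level k to level k + 1. From level
  k on the orbit stays within l^(k c) of the critical orbit, an error that tends to 0.\<close>

lemma basin_dim_ge_block:
  assumes fin: "finite X" and n: "1 \<le> n" and c: "1 \<le> c" and a: "n + 3 \<le> a"
    and X: "\<And>xs. xs \<in> X \<Longrightarrow> length xs = n \<and> sum_list xs = n + c"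
    and t: "0 < t" and card: "1 \<le> real (card X) * (r ^ n * l ^ c) powr t"
  shows "ereal t \<le> hausdorff_dim (Bas l)"
proof -
  define N where "N = n + c"
  have Xs: "length xs = n" "set xs \<subseteq> {..N}" "end_letter xs a = a + c" "ratio xs a = r ^ n" if "xs \<in> X" for xs
  proof -
    show "length xs = n" using X[OF that] by simp
    show "set xs \<subseteq> {..N}" using X[OF that] member_le_sum_list[of _ xs] by (auto simp: N_def)
    show "end_letter xs a = a + c" "ratio xs a = r ^ n" using high_word(1,2)[of xs a] X[OF that] a by auto
  qed
  have a1: "1 \<le> a" using a by simp
  obtain E where E: "E \<subseteq> J N a" "\<And>y. y \<in> E \<Longrightarrow> \<exists>xs\<in>X. \<exists>y'\<in>E. y = branch xs a (l ^ c * y')"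
    "ereal t \<le> hausdorff_dim E"
    using block_ifs[OF fin a1 n, of N c "r ^ n" t] Xs t card by auto
  have step: "\<exists>xs\<in>X. \<exists>y'\<in>E. l ^ (k * c) * y = branch xs (a + k * c) (l ^ (Suc k * c) * y') \<and>
      l ^ (Suc k * c) * y' \<in> J N (end_letter xs (a + k * c))" if y: "y \<in> E" for y k
  proof -
    obtain xs y' where xs: "xs \<in> X" "y' \<in> E" "y = branch xs a (l ^ c * y')" using E(2)[OF y] by blast
    have "l ^ (k * c) * y = branch xs (a + k * c) (l ^ (k * c) * (l ^ c * y'))"
      unfolding xs(3) using high_word(3)[of xs a] Xs[OF xs(1)] a by simp
    moreover have "end_letter xs (a + k * c) = a + Suc k * c"
      using high_word(1)[of xs "a + k * c"] X[OF xs(1)] a by simp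
    ultimately show ?thesis using xs(1,2) J_scale[of y' N a "Suc k * c"] E(1)
      by (intro bexI[of _ xs] bexI[of _ y']) (auto simp: power_add mult_ac)
  qed
  have ak: "1 \<le> a + k * c" for k using a by simp
  have shadow: "\<exists>m. \<bar>(g ^^ i) (l ^ (k * c) * y) - (g ^^ m) 0\<bar> \<le> l ^ (k * c)" if "y \<in> E" for i k y
    using that
  proof (induction i arbitrary: k y rule: less_induct)
    case (less i)
    obtain xs y' where xs: "xs \<in> X" "y' \<in> E" "l ^ (k * c) * y = branch xs (a + k * c) (l ^ (Suc k * c) * y')"
      "l ^ (Suc k * c) * y' \<in> J N (end_letter xs (a + k * c))" using step[OF less.prems, of k] by blast
    show ?case
    proof (cases "i \<le> time xs (a + k * c)")
      case True
      show ?thesis unfolding xs(3)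
        by (rule gn_branch_shadow[OF _ _ xs(4) True]) (use Xs[OF xs(1)] a in auto)
    next
      case False
      then obtain j where j: "i = j + time xs (a + k * c)" by (metis le_add_diff_inverse2 nat_le_linear)
      have "j < i" using j time_pos[of xs "a + k * c"] X[OF xs(1)] n by simp
      moreover have "(g ^^ i) (l ^ (k * c) * y) = (g ^^ j) (l ^ (Suc k * c) * y')"
        unfolding xs(3) j funpow_add' using g_time_branch[OF ak _ xs(4)] Xs[OF xs(1)] by simp
      moreover have "l ^ (Suc k * c) \<le> l ^ (k * c)" by (rule lpow_mono) simp
      ultimately show ?thesis using less.IH[of j y' "Suc k"] xs(2) by (metis order_trans)
    qed
  qed
  have reach: "\<exists>m. \<exists>y'\<in>E. (g ^^ m) y = l ^ (k * c) * y'" if "y \<in> E" for y k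
  proof (induction k)
    case 0
    show ?case using that by (intro exI[of _ 0] bexI[of _ y]) auto
  next
    case (Suc k)
    then obtain m y' where m: "y' \<in> E" "(g ^^ m) y = l ^ (k * c) * y'" by blast
    obtain xs y'' where xs: "xs \<in> X" "y'' \<in> E" "l ^ (k * c) * y' = branch xs (a + k * c) (l ^ (Suc k * c) * y'')"
      "l ^ (Suc k * c) * y'' \<in> J N (end_letter xs (a + k * c))" using step[OF m(1), of k] by blast
    have "(g ^^ (time xs (a + k * c) + m)) y = l ^ (Suc k * c) * y''"
      unfolding funpow_add' m(2) xs(3) using g_time_branch[OF ak _ xs(4)] Xs[OF xs(1)] by simp
    then show ?case using xs(2) by blast
  qed
  have bas: "(1 - y) / 2 \<in> Bas l" if y: "y \<in> E" for y
  proof -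
    define x where "x = (1 - y) / 2"
    have y01: "0 < y" "y \<le> 1" using E(1) y J_bounds by auto
    have "2 * x - 1 = - y" by (simp add: x_def field_simps)
    then have x01: "x \<in> {0..1}" and xy: "\<bar>2 * x - 1\<bar> = y" using y01 by (auto simp: x_def)
    have "(\<lambda>n. infdist ((f ^^ n) x) \<omega>) \<longlonglongrightarrow> 0"
    proof (rule LIMSEQ_I)
      fix e :: real assume e: "0 < e"
      \<comment> \<open>Closeness in the coordinate |2x - 1| does not tell x from 1 - x. One more
        application of f resolves this, as f x = \<open>\<phi>\<close> |2x - 1| and
        \<open>\<phi>\<close> is uniformly continuous.\<close>
      have "uniformly_continuous_on {0..1} \<phi>"
        by (rule compact_uniformly_continuous[OF \<phi>_continuous]) simp
      then obtain \<delta> where \<delta>: "0 < \<delta>"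
        "\<And>u v. u \<in> {0..1} \<Longrightarrow> v \<in> {0..1} \<Longrightarrow> dist u v < \<delta> \<Longrightarrow> dist (\<phi> u) (\<phi> v) < e"
        using e unfolding uniformly_continuous_on_def by metis
      obtain k where k: "l ^ k < \<delta>" using real_arch_pow_inv[of \<delta> l] \<delta> l by blast
      have "l ^ (k * c) \<le> l ^ k" by (rule lpow_mono) (use c in simp)
      then have kc: "l ^ (k * c) < \<delta>" using k by simp
      obtain M y' where M: "y' \<in> E" "(g ^^ M) y = l ^ (k * c) * y'" using reach[OF y, of k] by blast
      have "norm (infdist ((f ^^ n) x) \<omega> - 0) < e" if n: "Suc M \<le> n" for n
      proof -
        obtain i where i: "n = Suc (i + M)" using n by (metis add.commute add_Suc_right le_Suc_ex add_Suc)
        obtain m where "\<bar>(g ^^ i) (l ^ (k * c) * y') - (g ^^ m) 0\<bar> \<le> l ^ (k * c)" using shadow[OF M(1)] by blast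
        then have "\<bar>(g ^^ (i + M)) y - (g ^^ m) 0\<bar> < \<delta>" using M(2) kc by (simp add: funpow_add')
        then have "dist (\<phi> ((g ^^ (i + M)) y)) (\<phi> ((g ^^ m) 0)) < e"
          using gn_range[of y "i + M"] gn_range[of 0 m] y01 by (intro \<delta>(2)) (auto simp: dist_real_def)
        moreover have "(f ^^ n) x = \<phi> ((g ^^ (i + M)) y)" unfolding i using fn_Suc[OF x01] xy by simp
        moreover have "(f ^^ Suc m) (1/2) = \<phi> ((g ^^ m) 0)" using fn_Suc[of "1/2" m] by simp
        ultimately have "dist ((f ^^ n) x) ((f ^^ Suc m) (1/2)) < e" by simp
        moreover have "infdist ((f ^^ n) x) \<omega> \<le> dist ((f ^^ n) x) ((f ^^ Suc m) (1/2))"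
          by (rule infdist_le[OF critical_orbit_in_\<omega>])
        ultimately show ?thesis using infdist_nonneg[of "(f ^^ n) x" \<omega>] by simp
      qed
      then show "\<exists>no. \<forall>n\<ge>no. norm (infdist ((f ^^ n) x) \<omega> - 0) < e" by blast
    qed
    then show ?thesis using x01 by (simp add: Bas_def \<omega>_def x_def)
  qed
  have "E \<subseteq> (\<lambda>x. 1 - 2 * x) ` Bas l"
  proof
    fix y assume "y \<in> E"
    moreover have "y = 1 - 2 * ((1 - y) / 2)" by (simp add: field_simps)
    ultimately show "y \<in> (\<lambda>x. 1 - 2 * x) ` Bas l" using bas by blast
  qed
  then have "hausdorff_dim E \<le> hausdorff_dim ((\<lambda>x. 1 - 2 * x) ` Bas l)" by (rule hausdorff_dim_mono)
  also have "\<dots> \<le> hausdorff_dim (Bas l)" by (rule hausdorff_dim_lipschitz[where L = 2]) (auto simp: abs_if)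
  finally show ?thesis using E(3) by (meson order_trans)
qed

section \<open>Lower bounds by t2\<close>

lemma four_r_powr: assumes "t < t2 l" shows "1 < 4 * r powr t"
proof -
  have "r powr t2 l < r powr t" using assms r_bounds \<mu>_bounds by (intro powr_less_mono') auto
  then show ?thesis by (simp add: r_powr_t2)
qed

lemma dim_hyp_ge_t2: assumes "0 < t" "t < t2 l" shows "ereal t \<le> dim_hyp f"
proof -
  obtain n where n: "1 \<le> n" "1 \<le> 1 * (4 * r powr t) ^ n / (4 * real n)"
    using exp_beats_linear[OF four_r_powr[OF assms(2)], of 1] by auto
  show ?thesis
  proof (rule dim_hyp_ge_block[of "step_lists n n" "n + 2" n n "r ^ n" t])
    fix xs assume "xs \<in> step_lists n n"
    then have xs: "length xs = n" "sum_list xs = n" by (auto simp: step_lists_def)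
    moreover have "set xs \<subseteq> {..n}" using member_le_sum_list[of _ xs] xs by auto
    ultimately show "length xs = n \<and> set xs \<subseteq> {..n} \<and> end_letter xs (n + 2) = n + 2 \<and> ratio xs (n + 2) = r ^ n"
      using high_word(1,2)[of xs "n + 2"] by simp
  next
    have "1 \<le> 4 ^ n / (4 * real n) * (r powr t) ^ n" using n(2) by (simp add: power_mult_distrib)
    also have "\<dots> \<le> real (card (step_lists n n)) * (r powr t) ^ n"
      using card_step_lists_central[OF n(1)] by (intro mult_right_mono) auto
    finally show "1 \<le> real (card (step_lists n n)) * (r ^ n) powr t" using r_bounds by (simp add: powr_power_swap)
  qed (use step_lists n assms in auto)
qed

lemma basin_dim_ge_t2: assumes "0 < t" "t < t2 l" shows "ereal t \<le> hausdorff_dim (Bas l)"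
proof -
  obtain n where n: "1 \<le> n" "1 \<le> l powr t * (4 * r powr t) ^ n / (4 * real n)"
    using exp_beats_linear[OF four_r_powr[OF assms(2)], of "l powr t"] l by auto
  show ?thesis
  proof (rule basin_dim_ge_block[of "step_lists n (n + 1)" n 1 "n + 3" t])
    have "1 \<le> 4 ^ n / (4 * real n) * ((r powr t) ^ n * l powr t)"
      using n(2) by (simp add: power_mult_distrib mult_ac)
    also have "\<dots> \<le> real (card (step_lists n n)) * ((r powr t) ^ n * l powr t)"
      using card_step_lists_central[OF n(1)] by (intro mult_right_mono) auto
    also have "\<dots> \<le> real (card (step_lists n (n + 1))) * ((r powr t) ^ n * l powr t)"
      using card_step_lists_Suc[OF n(1), of n] by (intro mult_right_mono) auto
    finally show "1 \<le> real (card (step_lists n (n + 1))) * (r ^ n * l ^ 1) powr t"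
      using r_bounds l by (simp add: powr_power_swap powr_mult)
  qed (use step_lists n assms in \<open>auto simp: step_lists_def\<close>)
qed

section \<open>Dimension 1 of the basin for l at least 1/2\<close>

text \<open>One of the 2h+2 terms of (l + \<mu>)^(2h+1) reaches the average. As l \<ge> \<mu>, it
  may be replaced by its mirror image with fewer factors \<mu>; the odd exponent leaves no middle
  term.\<close>

lemma large_binomial_term:
  assumes "1/2 \<le> l"
  obtains i where "i \<le> h" "1 / real (2 * h + 2) \<le> real ((2 * h + 1) choose i) * (l ^ (2 * h + 1 - i) * \<mu> ^ i)"
proof -
  define M where "M = 2 * h + 1"
  define a where "a k = real (M choose k) * l ^ k * \<mu> ^ (M - k)" for k
  have sum: "(\<Sum>k\<le>M. a k) = 1" using binomial_ring[of l \<mu> M] l_\<mu> by (simp add: a_def)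
  have "\<exists>k\<le>M. 1 / real (M + 1) \<le> a k"
  proof (rule ccontr)
    assume "\<not> ?thesis"
    then have "(\<Sum>k\<le>M. a k) < (\<Sum>k\<le>M. 1 / real (M + 1))" by (intro sum_strict_mono) auto
    then show False using sum by simp
  qed
  then obtain k where k: "k \<le> M" "1 / real (M + 1) \<le> a k" by blast
  show ?thesis
  proof (cases "M - k \<le> h")
    case True
    have "a k = real (M choose (M - k)) * (l ^ (M - (M - k)) * \<mu> ^ (M - k))"
      using binomial_symmetric[OF k(1)] k(1) by (simp add: a_def)
    then show ?thesis using that[OF True] k(2) by (simp add: M_def)
  next
    case False
    then have kh: "k \<le> h" by (simp add: M_def)
    have "l ^ k * \<mu> ^ (M - k) = l ^ k * \<mu> ^ k * \<mu> ^ (M - 2 * k)"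
      using kh by (simp add: M_def power_add[symmetric] mult.assoc)
    also have "\<dots> \<le> l ^ k * \<mu> ^ k * l ^ (M - 2 * k)"
      using assms \<mu>_bounds l by (intro mult_left_mono power_mono) (auto simp: \<mu>_def)
    also have "\<dots> = (l ^ k * l ^ (M - 2 * k)) * \<mu> ^ k" by (simp add: mult_ac)
    also have "l ^ k * l ^ (M - 2 * k) = l ^ (M - k)" using kh by (simp add: M_def power_add[symmetric])
    finally have "real (M choose k) * (l ^ k * \<mu> ^ (M - k)) \<le> real (M choose k) * (l ^ (M - k) * \<mu> ^ k)"
      by (intro mult_left_mono) auto
    then have "1 / real (M + 1) \<le> real (M choose k) * (l ^ (M - k) * \<mu> ^ k)" using k(2) by (simp add: a_def mult.assoc)
    then show ?thesis using that[OF kh] by (simp add: M_def)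
  qed
qed

text \<open>A list of n steps with sum n + s is an arrangement of n + s stars and n - 1 = i bars; a
  star weighs l, a bar \<mu>, and \<open>P\<close> is the product times one more \<mu>. By
  \<open>large_binomial_term\<close> the lists of this kind carry a total weight of order at least
  1/h, while P \<le> l^n', so P^(t - 1) wins for t < 1. From i \<le> h follows s \<ge> 0, and one
  extra unit makes the displacement positive.\<close>

lemma basin_dim_ge_1: assumes "1/2 \<le> l" "0 < t" "t < 1" shows "ereal t \<le> hausdorff_dim (Bas l)"
proof -
  have \<theta>: "1 < l powr (t - 1)" using l assms powr_less_mono'[of l "t - 1" 0] by simp
  obtain n' where n': "1 \<le> n'" "1 \<le> 2 * \<mu> * l powr t * (l powr (t - 1)) ^ n' / (4 * real n')"
    using exp_beats_linear[OF \<theta>, of "2 * \<mu> * l powr t"] l \<mu>_bounds by auto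
  define h where "h = n' - 1"
  have h: "n' = h + 1" using n' by (simp add: h_def)
  obtain i where i: "i \<le> h" "1 / real (2 * h + 2) \<le> real ((2 * h + 1) choose i) * (l ^ (2 * h + 1 - i) * \<mu> ^ i)"
    using large_binomial_term[OF assms(1)] by blast
  define n s where "n = i + 1" and "s = 2 * h - 2 * i"
  have ns: "n + s = 2 * h + 1 - i" "(n + s) + n - 1 = 2 * h + 1" using i(1) by (auto simp: n_def s_def)
  define P where "P = r ^ n * l ^ s"
  have P: "P = l ^ (2 * h + 1 - i) * \<mu> ^ i * \<mu>"
    unfolding ns(1)[symmetric] by (simp add: P_def r_def n_def power_add power_mult_distrib mult_ac)
  have P0: "0 < P" using r_bounds l by (simp add: P_def)
  have "card (step_lists n (n + s)) = (2 * h + 1) choose (2 * h + 1 - i)" unfolding step_lists ns(2) unfolding ns(1) ..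
  also have "\<dots> = (2 * h + 1) choose i" using binomial_symmetric[of i "2 * h + 1"] i(1) by simp
  finally have card: "card (step_lists n (n + s)) = (2 * h + 1) choose i" .
  have PC: "\<mu> / real (2 * h + 2) \<le> real (card (step_lists n (n + s))) * P"
    using mult_right_mono[OF i(2), of \<mu>] \<mu>_bounds by (simp add: card P mult.assoc)
  have "\<mu> ^ i * \<mu> \<le> 1" using \<mu>_bounds by (intro mult_le_one) (auto simp: power_le_one)
  then have "P \<le> l ^ (2 * h + 1 - i) * 1" unfolding P mult.assoc using l by (intro mult_left_mono) auto
  also have "\<dots> \<le> l ^ n'" unfolding mult_1_right by (rule lpow_mono) (use i h in simp)
  finally have Ple: "P \<le> l ^ n'" .
  have "(l powr (t - 1)) ^ n' = (l ^ n') powr (t - 1)" using l by (simp add: powr_power_swap)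
  also have "\<dots> \<le> P powr (t - 1)" using P0 Ple assms by (intro powr_mono2') auto
  finally have Pt: "(l powr (t - 1)) ^ n' \<le> P powr (t - 1)" .
  have Psplit: "P powr t = P * P powr (t - 1)" using P0 powr_add[of P 1 "t - 1"] by simp
  show ?thesis
  proof (rule basin_dim_ge_block[of "step_lists n (n + (s + 1))" n "s + 1" "n + 3" t])
    have "1 \<le> \<mu> / real (2 * h + 2) * (l powr (t - 1)) ^ n' * l powr t"
    proof -
      have "2 * \<mu> * l powr t * (l powr (t - 1)) ^ n' / (4 * real n')
          = \<mu> / real (2 * h + 2) * (l powr (t - 1)) ^ n' * l powr t" by (simp add: h field_simps)
      then show ?thesis using n'(2) by simp
    qed
    also have "\<dots> \<le> (real (card (step_lists n (n + s))) * P) * P powr (t - 1) * l powr t"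
      using PC Pt P0 \<mu>_bounds by (intro mult_right_mono mult_mono) auto
    also have "\<dots> = real (card (step_lists n (n + s))) * (P powr t * l powr t)" by (simp add: Psplit mult_ac)
    also have "\<dots> \<le> real (card (step_lists n (n + (s + 1)))) * (P powr t * l powr t)"
      using card_step_lists_Suc[of n "n + s"] by (intro mult_right_mono) (auto simp: n_def)
    also have "P powr t * l powr t = (r ^ n * l ^ (s + 1)) powr t"
      using P0 l by (simp add: powr_mult[symmetric] P_def mult_ac)
    finally show "1 \<le> real (card (step_lists n (n + (s + 1)))) * (r ^ n * l ^ (s + 1)) powr t" .
  qed (use step_lists assms in \<open>auto simp: step_lists_def n_def\<close>)
qed

text \<open>
  For $\lambda < 1/2$ the words from letter 1 to letter 1 are the returns of a positive recurrent
  Markov chain with stationary weights $(\lambda/\mu)^j$: their total length \<open>returns n 1\<close> stays bounded below.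
\<close>

definition return_words :: "nat \<Rightarrow> nat \<Rightarrow> nat list set" where
  "return_words n j = {xs. length xs = n \<and> end_letter xs j = 1}"

definition returns :: "nat \<Rightarrow> nat \<Rightarrow> real" where
  "returns n j = (\<Sum>xs\<in>return_words n j. ratio xs j)"

lemma end_letter_ge: "a \<le> end_letter xs a + length xs"
proof (induction xs arbitrary: a)
  case (Cons x xs)
  have "a \<le> Suc (lowest a + x)" by (auto simp: lowest_def)
  then show ?case using Cons[of "lowest a + x"] by simp
qed simp

lemma step_le_end_letter: "x \<in> set xs \<Longrightarrow> x \<le> end_letter xs a + length xs"
proof (induction xs arbitrary: a)
  case (Cons y xs)
  then show ?case using end_letter_ge[of "lowest a + y" xs] Cons.IH[of "lowest a + y"] by fastforce
qed simp

lemma return_words_bound: "xs \<in> return_words n j \<Longrightarrow> set xs \<subseteq> {..n + 1}"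
  using step_le_end_letter[of _ xs j] by (auto simp: return_words_def)

lemma finite_return_words: "finite (return_words n j)"
proof (rule finite_subset)
  show "return_words n j \<subseteq> {xs. set xs \<subseteq> {..n + 1} \<and> length xs = n}"
    using return_words_bound by (auto simp: return_words_def)
qed (simp add: finite_lists_length_eq)

lemma return_words_empty: assumes "n + 1 < j" shows "return_words n j = {}"
proof -
  have "xs \<notin> return_words n j" for xs
    using end_letter_ge[of j xs] assms by (auto simp: return_words_def)
  then show ?thesis by blast
qed

lemma returns_nonneg: "0 \<le> returns n j"
  unfolding returns_def using ratio_pos by (intro sum_nonneg) (auto simp: less_imp_le)

lemma returns_0: "returns 0 j = (if j = 1 then 1 else 0)"
proof -
  have "return_words 0 j = (if j = 1 then {[]} else {})" by (auto simp: return_words_def)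
  then show ?thesis by (simp add: returns_def)
qed

lemma returns_Suc: "returns (Suc n) j = \<rho> j * (\<Sum>k\<in>{lowest j..n + 1}. returns n k)"
proof -
  let ?h = "\<lambda>(k, xs). (k - lowest j) # xs"
  let ?A = "SIGMA k:{lowest j..n + 1}. return_words n k"
  have "bij_betw ?h ?A (return_words (Suc n) j)"
  proof (rule bij_betw_imageI)
    show "inj_on ?h ?A" by (auto simp: inj_on_def)
    show "?h ` ?A = return_words (Suc n) j"
    proof
      show "?h ` ?A \<subseteq> return_words (Suc n) j" by (auto simp: return_words_def)
      show "return_words (Suc n) j \<subseteq> ?h ` ?A"
      proof
        fix ys assume "ys \<in> return_words (Suc n) j"
        then obtain x xs where ys: "ys = x # xs" "xs \<in> return_words n (lowest j + x)"
          by (cases ys) (auto simp: return_words_def)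
        then have "lowest j + x \<le> n + 1" using return_words_empty[of n "lowest j + x"] by fastforce
        then have "(lowest j + x, xs) \<in> ?A" using ys by auto
        moreover have "ys = ?h (lowest j + x, xs)" using ys by simp
        ultimately show "ys \<in> ?h ` ?A" by blast
      qed
    qed
  qed
  then have "returns (Suc n) j = (\<Sum>p\<in>?A. ratio (?h p) j)"
    unfolding returns_def by (rule sum.reindex_bij_betw[symmetric])
  also have "\<dots> = (\<Sum>p\<in>?A. \<rho> j * ratio (snd p) (fst p))"
    by (rule sum.cong) auto
  also have "\<dots> = \<rho> j * (\<Sum>k\<in>{lowest j..n + 1}. returns n k)"
    unfolding returns_def sum_distrib_left
    by (subst sum.Sigma) (auto simp: finite_return_words case_prod_beta)
  finally show ?thesis .
qed

text \<open>Multiplied by \<mu>, this compares the total length of disjoint cylinders in V_j, each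
  of length ratio times l * \<mu>, with the length l^j * \<mu> of V_j.\<close>

lemma returns_le: "1 \<le> j \<Longrightarrow> returns n j * l \<le> l ^ j"
proof (induction n arbitrary: j)
  case 0
  then show ?case using l by (simp add: returns_0)
next
  case (Suc n)
  have geo: "(\<Sum>k\<in>{a..c}. l ^ k) * \<mu> \<le> l ^ a" for a c
  proof (cases "a \<le> c")
    case True
    have "(\<Sum>k\<in>{a..c}. l ^ k) * \<mu> = l ^ a - l ^ Suc c"
      using sum_gp[of l a c] l True by (simp add: \<mu>_def)
    then show ?thesis using lpow_bounds(1)[of "Suc c"] by linarith
  qed (use l in simp)
  have "returns (Suc n) j * l = \<rho> j * (\<Sum>k\<in>{lowest j..n + 1}. returns n k * l)"
    unfolding returns_Suc sum_distrib_right[symmetric] by (simp only: mult.assoc)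
  also have "\<dots> \<le> \<rho> j * (\<Sum>k\<in>{lowest j..n + 1}. l ^ k)"
    using Suc.IH Suc.prems \<rho>_bounds(1)[of j] by (intro mult_left_mono sum_mono) (auto simp: lowest_def)
  finally have "returns (Suc n) j * l * \<mu> \<le> \<rho> j * ((\<Sum>k\<in>{lowest j..n + 1}. l ^ k) * \<mu>)"
    using \<mu>_bounds by (simp add: mult.assoc[symmetric])
  also have "\<dots> \<le> \<rho> j * l ^ lowest j" by (rule mult_left_mono[OF geo]) (use \<rho>_bounds(1)[of j] in simp)
  also have "\<dots> = l ^ j * \<mu>" by (rule image_length[OF Suc.prems, symmetric])
  finally show ?case using \<mu>_bounds by simp
qed

text \<open>The powers (1/\<mu>)^j form a left eigenvector, with eigenvalue 1, of the matrix with
  entries \<rho> j for lowest j \<le> k; times the lengths l^j they are the stationary weights.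
  Letters above n + 1 cannot reach 1 in n steps.\<close>

lemma returns_stationary: "(\<Sum>j\<in>{1..n + 1}. (1 / \<mu>) ^ j * returns n j) = 1 / \<mu>"
proof (induction n)
  case 0
  show ?case by (simp add: returns_0)
next
  case (Suc n)
  let ?\<beta> = "1 / \<mu>"
  have inner: "(\<Sum>j\<in>{1..k + 1}. ?\<beta> ^ j * \<rho> j) = ?\<beta> ^ k" if "1 \<le> k" for k
    using that
  proof (induction k rule: nat_induct_at_least)
    case base
    have "(\<Sum>j\<in>{1..1 + 1}. ?\<beta> ^ j * \<rho> j) = ?\<beta> * \<mu> + ?\<beta> ^ 2 * r"
      by (simp add: numeral_2_eq_2 \<rho>_def)
    also have "\<dots> = (\<mu> + l) / \<mu>" using \<mu>_bounds by (simp add: r_def field_simps power2_eq_square)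
    finally show ?case using l_\<mu> by (simp add: add.commute)
  next
    case (Suc k)
    have "(\<Sum>j\<in>{1..Suc k + 1}. ?\<beta> ^ j * \<rho> j) = ?\<beta> ^ k + ?\<beta> ^ (k + 2) * r"
      using Suc by (simp add: \<rho>_def)
    also have "\<dots> = ?\<beta> ^ Suc k * (\<mu> + l)" using \<mu>_bounds by (simp add: r_def field_simps)
    finally show ?case using l_\<mu> by (simp add: add.commute)
  qed
  have set: "{j \<in> {1..Suc n + 1}. lowest j \<le> k} = {1..k + 1}" if "k \<in> {1..n + 1}" for k
    using that by (auto simp: lowest_def)
  have "(\<Sum>j\<in>{1..Suc n + 1}. ?\<beta> ^ j * returns (Suc n) j)
      = (\<Sum>j\<in>{1..Suc n + 1}. \<Sum>k\<in>{k \<in> {1..n + 1}. lowest j \<le> k}. ?\<beta> ^ j * \<rho> j * returns n k)"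
  proof (rule sum.cong)
    fix j assume "j \<in> {1..Suc n + 1}"
    then have "{k \<in> {1..n + 1}. lowest j \<le> k} = {lowest j..n + 1}" by (auto simp: lowest_def)
    then show "?\<beta> ^ j * returns (Suc n) j = (\<Sum>k\<in>{k \<in> {1..n + 1}. lowest j \<le> k}. ?\<beta> ^ j * \<rho> j * returns n k)"
      by (simp only: returns_Suc sum_distrib_left mult.assoc)
  qed simp
  also have "\<dots> = (\<Sum>k\<in>{1..n + 1}. \<Sum>j\<in>{j \<in> {1..Suc n + 1}. lowest j \<le> k}. ?\<beta> ^ j * \<rho> j * returns n k)"
    by (rule sum.swap_restrict) auto
  also have "\<dots> = (\<Sum>k\<in>{1..n + 1}. ?\<beta> ^ k * returns n k)"
    using set inner by (intro sum.cong) (auto simp: sum_distrib_right[symmetric])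
  also have "\<dots> = ?\<beta>" by (rule Suc.IH)
  finally show ?case .
qed

text \<open>The step from letter 1 to letter k has ratio \<mu>, and can be put in front of any word
  from k.\<close>

lemma returns_le_Suc_1: "1 \<le> k \<Longrightarrow> \<mu> * returns n k \<le> returns (Suc n) 1"
proof (cases "k \<le> n + 1")
  case True
  assume "1 \<le> k"
  then have "returns n k \<le> (\<Sum>k\<in>{1..n + 1}. returns n k)"
    using True returns_nonneg by (intro member_le_sum) auto
  then show ?thesis using \<mu>_bounds by (simp add: returns_Suc lowest_def \<rho>_def)
next
  case False
  then have "returns n k = 0" by (simp add: returns_def return_words_empty)
  then show ?thesis using returns_nonneg by simp
qed

lemma returns_bounded_below:
  assumes "l < 1/2"
  obtains c where "0 < c" "\<And>n. 1 \<le> n \<Longrightarrow> c \<le> returns n 1"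
proof -
  let ?\<beta> = "1 / \<mu>"
  define q' where "q' = l / \<mu>"
  have q': "0 < q'" "q' < 1" using l \<mu>_bounds assms by (auto simp: q'_def \<mu>_def)
  \<comment> \<open>By \<open>returns_le\<close> the stationary sum beyond M is dominated by a
    geometric series in l / \<mu> < 1; M makes it at most half of the total 1 / \<mu>. The other
    half comes from the finitely many letters up to M, each controlled by the returns from letter
    1.\<close>
  have "0 < l * (1 - q') * ?\<beta> / 2" using l q' \<mu>_bounds by simp
  then obtain M where M: "q' ^ M < l * (1 - q') * ?\<beta> / 2" using real_arch_pow_inv q'(2) by blast
  define A where "A = real M * ?\<beta> ^ M * ?\<beta> + 1"
  have A0: "0 < A" using \<mu>_bounds by (simp add: A_def add_nonneg_pos)
  have low: "?\<beta> / 2 / A \<le> returns (Suc n) 1" for n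
  proof -
    let ?R = "returns (Suc n) 1"
    have le: "?\<beta> ^ j * returns n j \<le> (if j \<le> M then ?\<beta> ^ M * ?\<beta> * ?R else 0) + (if M < j then q' ^ j / l else 0)"
      if "1 \<le> j" for j
    proof (cases "j \<le> M")
      case True
      have "?\<beta> ^ j * returns n j \<le> ?\<beta> ^ M * (?\<beta> * ?R)"
      proof (rule mult_mono)
        show "?\<beta> ^ j \<le> ?\<beta> ^ M" using True \<mu>_bounds by (intro power_increasing) auto
        show "returns n j \<le> ?\<beta> * ?R" using returns_le_Suc_1[OF that, of n] \<mu>_bounds by (simp add: field_simps)
      qed (use \<mu>_bounds returns_nonneg in auto)
      then show ?thesis using True by (simp add: mult.assoc)
    next
      case False
      have "returns n j \<le> l ^ j / l" using returns_le[OF that, of n] l by (simp add: field_simps)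
      then have "?\<beta> ^ j * returns n j \<le> ?\<beta> ^ j * (l ^ j / l)" using \<mu>_bounds by (intro mult_left_mono) auto
      also have "\<dots> = q' ^ j / l" by (simp add: q'_def power_divide)
      finally show ?thesis using False by simp
    qed
    have "?\<beta> = (\<Sum>j\<in>{1..n + 1}. ?\<beta> ^ j * returns n j)" using returns_stationary[of n] by simp
    also have "\<dots> \<le> (\<Sum>j\<in>{1..n + 1}. (if j \<le> M then ?\<beta> ^ M * ?\<beta> * ?R else 0) + (if M < j then q' ^ j / l else 0))"
      using le by (intro sum_mono) auto
    also have "\<dots> = (\<Sum>j\<in>{1..n + 1}. if j \<le> M then ?\<beta> ^ M * ?\<beta> * ?R else 0) + (\<Sum>j\<in>{1..n + 1}. if M < j then q' ^ j / l else 0)"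
      by (rule sum.distrib)
    also have "(\<Sum>j\<in>{1..n + 1}. if j \<le> M then ?\<beta> ^ M * ?\<beta> * ?R else 0) \<le> A * ?R"
    proof -
      have "(\<Sum>j\<in>{1..n + 1}. if j \<le> M then ?\<beta> ^ M * ?\<beta> * ?R else 0) = (\<Sum>j\<in>{j\<in>{1..n + 1}. j \<le> M}. ?\<beta> ^ M * ?\<beta> * ?R)"
        by (rule sum.inter_filter[symmetric]) simp
      also have "\<dots> \<le> (\<Sum>j\<in>{1..M}. ?\<beta> ^ M * ?\<beta> * ?R)"
        using \<mu>_bounds returns_nonneg by (intro sum_mono2) auto
      also have "\<dots> = (A - 1) * ?R" by (simp add: A_def)
      also have "\<dots> \<le> A * ?R" using returns_nonneg[of "Suc n" 1] by (intro mult_right_mono) auto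
      finally show ?thesis .
    qed
    also have "(\<Sum>j\<in>{1..n + 1}. if M < j then q' ^ j / l else 0) \<le> ?\<beta> / 2"
    proof -
      have "(\<Sum>j\<in>{1..n + 1}. if M < j then q' ^ j / l else 0) = (\<Sum>j\<in>{j\<in>{1..n + 1}. M < j}. q' ^ j / l)"
        by (rule sum.inter_filter[symmetric]) simp
      also have "\<dots> \<le> (\<Sum>j\<in>{M..M + n + 1}. q' ^ j / l)"
        using q' l by (intro sum_mono2) auto
      also have "\<dots> = (q' ^ M - q' ^ Suc (M + n + 1)) / (1 - q') / l"
      proof -
        have "(\<Sum>j\<in>{M..K}. q' ^ j / l) = (q' ^ M - q' ^ Suc K) / (1 - q') / l" if "M \<le> K" for K
          using sum_gp[of q' M K] q' that unfolding sum_divide_distrib[symmetric] by simp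
        from this[of "M + n + 1"] show ?thesis by (simp only: le_add1 add.assoc)
      qed
      also have "\<dots> \<le> q' ^ M / (1 - q') / l" using q' l by (intro divide_right_mono) auto
      also have "\<dots> \<le> ?\<beta> / 2" using M q' l by (simp add: field_simps)
      finally show ?thesis .
    qed
    finally have "?\<beta> / 2 \<le> A * ?R" by simp
    then show ?thesis by (subst pos_divide_le_eq[OF A0]) (simp only: mult.commute)
  qed
  show ?thesis
  proof (rule that[of "?\<beta> / 2 / A"])
    show "0 < ?\<beta> / 2 / A" using A0 \<mu>_bounds by simp
    show "?\<beta> / 2 / A \<le> returns n 1" if "1 \<le> n" for n using low[of "n - 1"] that by simp
  qed
qed

lemma ratio_values: "\<exists>k\<le>length xs. ratio xs a = \<mu> ^ k * r ^ (length xs - k)"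
proof (induction xs arbitrary: a)
  case (Cons x xs)
  then obtain k where k: "k \<le> length xs" "ratio xs (lowest a + x) = \<mu> ^ k * r ^ (length xs - k)" by blast
  show ?case
  proof (cases "a \<le> 1")
    case True
    then show ?thesis using k by (intro exI[of _ "Suc k"]) (simp add: \<rho>_def)
  next
    case False
    then show ?thesis using k by (intro exI[of _ k]) (simp add: \<rho>_def Suc_diff_le)
  qed
qed simp

text \<open>A common ratio is required, while words from 1 to 1 have ratios \<mu>^k r^(n-k). These
  are at most n + 1 values, so one class keeps the share c / (n + 1) of the total; as v \<le>
  \<mu>^n, the factor v^(t - 1) outweighs this loss.\<close>

lemma dim_hyp_ge_1: assumes "l < 1/2" "0 < t" "t < 1" shows "ereal t \<le> dim_hyp f"
proof -
  have \<theta>: "1 < \<mu> powr (t - 1)" using \<mu>_bounds assms powr_less_mono'[of \<mu> "t - 1" 0] by simp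
  obtain c where c: "0 < c" "\<And>n. 1 \<le> n \<Longrightarrow> c \<le> returns n 1" using returns_bounded_below[OF assms(1)] by blast
  obtain n where n: "1 \<le> n" "1 \<le> 2 * c * (\<mu> powr (t - 1)) ^ n / (4 * real n)"
    using exp_beats_linear[OF \<theta>, of "2 * c"] c by auto
  let ?X = "return_words n 1"
  let ?V = "(\<lambda>xs. ratio xs 1) ` ?X"
  define C where "C v = {xs \<in> ?X. ratio xs 1 = v}" for v
  have fV: "finite ?V" using finite_return_words by simp
  have "?V \<subseteq> (\<lambda>k. \<mu> ^ k * r ^ (n - k)) ` {..n}"
    using ratio_values by (fastforce simp: return_words_def)
  then have "card ?V \<le> card {..n}" using surj_card_le[of "{..n}" ?V] by simp
  then have cV: "card ?V \<le> n + 1" by simp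
  have sum: "returns n 1 = (\<Sum>v\<in>?V. real (card (C v)) * v)"
  proof -
    have "returns n 1 = (\<Sum>v\<in>?V. \<Sum>xs\<in>C v. ratio xs 1)"
      unfolding returns_def C_def by (rule sum.image_gen[OF finite_return_words])
    also have "\<dots> = (\<Sum>v\<in>?V. real (card (C v)) * v)" by (intro sum.cong) (auto simp: C_def)
    finally show ?thesis .
  qed
  have "\<exists>v\<in>?V. c / (n + 1) \<le> real (card (C v)) * v"
  proof (rule ccontr)
    assume neg: "\<not> ?thesis"
    have "?V \<noteq> {}" using sum c(1) c(2)[OF n(1)] by auto
    then have "(\<Sum>v\<in>?V. real (card (C v)) * v) < (\<Sum>v\<in>?V. c / (n + 1))"
      using neg fV by (intro sum_strict_mono) auto
    also have "\<dots> = real (card ?V) * (c / (n + 1))" by simp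
    also have "\<dots> \<le> real (n + 1) * (c / (n + 1))"
      using cV c(1) by (intro mult_right_mono) (auto simp del: of_nat_add of_nat_Suc)
    also have "\<dots> = c" by simp
    finally show False using sum c(2)[OF n(1)] by simp
  qed
  then obtain v where v: "v \<in> ?V" "c / (n + 1) \<le> real (card (C v)) * v" by blast
  have v0: "0 < v" and vle: "v \<le> \<mu> ^ n" using v(1) ratio_pos ratio_le by (auto simp: return_words_def)
  have "(\<mu> powr (t - 1)) ^ n = (\<mu> ^ n) powr (t - 1)" using \<mu>_bounds by (simp add: powr_power_swap)
  also have "\<dots> \<le> v powr (t - 1)" using v0 vle assms by (intro powr_mono2') auto
  finally have vt: "(\<mu> powr (t - 1)) ^ n \<le> v powr (t - 1)" .
  have vsplit: "v powr t = v * v powr (t - 1)" using v0 powr_add[of v 1 "t - 1"] by simp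
  show ?thesis
  proof (rule dim_hyp_ge_block[of "C v" 1 n "n + 1" v t])
    show "finite (C v)" using finite_return_words by (simp add: C_def)
    show "length xs = n \<and> set xs \<subseteq> {..n + 1} \<and> end_letter xs 1 = 1 \<and> ratio xs 1 = v" if "xs \<in> C v" for xs
      using that return_words_bound[of xs n 1] by (auto simp: C_def return_words_def)
    have "2 * c * (\<mu> powr (t - 1)) ^ n / (4 * real n) = c / (2 * real n) * (\<mu> powr (t - 1)) ^ n" by simp
    also have "\<dots> \<le> c / (n + 1) * (\<mu> powr (t - 1)) ^ n"
      using n(1) c(1) by (intro mult_right_mono divide_left_mono) auto
    also have "\<dots> \<le> (real (card (C v)) * v) * v powr (t - 1)"
      using v(2) vt c(1) v0 by (intro mult_mono) auto
    also have "\<dots> = real (card (C v)) * v powr t" by (simp add: vsplit)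
    finally show "1 \<le> real (card (C v)) * v powr t" using n(2) by simp
  qed (use n assms in auto)
qed

end

section \<open>Combining upper and lower bounds\<close>

lemma ereal_le_if_all_less:
  assumes "0 < a" "\<And>t. 0 < t \<Longrightarrow> t < a \<Longrightarrow> ereal t \<le> x"
  shows "ereal a \<le> x"
proof (rule dense_le)
  fix z assume z: "z < ereal a"
  show "z \<le> x"
  proof (cases "z \<le> ereal (a / 2)")
    case True
    also have "ereal (a / 2) \<le> x" using assms by simp
    finally show ?thesis .
  next
    case False
    then obtain u where "z = ereal u" "a / 2 < u" using z by (cases z) auto
    then show ?thesis using assms z by simp
  qed
qed

lemma basin_dim:
  assumes "0 < p" "p < 1"
  shows "hausdorff_dim (Bas p) = ereal (if 1/2 \<le> p then 1 else t2 p)"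
proof -
  interpret fib_map p by standard (use assms in auto)
  show ?thesis
  proof (cases "1/2 \<le> p")
    case True
    have "hausdorff_dim (Bas p) \<le> ereal 1" by (rule hausdorff_dim_unit_interval_le) (auto simp: Bas_def)
    moreover have "ereal 1 \<le> hausdorff_dim (Bas p)"
      by (rule ereal_le_if_all_less) (use basin_dim_ge_1[OF True] in auto)
    ultimately show ?thesis using True by simp
  next
    case False
    then have "hausdorff_dim (Bas p) \<le> ereal (t2 p)" by (intro basin_dim_le) simp
    moreover have "ereal (t2 p) \<le> hausdorff_dim (Bas p)"
      by (rule ereal_le_if_all_less) (use basin_dim_ge_t2 r_powr_t2(2) in auto)
    ultimately show ?thesis using False by simp
  qed
qed

lemma hyperbolic_dim:
  assumes "0 < p" "p < 1"
  shows "dim_hyp (fmap p) = ereal (t1 p)"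
proof -
  interpret fib_map p by standard (use assms in auto)
  consider "p < 1/2" | "p = 1/2" | "1/2 < p" by linarith
  then show ?thesis
  proof cases
    case 1
    have "dim_hyp (fmap p) \<le> ereal 1"
      unfolding dim_hyp_def by (intro SUP_least hausdorff_dim_unit_interval_le) (auto simp: hyperbolic_set_def)
    moreover have "ereal 1 \<le> dim_hyp (fmap p)"
      by (rule ereal_le_if_all_less) (use dim_hyp_ge_1[OF 1] in auto)
    ultimately show ?thesis using 1 by (simp add: t1_def)
  next
    \<comment> \<open>At p = 1/2 the geometric tail behind \<open>dim_hyp_ge_1\<close> has ratio 1
      and that argument fails, but t2 = 1, so the two bounds by t2 suffice.\<close>
    case 2
    have "dim_hyp (fmap p) \<le> ereal (t2 p)"
      unfolding dim_hyp_def using 2 hyperbolic_dim_le by (intro SUP_least) auto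
    moreover have "ereal (t2 p) \<le> dim_hyp (fmap p)"
      by (rule ereal_le_if_all_less) (use dim_hyp_ge_t2 r_powr_t2(2) in auto)
    moreover have "t2 p = 1" using t2_half unfolding 2 .
    moreover have "t1 p = 1" using 2 by (simp add: t1_def)
    ultimately show ?thesis by simp
  next
    case 3
    have "dim_hyp (fmap p) \<le> ereal (t2 p)"
      unfolding dim_hyp_def using 3 hyperbolic_dim_le by (intro SUP_least) auto
    moreover have "ereal (t2 p) \<le> dim_hyp (fmap p)"
      by (rule ereal_le_if_all_less) (use dim_hyp_ge_t2 r_powr_t2(2) in auto)
    ultimately show ?thesis using 3 by (simp add: t1_def)
  qed
qed

theorem theorem2:
  fixes lam :: real
  assumes "lam \<in> {0<..<1}"
  shows "dim_hyp (fmap lam) = hausdorff_dim (Bas (1 - lam)) \<and>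
         hausdorff_dim (Bas (1 - lam)) = ereal (t1 lam)"
proof -
  \<comment> \<open>The product lam * (1 - lam) is symmetric, so both maps share t2, and 1/2 \<le> 1
    - lam is the condition lam \<le> 1/2 of \<open>t1\<close>.\<close>
  have "t2 (1 - lam) = t2 lam" by (simp add: t2_def mult.commute)
  then have "hausdorff_dim (Bas (1 - lam)) = ereal (t1 lam)"
    using basin_dim[of "1 - lam"] assms by (auto simp: t1_def)
  then show ?thesis using hyperbolic_dim[of lam] assms by simp
qed

end
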